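(* Assume that $d\ge2$ and that $\beta,D,b,K$ satisfy hypotheses (i)–(v) listed in the context. Let $T>0$, $Q_T=(0,T)\times\mathbb R^d$, and let $u_1,u_2\in L^1(Q_T)\cap L^\infty(Q_T)$ be two distributional solutions on $Q_T$ to $$\frac{\partial u}{\partial t}-\Delta\beta(u)+\mathrm{div}\big((D\,b(u)+K*u)\,u\big)=0,\qquad u(0,x)=u_0(x),$$ (with the same initial datum $u_0$) such that $$\lim_{t\downarrow 0}\ \operatorname*{ess\,sup}_{s\in(0,t)}\int_{\mathbb R^d}(u_1(s,x)-u_2(s,x))\psi(x)\,dx=0,\qquad\forall\psi\in C_0^\infty(\mathbb R^d).$$ Then $u_1\equiv u_2$.
   Context: Notation. $L^p=L^p(\mathbb R^d)$; $*$ is convolution in the space variable; $B_1=\{x\in\mathbb R^d:|x|\le 1\}$, $B_1^c=\{x\in\mathbb R^d:|x|>1\}$; $f^-$ denotes the negative part of $f$; $C_0^\infty$ denotes smooth functions with compact support. Hypotheses on $\beta:\mathbb R\to\mathbb R$, $D:\mathbb R^d\to\mathbb R^d$, $b:\mathbb R\to\mathbb R$, $K:\mathbb R^d\to\mathbb R^d$: (i) $\beta\in C^1(\mathbb R)$, $\beta(0)=0$, and there is $\alpha>0$ with $\beta'(r)\ge\alpha$ for all $r\in\mathbb R$. (ii) $D\in L^\infty(\mathbb R^d;\mathbb R^d)\cap L^2(\mathbb R^d;\mathbb R^d)$ and $(\mathrm{div}\,D)^-=0$ (that is, $\mathrm{div}\,D\ge 0$ in the sense of distributions). (iii) $b\in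 C^1(\mathbb R)$, $b(r)\ge 0$ for all $r\in\mathbb R$. (iv) $K\in C^1(\mathbb R^d\setminus\{0\};\mathbb R^d)\cap L^1(B_1;\mathbb R^d)\cap L^p(B_1^c;\mathbb R^d)$ for some $1\le p\le 2$, $(\mathrm{div}\,K)^-\in L^\infty(\mathbb R^d)$ (with $\mathrm{div}\,K$ the divergence on $\mathbb R^d\setminus\{0\}$), and the function $x\mapsto (K(x)\cdot x)^-|x|^{-1}$ belongs to $L^\infty(B_1)$. (v) $K\in L^\infty(B_1^c;\mathbb R^d)$. Distributional solution. Let $u_0\in L^1_{\rm loc}(\mathbb R^d)$. A function $u\in L^1_{\rm loc}([0,T)\times\mathbb R^d)$ is a distributional solution on $Q_T$ with initial datum $u_0$ if $\beta(u)\in L^1_{\rm loc}(Q_T)$, $(D\,b(u)+K*u)u\in L^1_{\rm loc}(Q_T;\mathbb R^d)$, and for all $\varphi\in C_0^\infty([0,T)\times\mathbb R^d)$, $$\int_{Q_T}\Big(u\,\frac{\partial\varphi}{\partial t}+\beta(u)\Delta\varphi+u\,\big(D(x)b(u(t,x))+(K*u(t,\cdot))(x)\big)\cdot\nabla\varphi\Big)\,dt\,dx+\int_{\mathbb R^d}u_0(x)\varphi(0,x)\,dx=0.$$ *)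

theory Defs
  imports "HOL-Analysis.Analysis" "HOL-Probability.Essential_Supremum"
begin

text \<open>
  All functions are total; a function on \<open>S\<close> is represented by any total extension, and no notion
  below depends on the values outside \<open>S\<close> (up to null sets for the measure-theoretic ones).
  Elements of the Lebesgue spaces are represented by functions rather than by classes.
\<close>

definition Lp_on :: "real \<Rightarrow> 'a::euclidean_space set \<Rightarrow> ('a \<Rightarrow> 'b::euclidean_space) set" where
  "Lp_on p S = {f \<in> borel_measurable (lebesgue_on S).
                  integrable (lebesgue_on S) (\<lambda>x. norm (f x) powr p)}"

definition Linf_on :: "'a::euclidean_space set \<Rightarrow> ('a \<Rightarrow> 'b::euclidean_space) set" where
  "Linf_on S = {f \<in> borel_measurable (lebesgue_on S).
                  \<exists>C. AE x in lebesgue_on S. norm (f x) \<le> C}"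

definition L1loc_on :: "'a::euclidean_space set \<Rightarrow> ('a \<Rightarrow> 'b::euclidean_space) set" where
  "L1loc_on S = {f. \<forall>C. compact C \<and> C \<subseteq> S \<longrightarrow> integrable (lebesgue_on C) f}"

definition neg_part :: "real \<Rightarrow> real" where
  "neg_part r = max 0 (- r)"

text \<open>
  Derivatives are taken relative to \<open>S\<close>, so that smoothness on \<open>[0,T) \<times> \<real>\<^sup>d\<close> means smoothness up to
  the face \<open>t = 0\<close>. The definition is meant for sets on which the relative derivative is unique,
  such as open sets or convex sets with nonempty interior.
\<close>

primrec Ck_on :: "nat \<Rightarrow> 'a::euclidean_space set \<Rightarrow> ('a \<Rightarrow> 'b::euclidean_space) \<Rightarrow> bool" where
  "Ck_on 0 S f \<longleftrightarrow> continuous_on S f"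
| "Ck_on (Suc k) S f \<longleftrightarrow>
     f differentiable_on S \<and> (\<forall>v. Ck_on k S (\<lambda>x. frechet_derivative f (at x within S) v))"

text \<open>The support may meet the part of the boundary of \<open>S\<close> that belongs to \<open>S\<close>.\<close>

definition test_functions :: "'a::euclidean_space set \<Rightarrow> ('a \<Rightarrow> real) set" where
  "test_functions S = {\<phi>. (\<forall>k. Ck_on k S \<phi>) \<and>
     compact (closure {x \<in> S. \<phi> x \<noteq> 0}) \<and> closure {x \<in> S. \<phi> x \<noteq> 0} \<subseteq> S}"

definition grad :: "(real^'n \<Rightarrow> real) \<Rightarrow> real^'n \<Rightarrow> real^'n" where
  "grad f x = (\<chi> i. frechet_derivative f (at x) (axis i 1))"

definition divergence :: "(real^'n \<Rightarrow> real^'n) \<Rightarrow> real^'n \<Rightarrow> real" where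
  "divergence F x = (\<Sum>i\<in>UNIV. frechet_derivative F (at x) (axis i 1) $ i)"

definition laplacian :: "(real^'n \<Rightarrow> real) \<Rightarrow> real^'n \<Rightarrow> real" where
  "laplacian f = divergence (grad f)"

definition distr_divergence :: "(real^'n \<Rightarrow> real^'n) \<Rightarrow> (real^'n \<Rightarrow> real) \<Rightarrow> real" where
  "distr_divergence F \<phi> = - (LINT x|lebesgue. F x \<bullet> grad \<phi> x)"

definition distr_divergence_nonneg :: "(real^'n \<Rightarrow> real^'n) \<Rightarrow> bool" where
  "distr_divergence_nonneg F \<longleftrightarrow>
     (\<forall>\<phi>\<in>test_functions UNIV. (\<forall>x. 0 \<le> \<phi> x) \<longrightarrow> 0 \<le> distr_divergence F \<phi>)"

definition convolve :: "(real^'n \<Rightarrow> real^'n) \<Rightarrow> (real^'n \<Rightarrow> real) \<Rightarrow> real^'n \<Rightarrow> real^'n" where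
  "convolve K v x = (LINT y|lebesgue. v y *\<^sub>R K (x - y))"

definition QT :: "real \<Rightarrow> (real \<times> (real^'n)) set" where
  "QT T = {0<..<T} \<times> UNIV"

definition drift ::
  "(real^'n \<Rightarrow> real^'n) \<Rightarrow> (real \<Rightarrow> real) \<Rightarrow> (real^'n \<Rightarrow> real^'n) \<Rightarrow>
   (real \<times> (real^'n) \<Rightarrow> real) \<Rightarrow> real \<times> (real^'n) \<Rightarrow> real^'n" where
  "drift D b K u = (\<lambda>(t, x). b (u (t, x)) *\<^sub>R D x + convolve K (\<lambda>y. u (t, y)) x)"

text \<open>
  Test functions do not have to vanish near \<open>t = 0\<close>, so the local integrability over the open set
  \<open>QT T\<close> does not by itself make the integrand below integrable. For \<open>u\<close> in \<open>L\<^sup>1 \<inter> L\<^sup>\<infinity>\<close> over \<open>QT T\<close>,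
  \<open>D\<close> bounded and \<open>K\<close> integrable near and bounded away from the origin it always is.
\<close>

definition distributional_solution ::
  "(real \<Rightarrow> real) \<Rightarrow> (real^'n \<Rightarrow> real^'n) \<Rightarrow> (real \<Rightarrow> real) \<Rightarrow> (real^'n \<Rightarrow> real^'n) \<Rightarrow>
   real \<Rightarrow> (real^'n \<Rightarrow> real) \<Rightarrow> (real \<times> (real^'n) \<Rightarrow> real) \<Rightarrow> bool" where
  "distributional_solution \<beta> D b K T u0 u \<longleftrightarrow>
     u \<in> L1loc_on ({0..<T} \<times> UNIV) \<and>
     (\<lambda>z. \<beta> (u z)) \<in> L1loc_on (QT T) \<and>
     (\<lambda>z. u z *\<^sub>R drift D b K u z) \<in> L1loc_on (QT T) \<and>
     (\<forall>\<phi>\<in>test_functions ({0..<T} \<times> UNIV).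
        (LINT (t, x)|lebesgue_on (QT T).
            u (t, x) * deriv (\<lambda>s. \<phi> (s, x)) t
          + \<beta> (u (t, x)) * laplacian (\<lambda>y. \<phi> (t, y)) x
          + u (t, x) * (drift D b K u (t, x) \<bullet> grad (\<lambda>y. \<phi> (t, y)) x))
        + (LINT x|lebesgue. u0 x * \<phi> (0, x)) = 0)"

end

theory Submission
  imports Defs "HOL-Probability.Probability"
begin

text \<open>
  Write \<open>z = u\<^sub>1 - u\<^sub>2\<close>, \<open>w = \<beta>(u\<^sub>1) - \<beta>(u\<^sub>2)\<close> and let \<open>F\<close> be the difference of the two fluxes
  \<open>u (D b(u) + K * u)\<close>. Both solutions start from \<open>u\<^sub>0\<close> and test functions reach down to \<open>t = 0\<close>, so
  subtracting the weak formulations leaves \<open>\<partial>\<^sub>t z = \<Delta>w - div F\<close> with initial value zero. The proof is an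
  energy estimate for \<open>z\<close> in \<open>H\<^sup>-\<^sup>1\<close>, where the energy is read off on the Fourier side as
  \<open>\<integral> |z^(t,\<xi>)|\<^sup>2 / (1 + |\<xi>|\<^sup>2) d\<xi>\<close> with \<open>z^\<close> the transform of \<open>z(t)\<close>. Differentiating it in time, \<open>\<Delta>w\<close>
  contributes \<open>-2 \<integral> z w\<close> up to a term of lower order. This is at most \<open>-2\<alpha> \<integral> z\<^sup>2\<close> because \<open>\<beta>' \<ge> \<alpha>\<close>; the
  divergence of \<open>F\<close> costs the square root of the energy times the \<open>L\<^sup>2\<close> norm of \<open>F(t)\<close>. Hence, if
  \<open>\<integral> |F(t)|\<^sup>2 \<le> G(t) \<integral> z(t)\<^sup>2\<close>, Young's inequality absorbs every \<open>L\<^sup>2\<close> norm of \<open>z\<close> into the coercive term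
  and the energy grows at most at a rate \<open>\<mu>(t) = C (1 + G(t))\<close>. It starts from zero, so it vanishes as
  soon as \<open>\<mu>\<close> is integrable on \<open>(0,T)\<close>.

  The flux bound comes from splitting \<open>K\<close> into a part near the origin, which is in \<open>L\<^sup>1\<close>, and a part away
  from it, which is in \<open>L\<^sup>2\<close> since it is bounded and in \<open>L\<^sup>p\<close> with \<open>p \<le> 2\<close>. The first maps \<open>L\<^sup>2\<close> to \<open>L\<^sup>2\<close> and
  \<open>L\<^sup>\<infinity>\<close> to \<open>L\<^sup>\<infinity>\<close>, the second maps \<open>L\<^sup>2\<close> to \<open>L\<^sup>\<infinity>\<close>. As the solutions are bounded, their squared \<open>L\<^sup>2\<close> norms
  are controlled by their \<open>L\<^sup>1\<close> norms, so that \<open>G(t)\<close> can be taken to be a multiple of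
  \<open>1 + \<parallel>u\<^sub>1(t)\<parallel>\<^sub>1 + \<parallel>u\<^sub>2(t)\<parallel>\<^sub>1\<close>. This is integrable in time but not known to be bounded, which is why Gronwall's
  inequality is needed with an integrable coefficient.

  Two difficulties remain. First, \<open>F\<close> is not known to be integrable over \<open>(0,T) \<times> \<real>\<^sup>d\<close>, so an exponential cannot
  serve as a test function even in the limit. Everything is therefore done for \<open>\<chi>\<^sub>R z\<close> with a smooth cutoff
  \<open>\<chi>\<^sub>R(x) = \<chi>(x/R)\<close>. The commutators with \<open>\<chi>\<^sub>R\<close> are estimated like \<open>F\<close> itself, uniformly in \<open>R \<ge> 1\<close>, and the
  only error left is a multiple of \<open>\<integral>\<integral> (1 - \<chi>\<^sub>R\<^sup>2) z\<^sup>2\<close>, which tends to zero as \<open>R\<close> grows. Secondly, the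
  distributional equation has to give an identity for almost every time: tested with a product
  \<open>\<theta>(t) \<psi>(x)\<close>, it says that \<open>\<integral> z(t) \<psi>\<close> is almost everywhere the primitive of an integrable function.

  The lemmas that carry the argument are \<open>ft_plancherel\<close> and \<open>ft_L2_bound\<close> (Plancherel),
  \<open>primitive_of_weak_derivative\<close> and \<open>prim_square\<close> (calculus in time), \<open>spectral_energy_bound\<close> and
  \<open>energy_inequality\<close> (the estimate), \<open>gronwall_L1\<close>, and \<open>conv_weighted\<close> (the nonlocal drift).
\<close>

section \<open>Integration on Euclidean space\<close>

lemma integrable_mult_bounded:
  fixes f :: "'a \<Rightarrow> 'b::{banach,second_countable_topology}" and h :: "'a \<Rightarrow> real"
  assumes "integrable M f" and [measurable]: "h \<in> borel_measurable M" and "\<And>x. \<bar>h x\<bar> \<le> B"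
  shows "integrable M (\<lambda>x. h x *\<^sub>R f x)"
proof (rule Bochner_Integration.integrable_bound)
  show "integrable M (\<lambda>x. B *\<^sub>R f x)" using assms(1) by simp
  have [measurable]: "f \<in> borel_measurable M" using assms(1) by simp
  show "(\<lambda>x. h x *\<^sub>R f x) \<in> borel_measurable M" by measurable
  show "AE x in M. norm (h x *\<^sub>R f x) \<le> norm (B *\<^sub>R f x)"
    using assms(3) by (intro AE_I2) (simp, intro mult_right_mono order_trans[OF assms(3) abs_ge_self] norm_ge_zero)
qed

lemma lborel_integral_affine:
  fixes f :: "'a::euclidean_space \<Rightarrow> 'b::{banach,second_countable_topology}"
  assumes [measurable]: "f \<in> borel_measurable borel" and c: "c \<noteq> 0"
  shows "(LBINT x. f x) = \<bar>c\<bar> ^ DIM('a) *\<^sub>R (LBINT x. f (t + c *\<^sub>R x))"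
  by (subst lborel_affine[OF c, of t]) (simp add: integral_density integral_distr)

lemma nn_integral_lborel_translate_reflect:
  fixes f :: "'a::euclidean_space \<Rightarrow> ennreal"
  assumes [measurable]: "f \<in> borel_measurable borel"
  shows "(\<integral>\<^sup>+x. f (t + x) \<partial>lborel) = (\<integral>\<^sup>+x. f x \<partial>lborel)"
    and "(\<integral>\<^sup>+x. f (t - x) \<partial>lborel) = (\<integral>\<^sup>+x. f x \<partial>lborel)"
  subgoal by (subst (2) lborel_affine[of 1 t]) (simp_all add: nn_integral_density nn_integral_distr)
  subgoal by (subst (2) lborel_affine[of "-1" t]) (simp_all add: nn_integral_density nn_integral_distr)
  done

lemma integrable_lborel_translate_reflect:
  fixes f :: "'a::euclidean_space \<Rightarrow> 'b::{banach,second_countable_topology}"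
  assumes "integrable lborel f"
  shows "integrable lborel (\<lambda>x. f (t + x))" and "integrable lborel (\<lambda>x. f (t - x))"
proof -
  have [measurable]: "f \<in> borel_measurable borel" using assms by simp
  show "integrable lborel (\<lambda>x. f (t + x))" "integrable lborel (\<lambda>x. f (t - x))"
    using assms nn_integral_lborel_translate_reflect[of "\<lambda>x. ennreal (norm (f x))" t]
    by (simp_all add: integrable_iff_bounded)
qed

lemma integral_lborel_translate_reflect:
  fixes f :: "'a::euclidean_space \<Rightarrow> 'b::{banach,second_countable_topology}"
  assumes "f \<in> borel_measurable borel"
  shows "(LBINT x. f (t + x)) = (LBINT x. f x)"
    and "(LBINT x. f (t - x)) = (LBINT x. f x)"
  using lborel_integral_affine[OF assms, of 1 t] lborel_integral_affine[OF assms, of "-1" t] by simp_all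

lemma integrable_lborel_tensor:
  fixes f :: "'a::euclidean_space \<Rightarrow> real" and g :: "'b::euclidean_space \<Rightarrow> real"
  assumes "integrable lborel f" "integrable lborel g"
  shows "integrable lborel (\<lambda>p. f (fst p) * g (snd p))"
proof -
  have [measurable]: "f \<in> borel_measurable borel" "g \<in> borel_measurable borel" using assms by simp_all
  have "integrable (lborel \<Otimes>\<^sub>M lborel) (\<lambda>p. f (fst p) * g (snd p))"
  proof (rule lborel_pair.Fubini_integrable)
    show "integrable lborel (\<lambda>x. LBINT y. norm (f (fst (x, y)) * g (snd (x, y))))"
      using assms by (simp add: abs_mult)
  qed (use assms in auto)
  then show ?thesis by (simp add: lborel_prod)
qed

section \<open>The Fourier transform of the Gaussian\<close>

definition gauss_mass :: "'a::euclidean_space itself \<Rightarrow> real" where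
  "gauss_mass _ = sqrt (2 * pi) ^ DIM('a)"

lemma gauss_mass_pos: "gauss_mass TYPE('a::euclidean_space) > 0"
  by (simp add: gauss_mass_def)

lemma gauss_fourier_real:
  fixes s :: real
  shows "integrable lborel (\<lambda>x::real. exp (- x\<^sup>2 / 2) *\<^sub>R cis (s * x))"
    and "(LBINT x. exp (- x\<^sup>2 / 2) *\<^sub>R cis (s * x)) = complex_of_real (sqrt (2 * pi) * exp (- s\<^sup>2 / 2))"
proof -
  have e: "exp (- x\<^sup>2 / 2) = sqrt (2 * pi) * std_normal_density x" for x :: real
    by (simp add: normal_density_def)
  have i: "integrable lborel (\<lambda>x. std_normal_density x *\<^sub>R cis (s * x))"
    by (rule Bochner_Integration.integrable_bound[OF integrable_normal_density[of 1 0]])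
       (auto intro!: borel_measurable_continuous_onI continuous_intros simp: cis_conv_exp)
  have "(LBINT x. std_normal_density x *\<^sub>R cis (s * x)) = char std_normal_distribution s"
    unfolding char_def
    by (subst integral_density) (auto simp: cis_conv_exp normal_density_nonneg intro!: borel_measurable_continuous_onI continuous_intros)
  then have v: "(LBINT x. std_normal_density x *\<^sub>R cis (s * x)) = complex_of_real (exp (- s\<^sup>2 / 2))"
    by (simp add: char_std_normal_distribution)
  show "integrable lborel (\<lambda>x::real. exp (- x\<^sup>2 / 2) *\<^sub>R cis (s * x))"
    unfolding e scaleR_scaleR[symmetric] using i by (rule integrable_scaleR_right)
  show "(LBINT x. exp (- x\<^sup>2 / 2) *\<^sub>R cis (s * x)) = complex_of_real (sqrt (2 * pi) * exp (- s\<^sup>2 / 2))"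
    unfolding e scaleR_scaleR[symmetric] integral_scaleR_right v by (simp add: scaleR_conv_of_real)
qed

lemma prod_cis: "(\<Prod>b\<in>A. cis (f b)) = cis (\<Sum>b\<in>A. f b)"
  by (induction A rule: infinite_finite_induct) (auto simp: cis_mult)

text \<open>
  The Gaussian and the exponential both factor over the coordinates, so this reduces to the
  characteristic function of the normal distribution on the line.
\<close>

lemma gauss_fourier:
  fixes s :: "'a::euclidean_space"
  shows "integrable lborel (\<lambda>x::'a. exp (- (norm x)\<^sup>2 / 2) *\<^sub>R cis (s \<bullet> x))"
    and "(LBINT x. exp (- (norm x)\<^sup>2 / 2) *\<^sub>R cis (s \<bullet> x)) =
           complex_of_real (gauss_mass TYPE('a) * exp (- (norm s)\<^sup>2 / 2))"
proof -
  let ?M = "\<lambda>b::'a. interval_measure (\<lambda>x. x)"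
  let ?h = "\<lambda>b x. exp (- x\<^sup>2 / 2) *\<^sub>R cis ((s \<bullet> b) * x)"
  have M: "?M b = lborel" for b by (simp add: lborel_eq_real)
  interpret product_sigma_finite ?M
    unfolding product_sigma_finite_def M by (intro allI lborel.sigma_finite_measure_axioms)
  have "exp (- (norm x)\<^sup>2 / 2) *\<^sub>R cis (s \<bullet> x) = (\<Prod>b\<in>Basis. ?h b (x \<bullet> b))" for x :: 'a
  proof -
    have "(norm x)\<^sup>2 = (\<Sum>b\<in>Basis. (x \<bullet> b)\<^sup>2)"
      by (subst power2_norm_eq_inner, subst euclidean_inner) (simp add: power2_eq_square)
    moreover have "s \<bullet> x = (\<Sum>b\<in>Basis. (s \<bullet> b) * (x \<bullet> b))" by (rule euclidean_inner)
    moreover have "(\<Prod>b\<in>Basis. ?h b (x \<bullet> b)) =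
        complex_of_real (\<Prod>b\<in>Basis. exp (- (x \<bullet> b)\<^sup>2 / 2)) * (\<Prod>b\<in>Basis. cis ((s \<bullet> b) * (x \<bullet> b)))"
      by (simp only: scaleR_conv_of_real prod.distrib of_real_prod)
    moreover have "(\<Prod>b\<in>Basis. exp (- (x \<bullet> b)\<^sup>2 / 2)) = exp (- (\<Sum>b\<in>Basis. (x \<bullet> b)\<^sup>2) / 2)"
      by (simp only: exp_sum[OF finite_Basis, symmetric] sum_divide_distrib[symmetric] sum_negf)
    ultimately show ?thesis
      by (simp only: scaleR_conv_of_real prod_cis)
  qed
  note split = this
  have comp: "(\<Sum>b\<in>Basis. f b *\<^sub>R b) \<bullet> b' = f b'" if "b' \<in> Basis" for f and b' :: 'a
    using that by simp
  have meas: "(\<lambda>f. \<Sum>b\<in>Basis. f b *\<^sub>R b) \<in> measurable (Pi\<^sub>M Basis ?M) (borel :: 'a measure)"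
    by (auto simp: M)
  have hmeas: "(\<lambda>x. \<Prod>b\<in>Basis. ?h b (x \<bullet> b)) \<in> borel_measurable (borel :: 'a measure)"
    by (auto intro!: borel_measurable_continuous_onI continuous_intros simp: cis_conv_exp)
  have i: "integrable (?M b) (?h b)" for b unfolding M by (rule gauss_fourier_real)
  show "integrable lborel (\<lambda>x::'a. exp (- (norm x)\<^sup>2 / 2) *\<^sub>R cis (s \<bullet> x))"
    unfolding split lborel_def integrable_distr_eq[OF meas hmeas]
    using product_integrable_prod[of Basis ?h] i by (simp add: comp cong: prod.cong)
  have "(LBINT x. exp (- (norm x)\<^sup>2 / 2) *\<^sub>R cis (s \<bullet> x)) = (\<Prod>b\<in>Basis. LINT x|?M b. ?h b x)"
    unfolding split lborel_def integral_distr[OF meas hmeas]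
    using product_integral_prod[of Basis ?h] i by (simp add: comp cong: prod.cong)
  also have "\<dots> = (\<Prod>b\<in>Basis. complex_of_real (sqrt (2 * pi) * exp (- (s \<bullet> b)\<^sup>2 / 2)))"
    unfolding M gauss_fourier_real(2) ..
  also have "\<dots> = complex_of_real (gauss_mass TYPE('a) * exp (- (norm s)\<^sup>2 / 2))"
  proof -
    have "(norm s)\<^sup>2 = (\<Sum>b\<in>Basis. (s \<bullet> b)\<^sup>2)"
      by (subst power2_norm_eq_inner, subst euclidean_inner) (simp add: power2_eq_square)
    moreover have "(\<Prod>b\<in>Basis. exp (- (s \<bullet> b)\<^sup>2 / 2)) = exp (- (\<Sum>b\<in>Basis. (s \<bullet> b)\<^sup>2) / 2)"
      by (simp only: exp_sum[OF finite_Basis, symmetric] sum_divide_distrib[symmetric] sum_negf)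
    ultimately show ?thesis
      by (simp only: of_real_prod[symmetric] prod.distrib gauss_mass_def prod_constant)
  qed
  finally show "(LBINT x. exp (- (norm x)\<^sup>2 / 2) *\<^sub>R cis (s \<bullet> x)) =
           complex_of_real (gauss_mass TYPE('a) * exp (- (norm s)\<^sup>2 / 2))" .
qed

lemma gauss_fourier_cos:
  fixes s :: "'a::euclidean_space"
  shows "integrable lborel (\<lambda>x::'a. exp (- (norm x)\<^sup>2 / 2))"
    and "(LBINT x. exp (- (norm x)\<^sup>2 / 2) * cos (s \<bullet> x)) = gauss_mass TYPE('a) * exp (- (norm s)\<^sup>2 / 2)"
    and "(LBINT x::'a. exp (- (norm x)\<^sup>2 / 2)) = gauss_mass TYPE('a)"
proof -
  have c: "(LBINT x. exp (- (norm x)\<^sup>2 / 2) * cos (s \<bullet> x)) = gauss_mass TYPE('a) * exp (- (norm s)\<^sup>2 / 2)" for s :: 'a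
    using arg_cong[OF gauss_fourier(2)[of s], of Re] integral_Re[OF gauss_fourier(1)[of s]] by simp
  show "(LBINT x. exp (- (norm x)\<^sup>2 / 2) * cos (s \<bullet> x)) = gauss_mass TYPE('a) * exp (- (norm s)\<^sup>2 / 2)"
    by (rule c)
  show "integrable lborel (\<lambda>x::'a. exp (- (norm x)\<^sup>2 / 2))"
    using integrable_Re[OF gauss_fourier(1)[of "0::'a"]] by simp
  show "(LBINT x::'a. exp (- (norm x)\<^sup>2 / 2)) = gauss_mass TYPE('a)" using c[of 0] by simp
qed

section \<open>Continuity of translations in the mean\<close>

text \<open>
  Continuity at zero of \<open>y \<mapsto> f(\<cdot> - y)\<close> in \<open>L\<^sup>1\<close>, in sequential form, so that the dominated convergence
  theorem applies directly.
\<close>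

definition translation_continuous :: "('a::euclidean_space \<Rightarrow> real) \<Rightarrow> bool" where
  "translation_continuous f \<longleftrightarrow>
     (\<forall>Y. Y \<longlonglongrightarrow> 0 \<longrightarrow> (\<lambda>n. LBINT x. \<bar>f (x - Y n) - f x\<bar>) \<longlonglongrightarrow> 0)"

lemma integrable_lborel_shift:
  fixes f :: "'a::euclidean_space \<Rightarrow> 'b::{banach,second_countable_topology}"
  assumes "integrable lborel f"
  shows "integrable lborel (\<lambda>x. f (x - y))"
  using integrable_lborel_translate_reflect(1)[OF assms, of "- y"] by simp

lemma integral_lborel_shift:
  fixes f :: "'a::euclidean_space \<Rightarrow> 'b::{banach,second_countable_topology}"
  assumes "f \<in> borel_measurable borel"
  shows "(LBINT x. f (x - y)) = (LBINT x. f x)"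
  using integral_lborel_translate_reflect(1)[OF assms, of "- y"] by simp

lemma translation_continuous_approx:
  assumes f: "integrable lborel f"
    and approx: "\<And>e. e > 0 \<Longrightarrow> \<exists>g. integrable lborel g \<and> translation_continuous g \<and> (LBINT x. \<bar>f x - g x\<bar>) < e"
  shows "translation_continuous f"
  unfolding translation_continuous_def
proof (intro allI impI LIMSEQ_I)
  fix Y :: "nat \<Rightarrow> 'a" and e :: real assume Y: "Y \<longlonglongrightarrow> 0" and e: "0 < e"
  obtain g where g: "integrable lborel g" "translation_continuous g" "(LBINT x. \<bar>f x - g x\<bar>) < e/3"
    using approx[of "e/3"] e by auto
  have [measurable]: "f \<in> borel_measurable borel" "g \<in> borel_measurable borel" using f g(1) by simp_all
  from g(2) Y have "(\<lambda>n. LBINT x. \<bar>g (x - Y n) - g x\<bar>) \<longlonglongrightarrow> 0"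
    by (simp add: translation_continuous_def)
  from LIMSEQ_D[OF this, of "e/3"] e obtain N
    where N: "\<And>n. n \<ge> N \<Longrightarrow> \<bar>LBINT x. \<bar>g (x - Y n) - g x\<bar>\<bar> < e/3" by auto
  have "(LBINT x. \<bar>f (x - y) - f x\<bar>) \<le>
        (LBINT x. \<bar>f x - g x\<bar>) + (LBINT x. \<bar>g (x - y) - g x\<bar>) + (LBINT x. \<bar>f x - g x\<bar>)" for y
  proof -
    have i: "integrable lborel (\<lambda>x. f (x - y))" "integrable lborel (\<lambda>x. g (x - y))"
      using f g(1) by (auto intro: integrable_lborel_shift)
    have "(LBINT x. \<bar>f (x - y) - f x\<bar>) \<le>
        (LBINT x. \<bar>f (x - y) - g (x - y)\<bar> + \<bar>g (x - y) - g x\<bar> + \<bar>f x - g x\<bar>)"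
      using f g(1) i by (intro integral_mono) auto
    also have "\<dots> = (LBINT x. \<bar>f (x - y) - g (x - y)\<bar>) + (LBINT x. \<bar>g (x - y) - g x\<bar>) + (LBINT x. \<bar>f x - g x\<bar>)"
      using f g(1) i by simp
    also have "(LBINT x. \<bar>f (x - y) - g (x - y)\<bar>) = (LBINT x. \<bar>f x - g x\<bar>)"
      by (rule integral_lborel_shift[of "\<lambda>x. \<bar>f x - g x\<bar>"]) measurable
    finally show ?thesis .
  qed
  note le = this
  show "\<exists>N. \<forall>n\<ge>N. norm ((LBINT x. \<bar>f (x - Y n) - f x\<bar>) - 0) < e"
  proof (intro exI[of _ N] allI impI)
    fix n assume "n \<ge> N"
    have "0 \<le> (LBINT x. \<bar>f (x - Y n) - f x\<bar>)" by simp
    then show "norm ((LBINT x. \<bar>f (x - Y n) - f x\<bar>) - 0) < e"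
      using le[of "Y n"] N[OF \<open>n \<ge> N\<close>] g(3) by simp
  qed
qed

text \<open>
  For an open set \<open>U\<close> the indicator of \<open>U \<inter> (U + y)\<close> converges pointwise to that of \<open>U\<close> as \<open>y\<close> tends to
  zero, and the symmetric difference of \<open>U\<close> and \<open>U + y\<close> has measure \<open>2 |U| - 2 |U \<inter> (U + y)|\<close>.
\<close>

lemma translation_continuous_open:
  fixes U :: "'a::euclidean_space set"
  assumes U: "open U" "emeasure lborel U < \<infinity>"
  shows "translation_continuous (indicat_real U)"
  unfolding translation_continuous_def
proof (intro allI impI)
  fix Y :: "nat \<Rightarrow> 'a" assume Y: "Y \<longlonglongrightarrow> 0"
  have [measurable]: "U \<in> sets borel" using U by simp
  let ?u = "indicat_real U"
  have iu: "integrable lborel ?u" using U by (simp add: integrable_indicator_iff)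
  have pm: "integrable lborel (\<lambda>x. ?u x * ?u (x - y))" for y
    by (rule Bochner_Integration.integrable_bound[OF iu]) (auto simp: indicator_def)
  have lim: "(\<lambda>n. LBINT x. ?u x * ?u (x - Y n)) \<longlonglongrightarrow> (LBINT x. ?u x)"
  proof (rule integral_dominated_convergence[where w="?u"])
    show "AE x in lborel. (\<lambda>n. ?u x * ?u (x - Y n)) \<longlonglongrightarrow> ?u x"
    proof (intro AE_I2)
      fix x
      show "(\<lambda>n. ?u x * ?u (x - Y n)) \<longlonglongrightarrow> ?u x"
      proof (cases "x \<in> U")
        case True
        have "(\<lambda>n. x - Y n) \<longlonglongrightarrow> x - 0" by (intro tendsto_intros Y)
        then have "\<forall>\<^sub>F n in sequentially. x - Y n \<in> U"
          using U(1) True by (auto dest: topological_tendstoD)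
        then show ?thesis using True by (intro tendsto_eventually) (auto elim: eventually_mono)
      qed simp
    qed
  qed (use iu in \<open>auto simp: indicator_def\<close>)
  have eq: "(LBINT x. \<bar>?u (x - y) - ?u x\<bar>) = 2 * (LBINT x. ?u x) - 2 * (LBINT x. ?u x * ?u (x - y))" for y
  proof -
    have "(LBINT x. \<bar>?u (x - y) - ?u x\<bar>) = (LBINT x. ?u (x - y) + ?u x - 2 * (?u x * ?u (x - y)))"
      by (rule Bochner_Integration.integral_cong) (auto simp: indicator_def)
    also have "\<dots> = (LBINT x. ?u (x - y)) + (LBINT x. ?u x) - 2 * (LBINT x. ?u x * ?u (x - y))"
      using iu pm integrable_lborel_shift[OF iu, of y] by simp
    also have "(LBINT x. ?u (x - y)) = (LBINT x. ?u x)" by (rule integral_lborel_shift) simp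
    finally show ?thesis by simp
  qed
  have "(\<lambda>n. 2 * (LBINT x. ?u x) - 2 * (LBINT x. ?u x * ?u (x - Y n))) \<longlonglongrightarrow>
        2 * (LBINT x. ?u x) - 2 * (LBINT x. ?u x)"
    by (intro tendsto_intros lim)
  then show "(\<lambda>n. LBINT x. \<bar>?u (x - Y n) - ?u x\<bar>) \<longlonglongrightarrow> 0"
    unfolding eq by simp
qed

lemma translation_continuous_scale:
  assumes "translation_continuous f"
  shows "translation_continuous (\<lambda>x. f x * c)"
  unfolding translation_continuous_def
proof (intro allI impI)
  fix Y :: "nat \<Rightarrow> 'a" assume "Y \<longlonglongrightarrow> 0"
  then have "(\<lambda>n. (LBINT x. \<bar>f (x - Y n) - f x\<bar>) * \<bar>c\<bar>) \<longlonglongrightarrow> 0 * \<bar>c\<bar>"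
    using assms unfolding translation_continuous_def by (intro tendsto_intros) auto
  then show "(\<lambda>n. LBINT x. \<bar>f (x - Y n) * c - f x * c\<bar>) \<longlonglongrightarrow> 0"
    by (simp add: left_diff_distrib[symmetric] abs_mult)
qed

lemma translation_continuous_add:
  assumes f: "integrable lborel f" "translation_continuous f"
    and g: "integrable lborel g" "translation_continuous g"
  shows "translation_continuous (\<lambda>x. f x + g x)"
  unfolding translation_continuous_def
proof (intro allI impI)
  fix Y :: "nat \<Rightarrow> 'a" assume Y: "Y \<longlonglongrightarrow> 0"
  have l: "(\<lambda>n. (LBINT x. \<bar>f (x - Y n) - f x\<bar>) + (LBINT x. \<bar>g (x - Y n) - g x\<bar>)) \<longlonglongrightarrow> 0"
    using tendsto_add[of _ 0 _ _ 0] f(2) g(2) Y unfolding translation_continuous_def by fastforce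
  show "(\<lambda>n. LBINT x. \<bar>f (x - Y n) + g (x - Y n) - (f x + g x)\<bar>) \<longlonglongrightarrow> 0"
  proof (rule tendsto_sandwich[OF _ _ tendsto_const l])
    show "\<forall>\<^sub>F n in sequentially. (LBINT x. \<bar>f (x - Y n) + g (x - Y n) - (f x + g x)\<bar>) \<le>
        (LBINT x. \<bar>f (x - Y n) - f x\<bar>) + (LBINT x. \<bar>g (x - Y n) - g x\<bar>)"
    proof (intro always_eventually allI)
      fix n
      note i = f(1) g(1) integrable_lborel_shift[OF f(1), of "Y n"] integrable_lborel_shift[OF g(1), of "Y n"]
      have "(LBINT x. \<bar>f (x - Y n) + g (x - Y n) - (f x + g x)\<bar>) \<le>
        (LBINT x. \<bar>f (x - Y n) - f x\<bar> + \<bar>g (x - Y n) - g x\<bar>)"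
        using i by (intro integral_mono) auto
      also have "\<dots> = (LBINT x. \<bar>f (x - Y n) - f x\<bar>) + (LBINT x. \<bar>g (x - Y n) - g x\<bar>)"
        using i by simp
      finally show "(LBINT x. \<bar>f (x - Y n) + g (x - Y n) - (f x + g x)\<bar>) \<le> \<dots>" .
    qed
  qed auto
qed

text \<open>
  The property survives limits in \<open>L\<^sup>1\<close>. It thus passes from open sets to measurable sets by outer
  regularity, and from there to all integrable functions.
\<close>

lemma integrable_translation_continuous:
  fixes f :: "'a::euclidean_space \<Rightarrow> real"
  assumes "integrable lborel f"
  shows "translation_continuous f"
  using assms
proof induction
  case (base A c)
  have A: "A \<in> sets borel" "emeasure lborel A < \<infinity>" using base by auto
  note A(1)[measurable]
  have "translation_continuous (indicat_real A)"
  proof (rule translation_continuous_approx)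
    show "integrable lborel (indicat_real A)" using A by (simp add: integrable_indicator_iff)
    fix e :: real assume e: "e > 0"
    have AL: "A \<in> sets lebesgue" using A by simp
    obtain U where U: "open U" "A \<subseteq> U" "emeasure lebesgue (U - A) < ennreal e"
      using sets_lebesgue_outer_open[OF AL e] by auto
    have [measurable]: "U \<in> sets borel" using U by simp
    have d: "emeasure lborel (U - A) < ennreal e" using U(3) by simp
    have "emeasure lborel U = emeasure lborel A + emeasure lborel (U - A)"
      using U(2) by (subst plus_emeasure) (auto intro!: arg_cong[of _ _ "emeasure lborel"])
    with A d have fU: "emeasure lborel U < \<infinity>" by (auto intro: order_less_trans[OF d])
    have "(LBINT x. \<bar>indicat_real A x - indicat_real U x\<bar>) = (LBINT x. indicat_real (U - A) x)"
      using U(2) by (intro Bochner_Integration.integral_cong) (auto simp: indicator_def)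
    also have "\<dots> = measure lborel (U - A)" by simp
    also have "\<dots> < e" using d e by (simp add: measure_def) (metis enn2real_less_iff ennreal_less_top order.strict_trans e less_eq_real_def)
    finally show "\<exists>g. integrable lborel g \<and> translation_continuous g \<and> (LBINT x. \<bar>indicat_real A x - g x\<bar>) < e"
      using translation_continuous_open[OF U(1) fU] fU by (intro exI[of _ "indicat_real U"]) (simp add: integrable_indicator_iff)
  qed
  then show ?case using translation_continuous_scale[of "indicat_real A" c] by simp
next
  case (add f g) then show ?case by (intro translation_continuous_add) auto
next
  case (lim f s)
  have [measurable]: "f \<in> borel_measurable borel" "\<And>i. s i \<in> borel_measurable borel" using lim.hyps(1,4) by simp_all
  show ?case
  proof (rule translation_continuous_approx[OF lim.hyps(4)])
    fix e :: real assume e: "e > 0"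
    have "(\<lambda>i. LBINT x. \<bar>f x - s i x\<bar>) \<longlonglongrightarrow> (LBINT x::'a. 0)"
    proof (rule integral_dominated_convergence[where w="\<lambda>x. 3 * \<bar>f x\<bar>"])
      show "AE x in lborel. (\<lambda>i. \<bar>f x - s i x\<bar>) \<longlonglongrightarrow> 0"
      proof (intro AE_I2)
        fix x
        have "(\<lambda>i. s i x) \<longlonglongrightarrow> f x" by (rule lim.hyps(2)) simp
        then have "(\<lambda>i. f x - s i x) \<longlonglongrightarrow> f x - f x" by (intro tendsto_intros)
        then show "(\<lambda>i. \<bar>f x - s i x\<bar>) \<longlonglongrightarrow> 0" by (intro tendsto_rabs_zero) simp
      qed
      show "AE x in lborel. norm \<bar>f x - s i x\<bar> \<le> 3 * \<bar>f x\<bar>" for i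
      proof (intro AE_I2)
        fix x show "norm \<bar>f x - s i x\<bar> \<le> 3 * \<bar>f x\<bar>" using lim.hyps(3)[of x i] by simp
      qed
    qed (use lim in auto)
    from LIMSEQ_D[OF this e] obtain i where "(LBINT x. \<bar>f x - s i x\<bar>) < e" by fastforce
    with lim.hyps(1) lim.IH show "\<exists>g. integrable lborel g \<and> translation_continuous g \<and> (LBINT x. \<bar>f x - g x\<bar>) < e" by blast
  qed
qed

section \<open>Fourier transform and Plancherel identity\<close>

definition ft :: "('a::euclidean_space \<Rightarrow> real) \<Rightarrow> 'a \<Rightarrow> complex" where
  "ft f \<xi> = (LBINT x. f x *\<^sub>R cis (\<xi> \<bullet> x))"

lemma borel_measurable_cis[measurable]: "cis \<in> borel_measurable borel"
  by (intro borel_measurable_continuous_onI) (auto intro!: continuous_intros simp: cis_conv_exp)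

lemma borel_measurable_cnj[measurable]: "cnj \<in> borel_measurable borel"
  by (intro borel_measurable_continuous_onI) (auto intro!: continuous_intros)

lemma borel_measurable_fst_snd[measurable]:
  "fst \<in> borel_measurable (borel :: ('a::second_countable_topology \<times> 'b::second_countable_topology) measure)"
  "snd \<in> borel_measurable (borel :: ('a::second_countable_topology \<times> 'b::second_countable_topology) measure)"
  by (auto intro!: borel_measurable_continuous_onI continuous_intros)

lemma borel_measurable_ft[measurable]:
  assumes [measurable]: "f \<in> borel_measurable (borel :: 'a::euclidean_space measure)"
  shows "ft f \<in> borel_measurable borel"
proof -
  have "(\<lambda>\<xi>. ft f \<xi>) \<in> borel_measurable lborel"
    unfolding ft_def by (rule lborel.borel_measurable_lebesgue_integral) (simp add: lborel_prod split_beta', measurable)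
  then show ?thesis by simp
qed

lemma integrable_ft: "integrable lborel f \<Longrightarrow> integrable lborel (\<lambda>x. f x *\<^sub>R cis (\<xi> \<bullet> x))"
  for f :: "'a::euclidean_space \<Rightarrow> real"
  by (rule Bochner_Integration.integrable_bound[of _ f]) auto

lemma ft_Re_Im:
  assumes "integrable lborel f"
  shows "Re (ft f \<xi>) = (LBINT x. f x * cos (\<xi> \<bullet> x))" "Im (ft f \<xi>) = (LBINT x. f x * sin (\<xi> \<bullet> x))"
  using integral_Re[OF integrable_ft[OF assms, of \<xi>]] integral_Im[OF integrable_ft[OF assms, of \<xi>]]
  unfolding ft_def by simp_all

lemma norm_ft_le: "norm (ft f \<xi>) \<le> (LBINT x. \<bar>f x\<bar>)"
  unfolding ft_def by (rule order_trans[OF integral_norm_bound]) simp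

lemma ft_pair_kernel:
  fixes f g :: "'a::euclidean_space \<Rightarrow> real"
  assumes f: "integrable lborel f" and g: "integrable lborel g"
  shows "Re (ft f \<xi> * cnj (ft g \<xi>)) = (LBINT p. f (fst p) * g (snd p) * cos (\<xi> \<bullet> (fst p - snd p)))"
proof -
  have [measurable]: "f \<in> borel_measurable borel" "g \<in> borel_measurable borel" using f g by simp_all
  have ic: "integrable lborel (\<lambda>x. h x * cos (\<xi> \<bullet> x))" "integrable lborel (\<lambda>x. h x * sin (\<xi> \<bullet> x))"
    if "integrable lborel h" for h :: "'a \<Rightarrow> real"
  proof -
    have [measurable]: "h \<in> borel_measurable borel" using that by simp
    show "integrable lborel (\<lambda>x. h x * cos (\<xi> \<bullet> x))"
      using integrable_mult_bounded[OF that, of "\<lambda>x. cos (\<xi> \<bullet> x)" 1] by (simp add: mult.commute)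
    show "integrable lborel (\<lambda>x. h x * sin (\<xi> \<bullet> x))"
      using integrable_mult_bounded[OF that, of "\<lambda>x. sin (\<xi> \<bullet> x)" 1] by (simp add: mult.commute)
  qed
  have T: "(LBINT p. a (fst p) * b (snd p)) = (LBINT x. a x) * (LBINT y. b y)"
    if "integrable lborel a" "integrable lborel b" for a b :: "'a \<Rightarrow> real"
  proof -
    have "(LBINT p. a (fst p) * b (snd p)) = (LBINT x. LBINT y. a x * b y)"
      using lborel_pair.integral_fst'[of "\<lambda>p. a (fst p) * b (snd p)"] integrable_lborel_tensor[OF that]
      by (simp add: lborel_prod)
    also have "\<dots> = (LBINT x. a x) * (LBINT y. b y)" by simp
    finally show ?thesis .
  qed
  have "(LBINT p. f (fst p) * g (snd p) * cos (\<xi> \<bullet> (fst p - snd p))) =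
        (LBINT p. (f (fst p) * cos (\<xi> \<bullet> fst p)) * (g (snd p) * cos (\<xi> \<bullet> snd p)) +
                        (f (fst p) * sin (\<xi> \<bullet> fst p)) * (g (snd p) * sin (\<xi> \<bullet> snd p)))"
    by (rule Bochner_Integration.integral_cong) (auto simp: inner_diff_right cos_diff algebra_simps)
  also have "\<dots> = (LBINT p. (f (fst p) * cos (\<xi> \<bullet> fst p)) * (g (snd p) * cos (\<xi> \<bullet> snd p))) +
                 (LBINT p. (f (fst p) * sin (\<xi> \<bullet> fst p)) * (g (snd p) * sin (\<xi> \<bullet> snd p)))"
    by (intro Bochner_Integration.integral_add integrable_lborel_tensor[of "\<lambda>x. f x * cos (\<xi> \<bullet> x)" "\<lambda>y. g y * cos (\<xi> \<bullet> y)"]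
        integrable_lborel_tensor[of "\<lambda>x. f x * sin (\<xi> \<bullet> x)" "\<lambda>y. g y * sin (\<xi> \<bullet> y)"] ic f g)
  also have "\<dots> = Re (ft f \<xi> * cnj (ft g \<xi>))"
    using T[OF ic(1)[OF f] ic(1)[OF g]] T[OF ic(2)[OF f] ic(2)[OF g]]
    by (simp add: ft_Re_Im f g)
  finally show ?thesis by simp
qed

lemma nn_integral_lborel_affine:
  fixes f :: "'a::euclidean_space \<Rightarrow> ennreal"
  assumes [measurable]: "f \<in> borel_measurable borel" and c: "c \<noteq> 0"
  shows "(\<integral>\<^sup>+x. f x \<partial>lborel) = ennreal (\<bar>c\<bar> ^ DIM('a)) * (\<integral>\<^sup>+x. f (t + c *\<^sub>R x) \<partial>lborel)"
  by (subst lborel_affine[OF c, of t]) (simp add: nn_integral_density nn_integral_distr nn_integral_cmult)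

lemma integrable_lborel_affine:
  fixes f :: "'a::euclidean_space \<Rightarrow> 'b::{banach,second_countable_topology}"
  assumes f: "integrable lborel f" and c: "c \<noteq> 0"
  shows "integrable lborel (\<lambda>x. f (t + c *\<^sub>R x))"
proof -
  have [measurable]: "f \<in> borel_measurable borel" using f by simp
  have "ennreal (\<bar>c\<bar> ^ DIM('a)) * (\<integral>\<^sup>+x. norm (f (t + c *\<^sub>R x)) \<partial>lborel) < \<infinity>"
    using f nn_integral_lborel_affine[of "\<lambda>x. ennreal (norm (f x))" c t] c by (simp add: integrable_iff_bounded)
  then show ?thesis using c by (auto simp: integrable_iff_bounded ennreal_mult_less_top)
qed

text \<open>
  With a Gaussian weight the frequency integral may be exchanged with the two space integrals, and
  what is left is the pairing of \<open>f\<close> with a Gaussian average of translates of \<open>g\<close> at scale \<open>\<delta>\<close>. Letting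
  \<open>\<delta>\<close> tend to zero gives Plancherel's identity.
\<close>

lemma ft_pair_gauss:
  fixes f g :: "'a::euclidean_space \<Rightarrow> real"
  assumes f: "integrable lborel f" and g: "integrable lborel g" and d: "\<delta> > 0"
  shows "(LBINT \<xi>. exp (- (norm (\<delta> *\<^sub>R \<xi>))\<^sup>2 / 2) * Re (ft f \<xi> * cnj (ft g \<xi>))) =
         gauss_mass TYPE('a) * (LBINT v. exp (- (norm v)\<^sup>2 / 2) * (LBINT x. f x * g (x - \<delta> *\<^sub>R v)))"
proof -
  have [measurable]: "f \<in> borel_measurable borel" "g \<in> borel_measurable borel" using f g by simp_all
  let ?n = "DIM('a)" and ?G = "\<lambda>v::'a. exp (- (norm v)\<^sup>2 / 2)"
  let ?u = "\<lambda>p::'a\<times>'a. f (fst p) * g (snd p)"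
  have iu: "integrable lborel ?u" by (rule integrable_lborel_tensor[OF f g])
  have iG: "integrable lborel ?G" by (rule gauss_fourier_cos)
  have "(LBINT \<xi>. ?G (\<delta> *\<^sub>R \<xi>) * Re (ft f \<xi> * cnj (ft g \<xi>))) =
        (1/\<delta>) ^ ?n * (LBINT \<eta>. ?G \<eta> * Re (ft f ((1/\<delta>) *\<^sub>R \<eta>) * cnj (ft g ((1/\<delta>) *\<^sub>R \<eta>))))"
    using d by (subst lborel_integral_affine[of _ "1/\<delta>" 0]) (simp_all, measurable)
  also have "(LBINT \<eta>. ?G \<eta> * Re (ft f ((1/\<delta>) *\<^sub>R \<eta>) * cnj (ft g ((1/\<delta>) *\<^sub>R \<eta>)))) =
        (LBINT \<eta>. LBINT p. ?G \<eta> * (?u p * cos (\<eta> \<bullet> ((1/\<delta>) *\<^sub>R (fst p - snd p)))))"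
    unfolding ft_pair_kernel[OF f g] by simp
  also have "\<dots> = (LBINT p. LBINT \<eta>. ?G \<eta> * (?u p * cos (\<eta> \<bullet> ((1/\<delta>) *\<^sub>R (fst p - snd p)))))"
  proof (rule lborel_pair.Fubini_integral[symmetric])
    have "integrable lborel (\<lambda>q. cos (fst q \<bullet> ((1/\<delta>) *\<^sub>R (fst (snd q) - snd (snd q)))) *\<^sub>R (?G (fst q) * ?u (snd q)))"
    proof (rule integrable_mult_bounded[OF integrable_lborel_tensor[OF iG iu]])
      show "\<bar>cos (fst q \<bullet> ((1/\<delta>) *\<^sub>R (fst (snd q) - snd (snd q))))\<bar> \<le> 1" for q :: "'a \<times> 'a \<times> 'a" by simp
    qed measurable
    then show "integrable (lborel \<Otimes>\<^sub>M lborel) (\<lambda>(\<eta>, p). ?G \<eta> * (?u p * cos (\<eta> \<bullet> ((1/\<delta>) *\<^sub>R (fst p - snd p)))))"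
      by (simp add: lborel_prod split_beta' mult_ac)
  qed
  also have "\<dots> = (LBINT p. ?u p * (gauss_mass TYPE('a) * ?G ((1/\<delta>) *\<^sub>R (fst p - snd p))))"
  proof (rule Bochner_Integration.integral_cong[OF refl])
    fix p :: "'a \<times> 'a"
    have "(LBINT \<eta>. ?G \<eta> * (?u p * cos (\<eta> \<bullet> ((1/\<delta>) *\<^sub>R (fst p - snd p))))) =
          (LBINT \<eta>. ?u p * (?G \<eta> * cos (((1/\<delta>) *\<^sub>R (fst p - snd p)) \<bullet> \<eta>)))"
      by (rule Bochner_Integration.integral_cong) (simp_all add: inner_commute)
    also have "\<dots> = ?u p * (gauss_mass TYPE('a) * ?G ((1/\<delta>) *\<^sub>R (fst p - snd p)))"
      by (simp only: integral_mult_right_zero gauss_fourier_cos(2))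
    finally show "(LBINT \<eta>. ?G \<eta> * (?u p * cos (\<eta> \<bullet> ((1/\<delta>) *\<^sub>R (fst p - snd p))))) = \<dots>" .
  qed
  also have "\<dots> = gauss_mass TYPE('a) * (LBINT p. ?u p * ?G ((1/\<delta>) *\<^sub>R (fst p - snd p)))"
    by (simp add: mult.left_commute)
  also have "(LBINT p. ?u p * ?G ((1/\<delta>) *\<^sub>R (fst p - snd p))) =
             (LBINT x. LBINT y. f x * g y * ?G ((1/\<delta>) *\<^sub>R (x - y)))"
  proof -
    have "integrable lborel (\<lambda>p. ?G ((1/\<delta>) *\<^sub>R (fst p - snd p)) *\<^sub>R ?u p)"
    proof (rule integrable_mult_bounded[OF iu])
      show "\<bar>?G ((1/\<delta>) *\<^sub>R (fst p - snd p))\<bar> \<le> 1" for p :: "'a \<times> 'a" by simp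
    qed measurable
    then have "integrable (lborel \<Otimes>\<^sub>M lborel) (\<lambda>p. ?u p * ?G ((1/\<delta>) *\<^sub>R (fst p - snd p)))"
      by (simp add: lborel_prod mult.commute)
    from lborel_pair.integral_fst'[OF this] show ?thesis by (simp add: lborel_prod)
  qed
  also have "\<dots> = (LBINT x. LBINT v. \<delta> ^ ?n * (f x * g (x - \<delta> *\<^sub>R v) * ?G v))"
  proof (rule Bochner_Integration.integral_cong[OF refl])
    fix x :: 'a
    show "(LBINT y. f x * g y * ?G ((1/\<delta>) *\<^sub>R (x - y))) = (LBINT v. \<delta> ^ ?n * (f x * g (x - \<delta> *\<^sub>R v) * ?G v))"
      using d by (subst lborel_integral_affine[of _ "-\<delta>" x]) (simp_all, measurable)
  qed
  also have "\<dots> = \<delta> ^ ?n * (LBINT x. LBINT v. f x * g (x - \<delta> *\<^sub>R v) * ?G v)"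
    by simp
  also have "(LBINT x. LBINT v. f x * g (x - \<delta> *\<^sub>R v) * ?G v) =
             (LBINT v. LBINT x. f x * g (x - \<delta> *\<^sub>R v) * ?G v)"
  proof (rule lborel_pair.Fubini_integral[symmetric])
    have ig: "integrable lborel (\<lambda>v. g (x - \<delta> *\<^sub>R v))" for x
      using integrable_lborel_affine[OF g, of "-\<delta>" x] d by simp
    have ii: "integrable lborel (\<lambda>v. f x * g (x - \<delta> *\<^sub>R v) * ?G v)" for x
      using integrable_mult_bounded[OF ig, of "\<lambda>v. f x * ?G v" "\<bar>f x\<bar>" x] by (simp add: abs_mult mult_left_le mult_ac)
    have mass: "(LBINT v. \<bar>g (x - \<delta> *\<^sub>R v)\<bar>) = (1/\<delta>) ^ ?n * (LBINT y. \<bar>g y\<bar>)" for x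
      using lborel_integral_affine[of "\<lambda>y. \<bar>g y\<bar>" "-\<delta>" x] d by (simp add: power_one_over field_simps)
    show "integrable (lborel \<Otimes>\<^sub>M lborel) (\<lambda>(x, v). f x * g (x - \<delta> *\<^sub>R v) * ?G v)"
    proof (rule lborel_pair.Fubini_integrable)
      show "(\<lambda>(x, v). f x * g (x - \<delta> *\<^sub>R v) * ?G v) \<in> borel_measurable (lborel \<Otimes>\<^sub>M lborel)"
        by (simp add: lborel_prod split_beta', measurable)
      show "AE x in lborel. integrable lborel (\<lambda>y. case (x, y) of (x, v) \<Rightarrow> f x * g (x - \<delta> *\<^sub>R v) * ?G v)"
        using ii by simp
      \<comment> \<open>The Gaussian factor is dropped: integrating first in \<open>v\<close> leaves \<open>|f x|\<close> times a constant.\<close>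
      show "integrable lborel (\<lambda>x. LBINT y. norm (case (x, y) of (x, v) \<Rightarrow> f x * g (x - \<delta> *\<^sub>R v) * ?G v))"
      proof (rule Bochner_Integration.integrable_bound)
        show "integrable lborel (\<lambda>x. \<bar>f x\<bar> * ((1/\<delta>) ^ ?n * (LBINT y. \<bar>g y\<bar>)))"
          using f by (intro integrable_mult_left integrable_abs)
        have "(\<lambda>x. LBINT v. \<bar>f x * g (x - \<delta> *\<^sub>R v) * ?G v\<bar>) \<in> borel_measurable lborel"
          by (rule lborel.borel_measurable_lebesgue_integral) (simp add: lborel_prod split_beta', measurable)
        then show "(\<lambda>x. LBINT y. norm (case (x, y) of (x, v) \<Rightarrow> f x * g (x - \<delta> *\<^sub>R v) * ?G v)) \<in> borel_measurable lborel"
          by simp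
        show "AE x in lborel. norm (LBINT y. norm (case (x, y) of (x, v) \<Rightarrow> f x * g (x - \<delta> *\<^sub>R v) * ?G v)) \<le>
            norm (\<bar>f x\<bar> * ((1/\<delta>) ^ ?n * (LBINT y. \<bar>g y\<bar>)))"
        proof (intro AE_I2)
          fix x
          have "(LBINT v. \<bar>f x * g (x - \<delta> *\<^sub>R v) * ?G v\<bar>) \<le> (LBINT v. \<bar>f x\<bar> * \<bar>g (x - \<delta> *\<^sub>R v)\<bar>)"
            by (intro integral_mono integrable_abs[OF ii] integrable_mult_right integrable_abs[OF ig])
               (auto simp: abs_mult mult_left_le)
          also have "\<dots> = \<bar>f x\<bar> * ((1/\<delta>) ^ ?n * (LBINT y. \<bar>g y\<bar>))" by (simp add: mass)
          finally have "(LBINT v. \<bar>f x * g (x - \<delta> *\<^sub>R v) * ?G v\<bar>) \<le> \<bar>f x\<bar> * ((1/\<delta>) ^ ?n * (LBINT y. \<bar>g y\<bar>))" .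
          then show "norm (LBINT y. norm (case (x, y) of (x, v) \<Rightarrow> f x * g (x - \<delta> *\<^sub>R v) * ?G v)) \<le>
            norm (\<bar>f x\<bar> * ((1/\<delta>) ^ ?n * (LBINT y. \<bar>g y\<bar>)))" by (simp add: order_trans[OF _ abs_ge_self])
        qed
      qed
    qed
  qed
  also have "(1/\<delta>) ^ ?n * (gauss_mass TYPE('a) * (\<delta> ^ ?n * (LBINT v. LBINT x. f x * g (x - \<delta> *\<^sub>R v) * ?G v))) =
      gauss_mass TYPE('a) * (LBINT v. ?G v * (LBINT x. f x * g (x - \<delta> *\<^sub>R v)))"
    using d by (simp add: power_one_over mult.commute)
  finally show ?thesis .
qed

lemma integrable_mult_L2:
  fixes f g :: "'a \<Rightarrow> real"
  assumes [measurable]: "f \<in> borel_measurable M" "g \<in> borel_measurable M"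
    and "integrable M (\<lambda>x. (f x)\<^sup>2)" "integrable M (\<lambda>x. (g x)\<^sup>2)"
  shows "integrable M (\<lambda>x. f x * g x)"
proof (rule Bochner_Integration.integrable_bound)
  show "integrable M (\<lambda>x. (f x)\<^sup>2 + (g x)\<^sup>2)" using assms by simp
  show "AE x in M. norm (f x * g x) \<le> norm ((f x)\<^sup>2 + (g x)\<^sup>2)"
  proof (intro AE_I2)
    fix x
    have "2 * (\<bar>f x\<bar> * \<bar>g x\<bar>) \<le> (f x)\<^sup>2 + (g x)\<^sup>2"
      using sum_squares_bound[of "\<bar>f x\<bar>" "\<bar>g x\<bar>"] by (simp add: mult.assoc)
    moreover have "0 \<le> \<bar>f x\<bar> * \<bar>g x\<bar>" by simp
    moreover have "norm (f x * g x) = \<bar>f x\<bar> * \<bar>g x\<bar>" by (simp add: abs_mult)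
    moreover have "norm ((f x)\<^sup>2 + (g x)\<^sup>2) = (f x)\<^sup>2 + (g x)\<^sup>2" by simp
    ultimately show "norm (f x * g x) \<le> norm ((f x)\<^sup>2 + (g x)\<^sup>2)" by linarith
  qed
qed measurable

text \<open>
  Translates of \<open>f\<close> have the same \<open>L\<^sup>2\<close> norm, so the weighted frequency integral is bounded uniformly in
  \<open>\<delta>\<close>; Fatou's lemma removes the weight.
\<close>

lemma ft_L2_bound:
  fixes f :: "'a::euclidean_space \<Rightarrow> real"
  assumes f: "integrable lborel f" and f2: "integrable lborel (\<lambda>x. (f x)\<^sup>2)"
  shows "integrable lborel (\<lambda>\<xi>. (norm (ft f \<xi>))\<^sup>2)"
    and "(LBINT \<xi>. (norm (ft f \<xi>))\<^sup>2) \<le> (gauss_mass TYPE('a))\<^sup>2 * (LBINT x. (f x)\<^sup>2)"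
proof -
  have [measurable]: "f \<in> borel_measurable borel" using f by simp
  let ?G = "\<lambda>v::'a. exp (- (norm v)\<^sup>2 / 2)" and ?c = "gauss_mass TYPE('a)"
  let ?B = "?c\<^sup>2 * (LBINT x. (f x)\<^sup>2)"
  have e: "Re (ft f \<xi> * cnj (ft f \<xi>)) = (norm (ft f \<xi>))\<^sup>2" for \<xi>
    by (simp add: complex_norm_square[symmetric])
  have H: "(LBINT x. f x * f (x - y)) \<le> (LBINT x. (f x)\<^sup>2)" for y
  proof -
    have i2: "integrable lborel (\<lambda>x. (f (x - y))\<^sup>2)"
      using integrable_lborel_shift[OF f2, of y] by simp
    have "(LBINT x. f x * f (x - y)) \<le> (LBINT x. (f x)\<^sup>2 / 2 + (f (x - y))\<^sup>2 / 2)"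
    proof (rule integral_mono)
      show "integrable lborel (\<lambda>x. f x * f (x - y))" by (intro integrable_mult_L2 f2 i2) measurable
      show "f x * f (x - y) \<le> (f x)\<^sup>2 / 2 + (f (x - y))\<^sup>2 / 2" for x
        using sum_squares_bound[of "f x" "f (x - y)"] by simp
    qed (use f2 i2 in simp)
    also have "\<dots> = (LBINT x. (f x)\<^sup>2) / 2 + (LBINT x. (f (x - y))\<^sup>2) / 2" using f2 i2 by simp
    also have "(LBINT x. (f (x - y))\<^sup>2) = (LBINT x. (f x)\<^sup>2)"
      by (rule integral_lborel_shift[of "\<lambda>x. (f x)\<^sup>2"]) measurable
    finally show ?thesis by simp
  qed
  have reg: "(\<integral>\<^sup>+\<xi>. ennreal (?G (\<delta> *\<^sub>R \<xi>) * (norm (ft f \<xi>))\<^sup>2) \<partial>lborel) \<le> ennreal ?B" if d: "\<delta> > 0" for \<delta>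
  proof -
    have ic: "integrable lborel (\<lambda>\<xi>. ?G (\<delta> *\<^sub>R \<xi>) * (norm (ft f \<xi>))\<^sup>2)"
    proof -
      have "integrable lborel (\<lambda>\<xi>. (norm (ft f \<xi>))\<^sup>2 *\<^sub>R ?G (\<delta> *\<^sub>R \<xi>))"
      proof (rule integrable_mult_bounded)
        show "integrable lborel (\<lambda>\<xi>. ?G (\<delta> *\<^sub>R \<xi>))"
          using integrable_lborel_affine[OF gauss_fourier_cos(1), of \<delta> 0] d by simp
        show "\<bar>(norm (ft f \<xi>))\<^sup>2\<bar> \<le> (LBINT x. \<bar>f x\<bar>)\<^sup>2" for \<xi>
          using power_mono[OF norm_ft_le[of f \<xi>], of 2] by simp
      qed measurable
      then show ?thesis by (simp add: mult.commute)
    qed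
    have "(\<integral>\<^sup>+\<xi>. ennreal (?G (\<delta> *\<^sub>R \<xi>) * (norm (ft f \<xi>))\<^sup>2) \<partial>lborel) = ennreal (LBINT \<xi>. ?G (\<delta> *\<^sub>R \<xi>) * (norm (ft f \<xi>))\<^sup>2)"
      by (rule nn_integral_eq_integral[OF ic]) simp
    also have "(LBINT \<xi>. ?G (\<delta> *\<^sub>R \<xi>) * (norm (ft f \<xi>))\<^sup>2) =
        ?c * (LBINT v. ?G v * (LBINT x. f x * f (x - \<delta> *\<^sub>R v)))"
      using ft_pair_gauss[OF f f d] unfolding e .
    also have "(LBINT v. ?G v * (LBINT x. f x * f (x - \<delta> *\<^sub>R v))) \<le> (LBINT v. ?G v * (LBINT x. (f x)\<^sup>2))"
    proof (rule integral_mono')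
      show "integrable lborel (\<lambda>v. ?G v * (LBINT x. (f x)\<^sup>2))"
        by (intro integrable_mult_left gauss_fourier_cos)
    qed (auto intro!: mult_left_mono H)
    also have "\<dots> = ?c * (LBINT x. (f x)\<^sup>2)" by (simp add: gauss_fourier_cos(3)[simplified])
    finally show ?thesis
      using gauss_mass_pos[where 'a='a] by (simp add: power2_eq_square mult.assoc ennreal_leI)
  qed
  let ?\<delta> = "\<lambda>n. 1 / real (Suc n)"
  have "(\<integral>\<^sup>+\<xi>. ennreal ((norm (ft f \<xi>))\<^sup>2) \<partial>lborel) =
        (\<integral>\<^sup>+\<xi>. liminf (\<lambda>n. ennreal (?G (?\<delta> n *\<^sub>R \<xi>) * (norm (ft f \<xi>))\<^sup>2)) \<partial>lborel)"
  proof (rule nn_integral_cong)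
    fix \<xi> :: 'a
    have "(\<lambda>n. ?\<delta> n *\<^sub>R \<xi>) \<longlonglongrightarrow> 0 *\<^sub>R \<xi>" by (intro tendsto_intros LIMSEQ_Suc lim_1_over_n)
    then have "(\<lambda>n. ?G (?\<delta> n *\<^sub>R \<xi>) * (norm (ft f \<xi>))\<^sup>2) \<longlonglongrightarrow> ?G 0 * (norm (ft f \<xi>))\<^sup>2"
      by (intro tendsto_intros) simp_all
    then have "(\<lambda>n. ennreal (?G (?\<delta> n *\<^sub>R \<xi>) * (norm (ft f \<xi>))\<^sup>2)) \<longlonglongrightarrow> ennreal (?G 0 * (norm (ft f \<xi>))\<^sup>2)"
      by (rule tendsto_ennrealI)
    from lim_imp_Liminf[OF sequentially_bot this]
    show "ennreal ((norm (ft f \<xi>))\<^sup>2) = liminf (\<lambda>n. ennreal (?G (?\<delta> n *\<^sub>R \<xi>) * (norm (ft f \<xi>))\<^sup>2))"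
      by simp
  qed
  also have "\<dots> \<le> liminf (\<lambda>n. \<integral>\<^sup>+\<xi>. ennreal (?G (?\<delta> n *\<^sub>R \<xi>) * (norm (ft f \<xi>))\<^sup>2) \<partial>lborel)"
    by (rule nn_integral_liminf) measurable
  also have "\<dots> \<le> liminf (\<lambda>n. ennreal ?B)"
    by (intro Liminf_mono always_eventually allI reg) simp
  finally have le: "(\<integral>\<^sup>+\<xi>. ennreal ((norm (ft f \<xi>))\<^sup>2) \<partial>lborel) \<le> ennreal ?B" by (simp add: Liminf_const)
  show int: "integrable lborel (\<lambda>\<xi>. (norm (ft f \<xi>))\<^sup>2)"
    using le by (intro integrableI_bounded) (auto intro: order_le_less_trans)
  show "(LBINT \<xi>. (norm (ft f \<xi>))\<^sup>2) \<le> ?B"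
    using le by (subst (asm) nn_integral_eq_integral[OF int]) (auto simp: ennreal_le_iff)
qed

text \<open>
  By the previous bound the product of the transforms is integrable, which dominates the weighted
  integrals. On the other side, boundedness of \<open>f\<close> lets continuity of translations of \<open>g\<close> in \<open>L\<^sup>1\<close> identify
  the limit.
\<close>

lemma ft_plancherel:
  fixes f g :: "'a::euclidean_space \<Rightarrow> real"
  assumes f: "integrable lborel f" "integrable lborel (\<lambda>x. (f x)\<^sup>2)" "\<And>x. \<bar>f x\<bar> \<le> B"
    and g: "integrable lborel g" "integrable lborel (\<lambda>x. (g x)\<^sup>2)"
  shows "integrable lborel (\<lambda>\<xi>. Re (ft f \<xi> * cnj (ft g \<xi>)))"
    and "(LBINT \<xi>. Re (ft f \<xi> * cnj (ft g \<xi>))) = (gauss_mass TYPE('a))\<^sup>2 * (LBINT x. f x * g x)"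
proof -
  have [measurable]: "f \<in> borel_measurable borel" "g \<in> borel_measurable borel" using f g by simp_all
  let ?G = "\<lambda>v::'a. exp (- (norm v)\<^sup>2 / 2)" and ?c = "gauss_mass TYPE('a)"
  let ?P = "\<lambda>\<xi>. Re (ft f \<xi> * cnj (ft g \<xi>))"
  have ifg: "integrable lborel (\<lambda>\<xi>. norm (ft f \<xi>) * norm (ft g \<xi>))"
    by (intro integrable_mult_L2 ft_L2_bound f g) measurable
  have bd: "\<bar>?P \<xi>\<bar> \<le> norm (ft f \<xi>) * norm (ft g \<xi>)" for \<xi>
    by (metis abs_Re_le_cmod complex_mod_cnj norm_mult)
  show "integrable lborel ?P"
    by (rule Bochner_Integration.integrable_bound[OF ifg]) (use bd in \<open>auto simp: abs_mult\<close>)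
  let ?\<delta> = "\<lambda>n. 1 / real (Suc n)"
  let ?H = "\<lambda>y. LBINT x. f x * g (x - y)"
  have d0: "(\<lambda>n. ?\<delta> n *\<^sub>R \<xi>) \<longlonglongrightarrow> 0" for \<xi> :: 'a
    using tendsto_scaleR[OF LIMSEQ_Suc[OF lim_1_over_n] tendsto_const[of \<xi>]] by simp
  have l1: "(\<lambda>n. LBINT \<xi>. ?G (?\<delta> n *\<^sub>R \<xi>) * ?P \<xi>) \<longlonglongrightarrow> (LBINT \<xi>. ?P \<xi>)"
  proof (rule integral_dominated_convergence[OF _ _ ifg])
    show "AE \<xi> in lborel. (\<lambda>n. ?G (?\<delta> n *\<^sub>R \<xi>) * ?P \<xi>) \<longlonglongrightarrow> ?P \<xi>"
    proof (intro AE_I2)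
      fix \<xi> :: 'a
      have "(\<lambda>n. ?G (?\<delta> n *\<^sub>R \<xi>) * ?P \<xi>) \<longlonglongrightarrow> ?G 0 * ?P \<xi>" by (intro tendsto_intros d0) simp_all
      then show "(\<lambda>n. ?G (?\<delta> n *\<^sub>R \<xi>) * ?P \<xi>) \<longlonglongrightarrow> ?P \<xi>" by simp
    qed
    show "AE \<xi> in lborel. norm (?G (?\<delta> n *\<^sub>R \<xi>) * ?P \<xi>) \<le> norm (ft f \<xi>) * norm (ft g \<xi>)" for n
    proof (intro AE_I2)
      fix \<xi> :: 'a
      have "norm (?G (?\<delta> n *\<^sub>R \<xi>) * ?P \<xi>) \<le> 1 * \<bar>?P \<xi>\<bar>"
        unfolding real_norm_def abs_mult by (intro mult_right_mono) auto
      with bd[of \<xi>] show "norm (?G (?\<delta> n *\<^sub>R \<xi>) * ?P \<xi>) \<le> norm (ft f \<xi>) * norm (ft g \<xi>)" by linarith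
    qed
  qed measurable
  have ifs: "integrable lborel (\<lambda>x. f x * h x)" if "integrable lborel h" for h
    using integrable_mult_bounded[OF that, of f B] f(3) by simp
  have B0: "0 \<le> B" using f(3)[of 0] by linarith
  have Hlim: "(\<lambda>n. ?H (Y n)) \<longlonglongrightarrow> ?H 0" if Y: "Y \<longlonglongrightarrow> 0" for Y
  proof (rule LIM_zero_cancel, rule Lim_null_comparison)
    have "(\<lambda>n. LBINT x. \<bar>g (x - Y n) - g x\<bar>) \<longlonglongrightarrow> 0"
      using integrable_translation_continuous[OF g(1)] Y by (simp add: translation_continuous_def)
    from tendsto_mult[OF tendsto_const[of B] this]
    show "(\<lambda>n. B * (LBINT x. \<bar>g (x - Y n) - g x\<bar>)) \<longlonglongrightarrow> 0" by simp
    show "\<forall>\<^sub>F n in sequentially. norm (?H (Y n) - ?H 0) \<le> B * (LBINT x. \<bar>g (x - Y n) - g x\<bar>)"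
    proof (intro always_eventually allI)
      fix n
      note ish = integrable_lborel_shift[OF g(1), of "Y n"]
      have "?H (Y n) - ?H 0 = (LBINT x. f x * (g (x - Y n) - g x))"
        using ifs[OF ish] ifs[OF g(1)] by (simp add: right_diff_distrib)
      also have "norm \<dots> \<le> (LBINT x. norm (f x * (g (x - Y n) - g x)))" by (rule integral_norm_bound)
      also have "\<dots> \<le> (LBINT x. B * \<bar>g (x - Y n) - g x\<bar>)"
        using ish g(1) by (intro integral_mono') (auto simp: abs_mult intro!: mult_right_mono mult_nonneg_nonneg f(3) B0)
      finally show "norm (?H (Y n) - ?H 0) \<le> B * (LBINT x. \<bar>g (x - Y n) - g x\<bar>)" by simp
    qed
  qed
  have Hb: "\<bar>?H y\<bar> \<le> B * (LBINT x. \<bar>g x\<bar>)" for y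
  proof -
    note ish = integrable_lborel_shift[OF g(1), of y]
    have "norm (?H y) \<le> (LBINT x. norm (f x * g (x - y)))" by (rule integral_norm_bound)
    also have "\<dots> \<le> (LBINT x. B * \<bar>g (x - y)\<bar>)"
      using ish by (intro integral_mono') (auto simp: abs_mult intro!: mult_right_mono mult_nonneg_nonneg f(3) B0)
    also have "\<dots> = B * (LBINT x. \<bar>g x\<bar>)"
      using integral_lborel_shift[of "\<lambda>x. \<bar>g x\<bar>" y] by simp
    finally show ?thesis by simp
  qed
  have [measurable]: "?H \<in> borel_measurable borel"
  proof -
    have "?H \<in> borel_measurable lborel"
      by (rule lborel.borel_measurable_lebesgue_integral) (simp add: lborel_prod split_beta', measurable)
    then show ?thesis by simp
  qed
  have l2: "(\<lambda>n. LBINT v. ?G v * ?H (?\<delta> n *\<^sub>R v)) \<longlonglongrightarrow> (LBINT v. ?G v * ?H 0)"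
  proof (rule integral_dominated_convergence[where w="\<lambda>v. ?G v * (B * (LBINT x. \<bar>g x\<bar>))"])
    show "integrable lborel (\<lambda>v. ?G v * (B * (LBINT x. \<bar>g x\<bar>)))"
      by (intro integrable_mult_left gauss_fourier_cos)
    show "AE v in lborel. (\<lambda>n. ?G v * ?H (?\<delta> n *\<^sub>R v)) \<longlonglongrightarrow> ?G v * ?H 0"
      by (intro AE_I2 tendsto_mult tendsto_const Hlim d0)
    show "AE v in lborel. norm (?G v * ?H (?\<delta> n *\<^sub>R v)) \<le> ?G v * (B * (LBINT x. \<bar>g x\<bar>))" for n
      by (intro AE_I2) (simp only: abs_mult real_norm_def abs_exp_cancel, intro mult_left_mono Hb, simp)
  qed measurable
  have "(LBINT \<xi>. ?P \<xi>) = ?c * (LBINT v. ?G v * ?H 0)"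
  proof (rule LIMSEQ_unique[OF l1])
    have "(LBINT \<xi>. ?G (?\<delta> n *\<^sub>R \<xi>) * ?P \<xi>) = ?c * (LBINT v. ?G v * ?H (?\<delta> n *\<^sub>R v))" for n
      by (rule ft_pair_gauss[OF f(1) g(1)]) simp
    then show "(\<lambda>n. LBINT \<xi>. ?G (?\<delta> n *\<^sub>R \<xi>) * ?P \<xi>) \<longlonglongrightarrow> ?c * (LBINT v. ?G v * ?H 0)"
      using tendsto_mult[OF tendsto_const[of ?c] l2] by simp
  qed
  also have "\<dots> = ?c\<^sup>2 * (LBINT x. f x * g x)"
    unfolding integral_mult_left_zero gauss_fourier_cos(3) by (simp add: power2_eq_square)
  finally show "(LBINT \<xi>. ?P \<xi>) = ?c\<^sup>2 * (LBINT x. f x * g x)" .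
qed

section \<open>Smooth functions and test functions\<close>

text \<open>
  Smoothness on the line is witnessed by the whole sequence of derivatives. This makes it stable
  under antiderivatives, which are needed for test functions in time.
\<close>

definition smooth_real :: "(real \<Rightarrow> real) \<Rightarrow> bool" where
  "smooth_real g \<longleftrightarrow> (\<exists>G. G 0 = g \<and> (\<forall>n x. (G n has_real_derivative G (Suc n) x) (at x)))"

lemma smooth_real_step:
  assumes "smooth_real g"
  shows "\<exists>g'. smooth_real g' \<and> (\<forall>x. (g has_real_derivative g' x) (at x))"
proof -
  obtain G where G: "G 0 = g" "\<And>n x. (G n has_real_derivative G (Suc n) x) (at x)"
    using assms by (auto simp: smooth_real_def)
  have "smooth_real (G 1)" unfolding smooth_real_def using G(2) by (intro exI[of _ "\<lambda>n. G (Suc n)"]) auto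
  with G show ?thesis by (intro exI[of _ "G 1"]) auto
qed

lemma smooth_real_measurable:
  assumes \<theta>: "smooth_real \<theta>" "\<And>t. (\<theta> has_real_derivative \<theta>' t) (at t)"
  shows "\<theta> \<in> borel_measurable borel" "\<theta>' \<in> borel_measurable borel"
proof -
  have m: "f \<in> borel_measurable borel" if "\<And>t. (f has_real_derivative g t) (at t)" for f g :: "real \<Rightarrow> real"
    using that by (intro borel_measurable_continuous_onI continuous_at_imp_continuous_on) (auto intro: DERIV_isCont)
  show "\<theta> \<in> borel_measurable borel" using \<theta>(2) by (rule m)
  obtain g where g: "smooth_real g" "\<And>x. (\<theta> has_real_derivative g x) (at x)" using smooth_real_step[OF \<theta>(1)] by blast
  then have "\<theta>' = g" using \<theta>(2) DERIV_unique by blast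
  with g(1) obtain h where "\<And>x. (\<theta>' has_real_derivative h x) (at x)" using smooth_real_step by blast
  then show "\<theta>' \<in> borel_measurable borel" by (rule m)
qed

lemma smooth_real_coinduct:
  assumes g: "g \<in> X" and step: "\<And>g. g \<in> X \<Longrightarrow> \<exists>g'\<in>X. \<forall>x. (g has_real_derivative g' x) (at x)"
  shows "smooth_real g"
proof -
  obtain d where d: "\<And>g. g \<in> X \<Longrightarrow> d g \<in> X" "\<And>g x. g \<in> X \<Longrightarrow> (g has_real_derivative d g x) (at x)"
    using step by metis
  have X: "(d ^^ n) g \<in> X" for n by (induction n) (auto simp: g d)
  show ?thesis unfolding smooth_real_def
    by (intro exI[of _ "\<lambda>n. (d ^^ n) g"]) (auto intro: d X)
qed

lemma smooth_real_antiderivative: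
  assumes "smooth_real g'" "\<And>x. (g has_real_derivative g' x) (at x)"
  shows "smooth_real g"
  by (rule smooth_real_coinduct[of _ "insert g (Collect smooth_real)"])
     (use assms in \<open>auto dest: smooth_real_step\<close>)

lemma smooth_real_sin_cos: "smooth_real sin" "smooth_real cos"
proof -
  let ?X = "{sin, cos, \<lambda>x. - sin x, \<lambda>x::real. - cos x}"
  have s: "\<exists>g'\<in>?X. \<forall>x. (g has_real_derivative g' x) (at x)" if "g \<in> ?X" for g
    using that by (auto intro!: derivative_eq_intros)
  show "smooth_real sin" "smooth_real cos" by (rule smooth_real_coinduct[of _ ?X], simp, rule s, assumption)+
qed

text \<open>
  The functions \<open>p(1/x) exp(-1/x)\<close>, extended by zero to \<open>x \<le> 0\<close>, form a class that is closed under
  differentiation, as the next derivative formula shows; for \<open>p = 1\<close> this is the standard building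
  block of cutoff functions.
\<close>

definition flat :: "real poly \<Rightarrow> real \<Rightarrow> real" where
  "flat p x = (if 0 < x then poly p (1 / x) * exp (- (1 / x)) else 0)"

lemma poly_times_exp_tendsto_0:
  "((\<lambda>x. poly p x * exp (- x)) \<longlongrightarrow> (0::real)) at_top"
proof -
  have e: "poly p x * exp (- x) = (\<Sum>i\<le>degree p. coeff p i * (x ^ i / exp x))" for x :: real
    by (simp add: poly_altdef sum_distrib_right exp_minus divide_inverse mult.assoc)
  have "((\<lambda>x. \<Sum>i\<le>degree p. coeff p i * (x ^ i / exp x)) \<longlongrightarrow> (\<Sum>i\<le>degree p. coeff p i * 0)) at_top"
    by (intro tendsto_intros tendsto_power_div_exp_0)
  then show ?thesis by (simp add: e)
qed

lemma flat_has_derivative: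
  "(flat p has_real_derivative flat ([:0, 0, 1:] * (p - pderiv p)) x) (at x)"
proof -
  consider "x < 0" | "x = 0" | "x > 0" by linarith
  then show ?thesis
  proof cases
    case 1
    have "((\<lambda>_. 0) has_real_derivative 0) (at x)" by simp
    then have "(flat p has_real_derivative 0) (at x)"
      by (rule has_field_derivative_transform_within_open[of _ _ _ "{..<0}"]) (use 1 in \<open>auto simp: flat_def\<close>)
    with 1 show ?thesis by (simp add: flat_def)
  next
    case 2
    have "((\<lambda>y. (flat p y - flat p 0) / (y - 0)) \<longlongrightarrow> 0) (at 0)"
    proof (rule filterlim_split_at)
      have "\<forall>\<^sub>F y in at_left 0. (flat p y - flat p 0) / (y - 0) = 0"
        by (auto simp: eventually_at_filter flat_def)
      then show "((\<lambda>y. (flat p y - flat p 0) / (y - 0)) \<longlongrightarrow> 0) (at_left 0)" by (rule tendsto_eventually)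
      have "((\<lambda>y. poly ([:0, 1:] * p) (inverse y) * exp (- inverse y)) \<longlongrightarrow> 0) (at_right (0::real))"
        by (rule filterlim_compose[OF poly_times_exp_tendsto_0 filterlim_inverse_at_top_right])
      moreover have "\<forall>\<^sub>F y in at_right 0. poly ([:0, 1:] * p) (inverse y) * exp (- inverse y) = (flat p y - flat p 0) / (y - 0)"
        by (auto simp: eventually_at_filter flat_def divide_inverse)
      ultimately show "((\<lambda>y. (flat p y - flat p 0) / (y - 0)) \<longlongrightarrow> 0) (at_right 0)"
        by (rule Lim_transform_eventually)
    qed
    with 2 show ?thesis by (simp add: has_field_derivative_iff flat_def)
  next
    case 3
    have "((\<lambda>x. poly p (1 / x) * exp (- (1 / x))) has_real_derivative
            poly (pderiv p) (1 / x) * (- 1 / x\<^sup>2) * exp (- (1 / x)) + poly p (1 / x) * (exp (- (1 / x)) * (1 / x\<^sup>2))) (at x)"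
      using 3 by (auto intro!: derivative_eq_intros DERIV_chain2[OF poly_DERIV] simp: power2_eq_square)
    then have "(flat p has_real_derivative
            poly (pderiv p) (1 / x) * (- 1 / x\<^sup>2) * exp (- (1 / x)) + poly p (1 / x) * (exp (- (1 / x)) * (1 / x\<^sup>2))) (at x)"
      by (rule has_field_derivative_transform_within_open[of _ _ _ "{0<..}"]) (use 3 in \<open>auto simp: flat_def\<close>)
    moreover have "poly (pderiv p) (1 / x) * (- 1 / x\<^sup>2) * exp (- (1 / x)) + poly p (1 / x) * (exp (- (1 / x)) * (1 / x\<^sup>2)) =
        flat ([:0, 0, 1:] * (p - pderiv p)) x"
      using 3 by (simp add: flat_def power2_eq_square algebra_simps)
    ultimately show ?thesis by simp
  qed
qed

lemma smooth_real_flat: "smooth_real (flat p)"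
  by (rule smooth_real_coinduct[of _ "range flat"]) (auto intro: flat_has_derivative)

text \<open>
  A class of functions that is closed under all directional derivatives for formal reasons and
  contains every test function used below. Membership yields all orders of \<open>Ck_on\<close> at once.
\<close>

inductive esmooth :: "('a::euclidean_space \<Rightarrow> real) \<Rightarrow> bool" where
  const: "esmooth (\<lambda>_. c)"
| linear: "bounded_linear l \<Longrightarrow> esmooth l"
| add: "esmooth f \<Longrightarrow> esmooth g \<Longrightarrow> esmooth (\<lambda>x. f x + g x)"
| mult: "esmooth f \<Longrightarrow> esmooth g \<Longrightarrow> esmooth (\<lambda>x. f x * g x)"
| comp: "smooth_real g \<Longrightarrow> esmooth f \<Longrightarrow> esmooth (\<lambda>x. g (f x))"

lemma esmooth_has_derivative:
  assumes "esmooth f"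
  shows "\<exists>f'. (\<forall>x. (f has_derivative f' x) (at x)) \<and> (\<forall>v. esmooth (\<lambda>x. f' x v))"
  using assms
proof induction
  case (const c)
  show ?case by (rule exI[of _ "\<lambda>x v. 0"]) (auto intro: esmooth.const)
next
  case (linear l)
  then show ?case by (intro exI[of _ "\<lambda>x. l"]) (auto intro: esmooth.const bounded_linear_imp_has_derivative)
next
  case (add f g)
  then obtain f' g' where "\<And>x. (f has_derivative f' x) (at x)" "\<And>v. esmooth (\<lambda>x. f' x v)"
    "\<And>x. (g has_derivative g' x) (at x)" "\<And>v. esmooth (\<lambda>x. g' x v)" by auto
  then show ?case by (intro exI[of _ "\<lambda>x v. f' x v + g' x v"]) (auto intro: has_derivative_add esmooth.add)
next
  case (mult f g)
  then obtain f' g' where "\<And>x. (f has_derivative f' x) (at x)" "\<And>v. esmooth (\<lambda>x. f' x v)"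
    "\<And>x. (g has_derivative g' x) (at x)" "\<And>v. esmooth (\<lambda>x. g' x v)" by auto
  with mult.hyps show ?case
    by (intro exI[of _ "\<lambda>x v. f x * g' x v + f' x v * g x"])
       (auto intro!: has_derivative_mult esmooth.add esmooth.mult)
next
  case (comp g f)
  then obtain f' where f': "\<And>x. (f has_derivative f' x) (at x)" "\<And>v. esmooth (\<lambda>x. f' x v)" by auto
  obtain g' where g': "smooth_real g'" "\<And>x. (g has_real_derivative g' x) (at x)"
    using smooth_real_step[OF comp.hyps(1)] by blast
  have "((\<lambda>x. g (f x)) has_derivative (\<lambda>v. f' x v * g' (f x))) (at x)" for x
    using has_derivative_compose[OF f'(1), of g "\<lambda>h. h * g' (f x)"] g'(2)[of "f x"]
    by (simp add: has_field_derivative_def mult_commute_abs)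
  then show ?case using f' g' comp.hyps
    by (intro exI[of _ "\<lambda>x v. f' x v * g' (f x)"]) (auto intro: esmooth.mult esmooth.comp)
qed

lemma esmooth_sum: "(\<And>i. i \<in> A \<Longrightarrow> esmooth (f i)) \<Longrightarrow> esmooth (\<lambda>x. \<Sum>i\<in>A. f i x)"
  by (induction A rule: infinite_finite_induct) (auto intro: esmooth.intros)

lemma esmooth_compose_linear:
  assumes "esmooth f" "bounded_linear l"
  shows "esmooth (\<lambda>x. f (l x))"
  using assms(1)
  by induction (auto intro: esmooth.intros bounded_linear_compose[OF _ assms(2)])

lemma esmooth_inner: "esmooth (\<lambda>x. x \<bullet> v)" "esmooth (\<lambda>x. v \<bullet> x)"
  by (auto intro!: esmooth.linear bounded_linear_inner_left bounded_linear_inner_right)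

lemma esmooth_norm2: "esmooth (\<lambda>x::'a::euclidean_space. (norm x)\<^sup>2)"
proof -
  have "esmooth (\<lambda>x::'a. \<Sum>b\<in>Basis. (x \<bullet> b) * (x \<bullet> b))"
    by (intro esmooth_sum esmooth.mult esmooth_inner)
  then show ?thesis unfolding power2_norm_eq_inner by (subst euclidean_inner)
qed

lemma esmooth_continuous: "esmooth f \<Longrightarrow> continuous_on A f"
  by (meson esmooth_has_derivative continuous_at_imp_continuous_on has_derivative_continuous)

lemma esmooth_differentiable: "esmooth f \<Longrightarrow> f differentiable (at x)"
  using esmooth_has_derivative[of f] by (auto simp: differentiable_def)

text \<open>
  The hypothesis on \<open>S\<close> makes derivatives relative to \<open>S\<close> unique. It also holds on the face \<open>t = 0\<close> of a
  half-open time interval.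
\<close>

lemma esmooth_Ck_on:
  assumes S: "\<And>x i e. x \<in> S \<Longrightarrow> i \<in> Basis \<Longrightarrow> e > 0 \<Longrightarrow> \<exists>d. 0 < \<bar>d\<bar> \<and> \<bar>d\<bar> < e \<and> x + d *\<^sub>R i \<in> S"
    and "esmooth f" "\<And>x. x \<in> S \<Longrightarrow> g x = f x"
  shows "Ck_on k S g"
  using assms(2,3)
proof (induction k arbitrary: f g)
  case 0
  then show ?case using esmooth_continuous[of f S] by (simp cong: continuous_on_cong)
next
  case (Suc k)
  obtain f' where f': "\<And>x. (f has_derivative f' x) (at x)" "\<And>v. esmooth (\<lambda>x. f' x v)"
    using esmooth_has_derivative[OF Suc.prems(1)] by auto
  have g': "(g has_derivative f' x) (at x within S)" if "x \<in> S" for x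
    by (rule has_derivative_transform[OF that _ has_derivative_at_withinI[OF f'(1)]]) (use Suc.prems(2) in simp)
  have fd: "frechet_derivative g (at x within S) = f' x" if "x \<in> S" for x
  proof (rule frechet_derivative_unique_within)
    show "(g has_derivative frechet_derivative g (at x within S)) (at x within S)"
      using g'[OF that] frechet_derivative_works differentiableI by blast
    show "(g has_derivative f' x) (at x within S)" by (rule g'[OF that])
  qed (use that S in auto)
  have "g differentiable_on S"
    unfolding differentiable_on_def using g' differentiableI by blast
  moreover have "Ck_on k S (\<lambda>x. frechet_derivative g (at x within S) v)" for v
    by (rule Suc.IH[OF f'(2)[of v]]) (simp only: fd)
  ultimately show ?case by simp
qed

abbreviation pd :: "'n \<Rightarrow> (real^'n \<Rightarrow> real) \<Rightarrow> real^'n \<Rightarrow> real" where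
  "pd i f x \<equiv> frechet_derivative f (at x) (axis i 1)"

lemma esmooth_pd: "esmooth f \<Longrightarrow> esmooth (pd i f)"
proof -
  assume "esmooth f"
  then obtain f' where f': "\<And>x. (f has_derivative f' x) (at x)" "\<And>v. esmooth (\<lambda>x. f' x v)"
    using esmooth_has_derivative by blast
  then have "frechet_derivative f (at x) = f' x" for x by (metis frechet_derivative_at)
  with f'(2) show ?thesis by simp
qed

lemma grad_nth: "grad f x $ i = pd i f x"
  by (simp add: grad_def)

lemma laplacian_esmooth:
  assumes f: "esmooth f"
  shows "laplacian f x = (\<Sum>i\<in>UNIV. pd i (pd i f) x)"
proof -
  have "(grad f has_derivative (\<lambda>h. \<chi> i. frechet_derivative (pd i f) (at x) h)) (at x)"
  proof -
    have "(pd i f has_derivative frechet_derivative (pd i f) (at x)) (at x)" for i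
      using esmooth_differentiable[OF esmooth_pd[OF f]] by (simp add: frechet_derivative_works)
    then show ?thesis
      by (subst has_derivative_componentwise_within) (auto simp: Basis_vec_def inner_axis grad_nth)
  qed
  then have "frechet_derivative (grad f) (at x) = (\<lambda>h. \<chi> i. frechet_derivative (pd i f) (at x) h)"
    by (metis frechet_derivative_at)
  then show ?thesis by (simp add: laplacian_def divergence_def)
qed

lemma esmooth_laplacian: "esmooth (\<psi> :: real^'n \<Rightarrow> real) \<Longrightarrow> esmooth (laplacian \<psi>)"
  by (subst ext[of "laplacian \<psi>" "\<lambda>x. \<Sum>i\<in>UNIV. pd i (pd i \<psi>) x"])
     (simp_all add: laplacian_esmooth esmooth_sum esmooth_pd)

lemma inner_grad: "v \<bullet> grad \<psi> x = (\<Sum>i\<in>UNIV. pd i \<psi> x * v $ i)"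
  by (simp add: inner_vec_def grad_nth mult.commute)

lemma test_function_product:
  fixes \<psi> :: "real^'n \<Rightarrow> real"
  assumes \<theta>: "smooth_real \<theta>" and b: "b < T" "\<And>t. t \<ge> b \<Longrightarrow> \<theta> t = 0"
    and \<psi>: "esmooth \<psi>" "\<And>x. norm x > R \<Longrightarrow> \<psi> x = 0"
  shows "(\<lambda>(t, x). \<theta> t * \<psi> x) \<in> test_functions ({0..<T} \<times> UNIV)"
proof -
  let ?S = "{0..<T} \<times> (UNIV :: (real^'n) set)" and ?f = "\<lambda>(t, x). \<theta> t * \<psi> x"
  have es: "esmooth (\<lambda>z::real \<times> (real^'n). \<theta> (fst z) * \<psi> (snd z))"
    by (intro esmooth.mult esmooth.comp[OF \<theta>] esmooth.linear bounded_linear_fst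
        esmooth_compose_linear[OF \<psi>(1)] bounded_linear_snd)
  have Ck: "Ck_on k ?S ?f" for k
  proof (rule esmooth_Ck_on[OF _ es])
    fix z i :: "real \<times> (real^'n)" and e :: real
    assume z: "z \<in> ?S" and i: "i \<in> Basis" and e: "e > 0"
    show "\<exists>d. 0 < \<bar>d\<bar> \<and> \<bar>d\<bar> < e \<and> z + d *\<^sub>R i \<in> ?S"
    proof -
      let ?d = "min (e / 2) ((T - fst z) / 2)"
      have "0 < ?d" "?d < e" "?d < T - fst z" using z e by (auto simp: min_def)
      moreover have "fst i = 0 \<or> fst i = 1" using i by (auto simp: Basis_prod_def)
      ultimately show ?thesis using z by (intro exI[of _ ?d]) (auto simp: mem_Times_iff)
    qed
  qed (simp add: split_beta)
  let ?C = "{0..b} \<times> cball (0::real^'n) R"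
  have sub: "{z \<in> ?S. ?f z \<noteq> 0} \<subseteq> ?C"
  proof clarsimp
    fix t x assume "0 \<le> t" "\<theta> t \<noteq> 0" "\<psi> x \<noteq> 0"
    then show "t \<le> b \<and> norm x \<le> R" using b(2)[of t] \<psi>(2)[of x] by force
  qed
  have cC: "compact ?C" by (intro compact_Times) auto
  then have "closure {z \<in> ?S. ?f z \<noteq> 0} \<subseteq> ?C"
    using closure_minimal[OF sub] compact_imp_closed by blast
  moreover have "?C \<subseteq> ?S" using b by auto
  moreover have "compact (closure {z \<in> ?S. ?f z \<noteq> 0})"
    using bounded_subset[OF compact_imp_bounded[OF cC] sub] by (simp add: compact_closure)
  ultimately show ?thesis using Ck unfolding test_functions_def by blast
qed

lemma pd_eqI: "(f has_derivative f') (at x) \<Longrightarrow> pd i f x = f' (axis i 1)"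
  by (metis frechet_derivative_at)

lemma esmooth_frechet: "esmooth f \<Longrightarrow> (f has_derivative frechet_derivative f (at x)) (at x)"
  using esmooth_differentiable frechet_derivative_works by blast

lemma pd_mult:
  assumes "esmooth f" "esmooth g"
  shows "pd i (\<lambda>x. f x * g x) x = pd i f x * g x + f x * pd i g x"
  by (subst pd_eqI[OF has_derivative_mult[OF esmooth_frechet[OF assms(1)] esmooth_frechet[OF assms(2)]]]) simp

lemma pd_add:
  assumes "esmooth f" "esmooth g"
  shows "pd i (\<lambda>x. f x + g x) x = pd i f x + pd i g x"
  by (subst pd_eqI[OF has_derivative_add[OF esmooth_frechet[OF assms(1)] esmooth_frechet[OF assms(2)]]]) simp

lemma pd_cmult:
  assumes "esmooth f"
  shows "pd i (\<lambda>x. c * f x) x = c * pd i f x"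
  by (subst pd_eqI[OF has_derivative_mult_right[OF esmooth_frechet[OF assms]]]) simp

lemma pd_scale:
  assumes "esmooth f"
  shows "pd i (\<lambda>x. f (c *\<^sub>R x)) x = c * pd i f (c *\<^sub>R x)"
proof -
  have "((\<lambda>x. c *\<^sub>R x) has_derivative (\<lambda>h. c *\<^sub>R h)) (at x)" by (auto intro!: derivative_eq_intros)
  from has_derivative_compose[OF this esmooth_frechet[OF assms]]
  have "pd i (\<lambda>x. f (c *\<^sub>R x)) x = frechet_derivative f (at (c *\<^sub>R x)) (c *\<^sub>R axis i 1)" by (rule pd_eqI)
  also have "\<dots> = c * pd i f (c *\<^sub>R x)"
    using linear_cmul[OF has_derivative_linear[OF esmooth_frechet[OF assms]]] by simp
  finally show ?thesis .
qed

lemma esmooth_trig: "esmooth (\<lambda>x. cos (\<xi> \<bullet> x))" "esmooth (\<lambda>x. sin (\<xi> \<bullet> x))"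
  by (rule esmooth.comp[OF smooth_real_sin_cos(2)] esmooth.comp[OF smooth_real_sin_cos(1)], rule esmooth_inner)+

lemma pd_trig:
  "pd i (\<lambda>x. cos (\<xi> \<bullet> x)) x = - \<xi> $ i * sin (\<xi> \<bullet> x)"
  "pd i (\<lambda>x. sin (\<xi> \<bullet> x)) x = \<xi> $ i * cos (\<xi> \<bullet> x)"
proof -
  have "((\<lambda>x. cos (\<xi> \<bullet> x)) has_derivative (\<lambda>h. - (\<xi> \<bullet> h) * sin (\<xi> \<bullet> x))) (at x)"
    "((\<lambda>x. sin (\<xi> \<bullet> x)) has_derivative (\<lambda>h. (\<xi> \<bullet> h) * cos (\<xi> \<bullet> x))) (at x)"
    by (auto intro!: derivative_eq_intros)
  from this[THEN pd_eqI, of i]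
  show "pd i (\<lambda>x. cos (\<xi> \<bullet> x)) x = - \<xi> $ i * sin (\<xi> \<bullet> x)" "pd i (\<lambda>x. sin (\<xi> \<bullet> x)) x = \<xi> $ i * cos (\<xi> \<bullet> x)"
    by (simp_all add: inner_axis)
qed

lemma sum_square_vec: "(\<Sum>i\<in>UNIV. (\<xi> $ i)\<^sup>2) = (norm \<xi>)\<^sup>2"
  unfolding power2_norm_eq_inner inner_vec_def by (simp add: power2_eq_square)

text \<open>
  The three terms are the contributions of \<open>\<Delta>f\<close>, of the cross term \<open>2 \<nabla>f \<cdot> \<nabla>e\<close> and of \<open>\<Delta>e\<close>, where \<open>e\<close> is
  the trigonometric factor; together they are the real and imaginary part of \<open>\<Delta>(f exp(i \<xi> \<cdot> x))\<close>.
\<close>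

lemma laplacian_trig:
  assumes f: "esmooth f"
  shows "laplacian (\<lambda>x. f x * cos (\<xi> \<bullet> x)) x =
      laplacian f x * cos (\<xi> \<bullet> x) - 2 * (\<Sum>i\<in>UNIV. \<xi> $ i * pd i f x) * sin (\<xi> \<bullet> x) - (norm \<xi>)\<^sup>2 * f x * cos (\<xi> \<bullet> x)"
    and "laplacian (\<lambda>x. f x * sin (\<xi> \<bullet> x)) x =
      laplacian f x * sin (\<xi> \<bullet> x) + 2 * (\<Sum>i\<in>UNIV. \<xi> $ i * pd i f x) * cos (\<xi> \<bullet> x) - (norm \<xi>)\<^sup>2 * f x * sin (\<xi> \<bullet> x)"
proof -
  note es = f esmooth_trig esmooth_pd[OF f] esmooth.mult
  have 1: "pd i (\<lambda>x. f x * cos (\<xi> \<bullet> x)) = (\<lambda>x. pd i f x * cos (\<xi> \<bullet> x) + (- \<xi> $ i) * (f x * sin (\<xi> \<bullet> x)))" for i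
    by (rule ext, subst pd_mult) (auto simp: es pd_trig)
  have 2: "pd i (\<lambda>x. f x * sin (\<xi> \<bullet> x)) = (\<lambda>x. pd i f x * sin (\<xi> \<bullet> x) + \<xi> $ i * (f x * cos (\<xi> \<bullet> x)))" for i
    by (rule ext, subst pd_mult) (auto simp: es pd_trig)
  have 3: "pd i (pd i (\<lambda>x. f x * cos (\<xi> \<bullet> x))) x =
     pd i (pd i f) x * cos (\<xi> \<bullet> x) - 2 * (\<xi> $ i * pd i f x) * sin (\<xi> \<bullet> x) - (\<xi> $ i)\<^sup>2 * (f x * cos (\<xi> \<bullet> x))" for i
    unfolding 1
    by (subst pd_add pd_mult pd_cmult; (intro es esmooth.const)?)+ (simp add: pd_trig power2_eq_square algebra_simps)
  have 4: "pd i (pd i (\<lambda>x. f x * sin (\<xi> \<bullet> x))) x =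
     pd i (pd i f) x * sin (\<xi> \<bullet> x) + 2 * (\<xi> $ i * pd i f x) * cos (\<xi> \<bullet> x) - (\<xi> $ i)\<^sup>2 * (f x * sin (\<xi> \<bullet> x))" for i
    unfolding 2
    by (subst pd_add pd_mult pd_cmult; (intro es esmooth.const)?)+ (simp add: pd_trig power2_eq_square algebra_simps)
  show "laplacian (\<lambda>x. f x * cos (\<xi> \<bullet> x)) x =
      laplacian f x * cos (\<xi> \<bullet> x) - 2 * (\<Sum>i\<in>UNIV. \<xi> $ i * pd i f x) * sin (\<xi> \<bullet> x) - (norm \<xi>)\<^sup>2 * f x * cos (\<xi> \<bullet> x)"
    by (simp add: laplacian_esmooth es 3 sum.distrib sum_subtractf sum_distrib_right sum_distrib_left flip: sum_square_vec)
       (simp add: mult.assoc)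
  show "laplacian (\<lambda>x. f x * sin (\<xi> \<bullet> x)) x =
      laplacian f x * sin (\<xi> \<bullet> x) + 2 * (\<Sum>i\<in>UNIV. \<xi> $ i * pd i f x) * cos (\<xi> \<bullet> x) - (norm \<xi>)\<^sup>2 * f x * sin (\<xi> \<bullet> x)"
    by (simp add: laplacian_esmooth es 4 sum.distrib sum_subtractf sum_distrib_right sum_distrib_left flip: sum_square_vec)
       (simp add: mult.assoc)
qed

text \<open>
  A smooth bump supported in the ball of radius \<open>R\<close>, normalized so that its value at the origin is 1.
  It is not constant on a smaller ball, but it converges to 1 pointwise as \<open>R\<close> grows, which is what
  dominated convergence needs. Differences are written with a factor \<open>-1\<close> to match the rules of \<open>esmooth\<close>.
\<close>

definition cut :: "real \<Rightarrow> 'a::euclidean_space \<Rightarrow> real" where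
  "cut R x = exp 1 * flat [:1:] (1 + (norm ((1 / R) *\<^sub>R x))\<^sup>2 * (-1))"

lemma esmooth_cut: "esmooth (cut R)"
  unfolding cut_def[abs_def]
  by (intro esmooth.mult esmooth.const esmooth.comp[OF smooth_real_flat] esmooth.add
      esmooth_compose_linear[OF esmooth_norm2] bounded_linear_scaleR_right)

lemma cut_bounds: "0 \<le> cut R x" "cut R x \<le> 1"
proof -
  let ?s = "1 + (norm ((1 / R) *\<^sub>R x))\<^sup>2 * (-1)"
  have s: "?s \<le> 1" by simp
  show "0 \<le> cut R x" by (simp add: cut_def flat_def)
  show "cut R x \<le> 1"
  proof (cases "?s > 0")
    case True
    have "1 \<le> 1 / ?s" using True s by (simp only: le_divide_eq_1_pos)
    then have "exp (1 + - (1 / ?s)) \<le> 1" by (simp only: exp_le_one_iff)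
    moreover have "cut R x = exp (1 + - (1 / ?s))" using True by (simp only: cut_def flat_def exp_add) simp
    ultimately show ?thesis by simp
  qed (simp add: cut_def flat_def)
qed

lemma cut_eq_0: "R > 0 \<Longrightarrow> norm x > R \<Longrightarrow> cut R x = 0"
proof -
  assume R: "R > 0" "norm x > R"
  then have "1 \<le> (norm ((1 / R) *\<^sub>R x))\<^sup>2"
    by (intro one_le_power) (simp add: field_simps)
  then show ?thesis by (simp add: cut_def flat_def)
qed

lemma cut_tendsto: "(\<lambda>n. cut (real (Suc n)) x) \<longlonglongrightarrow> 1"
proof -
  let ?s = "\<lambda>n. 1 + (norm ((1 / real (Suc n)) *\<^sub>R x))\<^sup>2 * (-1)"
  have "(\<lambda>n. (1 / real (Suc n)) *\<^sub>R x) \<longlonglongrightarrow> 0"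
    using tendsto_scaleR[OF LIMSEQ_Suc[OF lim_1_over_n] tendsto_const[of x]] by simp
  then have "?s \<longlonglongrightarrow> 1 + (norm (0::'a))\<^sup>2 * (-1)" by (intro tendsto_intros)
  then have "?s \<longlonglongrightarrow> 1" by simp
  moreover have "isCont (flat [:1:]) 1" using flat_has_derivative by (rule DERIV_isCont)
  ultimately have "(\<lambda>n. flat [:1:] (?s n)) \<longlonglongrightarrow> flat [:1:] 1" by (rule isCont_tendsto_compose[rotated])
  from tendsto_mult[OF tendsto_const[of "exp 1"] this]
  show ?thesis by (simp add: cut_def flat_def exp_minus)
qed

lemma pd_outside:
  assumes "\<And>x. norm x > R \<Longrightarrow> f x = 0" "norm x > R"
  shows "pd i f x = 0"
proof -
  have "((\<lambda>_. 0) has_derivative (\<lambda>_. 0)) (at x)" by simp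
  moreover have "open {x. R < norm x}" by (intro open_Collect_less continuous_intros)
  ultimately have "(f has_derivative (\<lambda>_. 0)) (at x)"
    by (rule has_derivative_transform_within_open[of _ _ _ UNIV, simplified]) (use assms in auto)
  then show ?thesis by (rule pd_eqI)
qed

lemma esmooth_bounded:
  assumes "esmooth f" "\<And>x. norm x > R \<Longrightarrow> f x = 0"
  shows "\<exists>C. \<forall>x. \<bar>f x\<bar> \<le> C"
proof -
  have "bounded (f ` cball 0 R)"
    using compact_continuous_image[OF esmooth_continuous[OF assms(1)] compact_cball] by (rule compact_imp_bounded)
  then obtain C where C: "C > 0" "\<And>x. norm x \<le> R \<Longrightarrow> \<bar>f x\<bar> \<le> C"
    by (auto simp: bounded_pos)
  have "\<bar>f x\<bar> \<le> C" for x using C assms(2)[of x] by (cases "norm x \<le> R") auto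
  then show ?thesis by blast
qed

text \<open>
  Since \<open>cut R\<close> is a dilation of \<open>cut 1\<close>, each derivative gains a factor \<open>1/R\<close>.
\<close>

lemma cut_derivative_bounds:
  "\<exists>C\<ge>0. \<forall>R\<ge>1. \<forall>x::real^'n. (\<forall>i. \<bar>pd i (cut R) x\<bar> \<le> C) \<and> \<bar>laplacian (cut R) x\<bar> \<le> C"
proof -
  let ?c = "cut 1 :: real^'n \<Rightarrow> real"
  have o: "norm x > 1 \<Longrightarrow> ?c x = 0" for x by (simp add: cut_eq_0)
  have o1: "norm x > 1 \<Longrightarrow> pd i ?c x = 0" for x i by (rule pd_outside[OF o])
  have o2: "norm x > 1 \<Longrightarrow> pd i (pd i ?c) x = 0" for x i by (rule pd_outside[OF o1])
  note e1 = esmooth_pd[OF esmooth_cut[of 1]] and e2 = esmooth_pd[OF esmooth_pd[OF esmooth_cut[of 1]]]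
  obtain A where A: "\<And>i x. \<bar>pd i ?c x\<bar> \<le> A i" using esmooth_bounded[OF e1 o1] by metis
  obtain B where B: "\<And>i x. \<bar>pd i (pd i ?c) x\<bar> \<le> B i" using esmooth_bounded[OF e2 o2] by metis
  have A0: "0 \<le> A i" and B0: "0 \<le> B i" for i using A[where x=0 and i=i] B[where x=0 and i=i] by linarith+
  let ?C = "(\<Sum>i\<in>UNIV. A i) + (\<Sum>i\<in>UNIV. B i)"
  have s: "cut R = (\<lambda>x::real^'n. ?c ((1 / R) *\<^sub>R x))" for R by (simp add: cut_def fun_eq_iff)
  have p1: "pd i (cut R) = (\<lambda>x::real^'n. (1 / R) * pd i ?c ((1 / R) *\<^sub>R x))" for R i
    unfolding s[of R] by (rule ext, rule pd_scale[OF esmooth_cut])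
  have p2: "pd i (pd i (cut R)) x = (1 / R) * ((1 / R) * pd i (pd i ?c) ((1 / R) *\<^sub>R x))" for R i and x :: "real^'n"
    unfolding p1[where R=R and i=i]
    by (subst pd_cmult) (auto intro!: esmooth_compose_linear[OF e1] bounded_linear_scaleR_right simp: pd_scale[OF e1])
  show ?thesis
  proof (intro exI[of _ ?C] conjI allI impI)
    show "0 \<le> ?C" using A0 B0 by (simp add: sum_nonneg)
    fix R :: real and x :: "real^'n" assume R: "1 \<le> R"
    have r: "0 \<le> 1 / R" "1 / R \<le> 1" using R by auto
    show "\<bar>pd i (cut R) x\<bar> \<le> ?C" for i
    proof -
      have "\<bar>pd i (cut R) x\<bar> \<le> 1 * \<bar>pd i ?c ((1 / R) *\<^sub>R x)\<bar>"
        unfolding fun_cong[OF p1[where R=R and i=i]] abs_mult using r by (intro mult_right_mono) auto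
      also have "\<dots> \<le> A i" using A by simp
      also have "\<dots> \<le> (\<Sum>i\<in>UNIV. A i)" using A0 by (intro member_le_sum) auto
      also have "\<dots> \<le> ?C" using B0 by (simp add: sum_nonneg)
      finally show ?thesis .
    qed
    have "\<bar>pd i (pd i (cut R)) x\<bar> \<le> B i" for i
    proof -
      have "\<bar>pd i (pd i (cut R)) x\<bar> \<le> 1 * (1 * \<bar>pd i (pd i ?c) ((1 / R) *\<^sub>R x)\<bar>)"
        unfolding p2[where R=R and i=i] abs_mult using r by (intro mult_mono) auto
      with B[where i=i] show ?thesis by (simp add: order_trans)
    qed
    then have "\<bar>laplacian (cut R) x\<bar> \<le> (\<Sum>i\<in>UNIV. B i)"
      unfolding laplacian_esmooth[OF esmooth_cut] by (intro order_trans[OF sum_abs] sum_mono)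
    also have "\<dots> \<le> ?C" using A0 by (simp add: sum_nonneg)
    finally show "\<bar>laplacian (cut R) x\<bar> \<le> ?C" .
  qed
qed

section \<open>Primitives of integrable functions\<close>

text \<open>
  The positive and the negative part of \<open>h\<close> are densities of finite measures that agree on half-lines,
  hence everywhere.
\<close>

lemma AE_zero_of_tail_integrals:
  fixes h :: "real \<Rightarrow> real"
  assumes h: "integrable lborel h" and z: "\<And>x. (LBINT s. indicat_real {x<..} s * h s) = 0"
  shows "AE s in lborel. h s = 0"
proof -
  have [measurable]: "h \<in> borel_measurable borel" using h by simp
  let ?p = "\<lambda>s. ennreal (h s)" and ?n = "\<lambda>s. ennreal (- h s)"
  have fin: "(\<integral>\<^sup>+s. ?p s \<partial>lborel) < \<infinity>" "(\<integral>\<^sup>+s. ?n s \<partial>lborel) < \<infinity>"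
    using h by (simp_all add: real_integrable_def less_top)
  have "density lborel ?p = density lborel ?n"
  proof (rule measure_eqI_lessThan)
    fix x :: real
    have i: "integrable lborel (\<lambda>s. indicat_real {x<..} s * h s)"
      using integrable_mult_bounded[OF h, of "indicat_real {x<..}" 1] by simp
    have pos: "emeasure (density lborel ?p) {x<..} = (\<integral>\<^sup>+s. ennreal (indicat_real {x<..} s * h s) \<partial>lborel)"
      by (simp add: emeasure_density) (auto intro!: nn_integral_cong simp: indicator_def)
    have neg: "emeasure (density lborel ?n) {x<..} = (\<integral>\<^sup>+s. ennreal (- (indicat_real {x<..} s * h s)) \<partial>lborel)"
      by (simp add: emeasure_density) (auto intro!: nn_integral_cong simp: indicator_def)
    have fin': "(\<integral>\<^sup>+s. ennreal (indicat_real {x<..} s * h s) \<partial>lborel) < \<infinity>"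
      "(\<integral>\<^sup>+s. ennreal (- (indicat_real {x<..} s * h s)) \<partial>lborel) < \<infinity>"
      using i by (simp_all add: real_integrable_def less_top)
    show "emeasure (density lborel ?p) {x<..} < \<infinity>" using fin' pos by simp
    have "enn2real (\<integral>\<^sup>+s. ennreal (indicat_real {x<..} s * h s) \<partial>lborel) =
        enn2real (\<integral>\<^sup>+s. ennreal (- (indicat_real {x<..} s * h s)) \<partial>lborel)"
      using z[of x] unfolding real_lebesgue_integral_def[OF i] by simp
    then show "emeasure (density lborel ?p) {x<..} = emeasure (density lborel ?n) {x<..}"
      unfolding pos neg using fin' by (metis ennreal_enn2real infinity_ennreal_def)
  qed simp_all
  then have "AE s in lborel. ?p s = ?n s"
    using fin by (subst (asm) finite_density_unique) auto
  then show ?thesis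
  proof eventually_elim
    case (elim s)
    show ?case
    proof (cases "0 \<le> h s")
      case True
      with elim have "ennreal (h s) = 0" by (simp add: ennreal_neg)
      with True show ?thesis by simp
    next
      case False
      with elim have "ennreal (- h s) = 0" by (simp add: ennreal_neg)
      with False show ?thesis by simp
    qed
  qed
qed

lemma integrable_indicat_Ioo: "integrable lborel (indicat_real {a<..<b::real})"
  by (cases "a \<le> b") (simp_all add: integrable_indicator_iff)

lemma AE_zero_of_interval_integrals:
  fixes h :: "real \<Rightarrow> real"
  assumes h: "integrable lborel h" and supp: "\<And>s. s \<le> 0 \<or> T \<le> s \<Longrightarrow> h s = 0"
    and z: "\<And>a b. 0 < a \<Longrightarrow> a < b \<Longrightarrow> b < T \<Longrightarrow> (LBINT s. indicat_real {a<..<b} s * h s) = 0"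
  shows "AE s in lborel. h s = 0"
proof (rule AE_zero_of_tail_integrals[OF h])
  fix x :: real
  have [measurable]: "h \<in> borel_measurable borel" using h by simp
  let ?y = "max x 0"
  let ?a = "\<lambda>n. ?y + 1 / real (Suc n)" and ?b = "\<lambda>n. T - 1 / real (Suc n)"
  have l0: "(\<lambda>n. 1 / real (Suc n)) \<longlonglongrightarrow> 0" by (rule LIMSEQ_Suc[OF lim_1_over_n])
  have "(\<lambda>n. LBINT s. indicat_real {?a n<..<?b n} s * h s) \<longlonglongrightarrow> (LBINT s. indicat_real {x<..} s * h s)"
  proof (rule integral_dominated_convergence[where w="\<lambda>s. \<bar>h s\<bar>"])
    show "AE s in lborel. (\<lambda>n. indicat_real {?a n<..<?b n} s * h s) \<longlonglongrightarrow> indicat_real {x<..} s * h s"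
    proof (intro AE_I2)
      fix s :: real
      show "(\<lambda>n. indicat_real {?a n<..<?b n} s * h s) \<longlonglongrightarrow> indicat_real {x<..} s * h s"
      proof (cases "0 < s \<and> s < T \<and> x < s")
        case True
        have A: "?a \<longlonglongrightarrow> ?y + 0" and B: "?b \<longlonglongrightarrow> T - 0" by (intro tendsto_intros l0)+
        have "\<forall>\<^sub>F n in sequentially. ?a n < s" using True by (intro order_tendstoD(2)[OF A]) auto
        moreover have "\<forall>\<^sub>F n in sequentially. s < ?b n" using True by (intro order_tendstoD(1)[OF B]) auto
        ultimately have "\<forall>\<^sub>F n in sequentially. indicat_real {?a n<..<?b n} s * h s = indicat_real {x<..} s * h s"
          by eventually_elim (use True in auto)
        then show ?thesis by (rule tendsto_eventually)
      next
        case False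
        have "indicat_real {?a n<..<?b n} s * h s = indicat_real {x<..} s * h s" for n
        proof -
          define c where "c = 1 / real (Suc n)"
          have "0 \<le> c" by (simp add: c_def)
          then show ?thesis
            using False supp[of s] unfolding c_def[symmetric]
            by (cases "s \<le> 0 \<or> T \<le> s") (auto simp: indicator_def not_less max_def split: if_splits)
        qed
        then show ?thesis by (simp only: tendsto_const)
      qed
    qed
  qed (use h in \<open>auto simp: indicator_def\<close>)
  moreover have "(LBINT s. indicat_real {?a n<..<?b n} s * h s) = 0" for n
  proof (cases "?a n < ?b n")
    case True
    have "0 < ?a n" by (rule add_nonneg_pos) auto
    then show ?thesis using True by (intro z) auto
  qed simp
  ultimately show "(LBINT s. indicat_real {x<..} s * h s) = 0" by (simp add: LIMSEQ_const_iff)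
qed

text \<open>
  The primitive that vanishes at 0, defined for all \<open>t\<close>; it is zero for \<open>t \<le> 0\<close>.
\<close>

definition prim :: "(real \<Rightarrow> real) \<Rightarrow> real \<Rightarrow> real" where
  "prim f t = (LBINT s. indicat_real {0<..<t} s * f s)"

lemma integrable_indicat_mult:
  fixes f :: "'a::euclidean_space \<Rightarrow> real"
  shows "integrable lborel f \<Longrightarrow> A \<in> sets borel \<Longrightarrow> integrable lborel (\<lambda>s. indicat_real A s * f s)"
  using integrable_mult_bounded[of lborel f "indicat_real A" 1] by simp

lemma borel_measurable_prim[measurable]:
  assumes [measurable]: "f \<in> borel_measurable borel"
  shows "prim f \<in> borel_measurable borel"
proof -
  have "(\<lambda>t. LBINT s. indicat_real {0<..<t} s * f s) \<in> borel_measurable lborel"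
  proof (rule lborel.borel_measurable_lebesgue_integral)
    have "(\<lambda>z::real\<times>real. (if 0 < snd z \<and> snd z < fst z then 1 else 0) * f (snd z)) \<in> borel_measurable borel"
      by measurable
    moreover have "(\<lambda>(t, s). indicat_real {0<..<t} s * f s) = (\<lambda>z. (if 0 < snd z \<and> snd z < fst z then 1 else 0) * f (snd z))"
      by (auto simp: indicator_def)
    ultimately show "(\<lambda>(t, s). indicat_real {0<..<t} s * f s) \<in> borel_measurable (lborel \<Otimes>\<^sub>M lborel)"
      by (simp add: lborel_prod)
  qed
  then show ?thesis by (simp add: prim_def[abs_def])
qed

lemma prim_bound: "\<bar>prim f t\<bar> \<le> (LBINT s. \<bar>f s\<bar>)" if "integrable lborel f"
proof -
  have "norm (prim f t) \<le> (LBINT s. norm (indicat_real {0<..<t} s * f s))"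
    unfolding prim_def by (rule integral_norm_bound)
  also have "\<dots> \<le> (LBINT s. \<bar>f s\<bar>)"
    using that by (intro integral_mono') (auto simp: indicator_def)
  finally show ?thesis by simp
qed

text \<open>
  The chain rule for the square of an absolutely continuous function. It is obtained without
  differentiation: the square \<open>(0,t) \<times> (0,t)\<close> is cut along its diagonal, and by Fubini both triangles
  contribute the same.
\<close>

lemma prim_square:
  assumes f: "integrable lborel f"
  shows "integrable lborel (\<lambda>s. f s * prim f s)" and "(prim f t)\<^sup>2 = 2 * prim (\<lambda>s. f s * prim f s) t"
proof -
  have [measurable]: "f \<in> borel_measurable borel" using f by simp
  show "integrable lborel (\<lambda>s. f s * prim f s)"
    using integrable_mult_bounded[OF f, of "prim f" "LBINT s. \<bar>f s\<bar>"] prim_bound[OF f] by (simp add: mult.commute)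
  let ?g = "\<lambda>s. indicat_real {0<..<t} s * f s"
  have g: "integrable lborel ?g" by (rule integrable_indicat_mult[OF f]) simp
  have t: "integrable lborel (\<lambda>p. ?g (fst p) * ?g (snd p))" by (rule integrable_lborel_tensor[OF g g])
  let ?L = "\<lambda>r s. if r < s then ?g r * ?g s else 0"
  have iL: "integrable (lborel \<Otimes>\<^sub>M lborel) (\<lambda>(r, s). ?L r s)"
  proof -
    have "integrable lborel (\<lambda>p. (if fst p < snd p then 1 else 0) *\<^sub>R (?g (fst p) * ?g (snd p)))"
      by (rule integrable_mult_bounded[OF t, of _ 1]) auto
    then show ?thesis unfolding lborel_prod by (rule back_subst[of "integrable lborel"]) (auto simp: split_beta')
  qed
  have iL': "integrable (lborel \<Otimes>\<^sub>M lborel) (\<lambda>(s, r). ?L r s)"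
    using lborel_pair.integrable_product_swap[OF iL] by (simp add: split_beta' cong: if_cong)
  have "(prim f t)\<^sup>2 = (LBINT r. LBINT s. ?g r * ?g s)"
    by (simp add: prim_def power2_eq_square)
  also have "\<dots> = (LBINT r. (LBINT s. ?L r s) + (LBINT s. ?L s r))"
  proof (rule Bochner_Integration.integral_cong[OF refl])
    fix r
    have i1: "integrable lborel (\<lambda>s. ?L r s)"
      using integrable_mult_bounded[OF g, of "\<lambda>s. if r < s then ?g r else 0" "\<bar>?g r\<bar>"]
      by (rule back_subst[of "integrable lborel"]) auto
    have i2: "integrable lborel (\<lambda>s. ?L s r)"
      using integrable_mult_bounded[OF g, of "\<lambda>s. if s < r then ?g r else 0" "\<bar>?g r\<bar>"]
      by (rule back_subst[of "integrable lborel"]) auto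
    have "(LBINT s. ?g r * ?g s) = (LBINT s. ?L r s + ?L s r)"
      by (rule integral_cong_AE) (use AE_lborel_singleton[of r] in \<open>auto elim!: eventually_mono\<close>)
    then show "(LBINT s. ?g r * ?g s) = (LBINT s. ?L r s) + (LBINT s. ?L s r)"
      using i1 i2 by simp
  qed
  also have "\<dots> = (LBINT r. LBINT s. ?L r s) + (LBINT r. LBINT s. ?L s r)"
    using lborel_pair.integrable_fst[OF iL] lborel_pair.integrable_fst[OF iL'] by (rule Bochner_Integration.integral_add)
  also have "(LBINT r. LBINT s. ?L r s) = (LBINT s. LBINT r. ?L r s)"
    by (rule lborel_pair.Fubini_integral[OF iL, symmetric])
  also have "(LBINT s. LBINT r. ?L r s) = prim (\<lambda>s. f s * prim f s) t"
    unfolding prim_def[of _ t]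
  proof (rule Bochner_Integration.integral_cong[OF refl])
    fix s
    have "(LBINT r. ?L r s) = (LBINT r. ?g s * (indicat_real {0<..<s} r * f r))"
      by (rule Bochner_Integration.integral_cong) (auto simp: indicator_def)
    then show "(LBINT r. ?L r s) = indicat_real {0<..<t} s * (f s * prim f s)" by (simp add: prim_def)
  qed
  finally show "(prim f t)\<^sup>2 = 2 * prim (\<lambda>s. f s * prim f s) t" by simp
qed

lemma prim_continuous:
  assumes f: "integrable lborel f"
  shows "continuous_on A (prim f)"
proof (rule continuous_at_imp_continuous_on, intro ballI)
  fix t
  have [measurable]: "f \<in> borel_measurable borel" using f by simp
  show "isCont (prim f) t"
  proof (rule continuous_at_sequentiallyI)
    fix u :: "nat \<Rightarrow> real" assume u: "u \<longlonglongrightarrow> t"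
    show "(\<lambda>n. prim f (u n)) \<longlonglongrightarrow> prim f t"
      unfolding prim_def
    proof (rule integral_dominated_convergence[where w="\<lambda>s. \<bar>f s\<bar>"])
      show "AE s in lborel. (\<lambda>n. indicat_real {0<..<u n} s * f s) \<longlonglongrightarrow> indicat_real {0<..<t} s * f s"
        using AE_lborel_singleton[of t]
      proof eventually_elim
        case (elim s)
        have "\<forall>\<^sub>F n in sequentially. s < u n \<longleftrightarrow> s < t"
        proof (cases "s < t")
          case True from order_tendstoD(1)[OF u this] show ?thesis by eventually_elim (use True in simp)
        next
          case False then have "t < s" using elim by simp
          from order_tendstoD(2)[OF u this] show ?thesis by eventually_elim (use False in simp)
        qed
        then have "\<forall>\<^sub>F n in sequentially. indicat_real {0<..<u n} s * f s = indicat_real {0<..<t} s * f s"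
          by eventually_elim (simp add: indicator_def)
        then show ?case by (rule tendsto_eventually)
      qed
    qed (use f in \<open>auto simp: indicator_def\<close>)
  qed
qed

text \<open>
  The constant must depend on \<open>\<mu>\<close> and \<open>T\<close> only, because the lemma is applied along a sequence of functions
  \<open>y\<close> with \<open>\<epsilon>\<close> tending to zero. Let \<open>Y\<close> be the right-hand side of the assumed inequality. It is
  nondecreasing and bounds \<open>y\<close>, so \<open>Y(b) \<le> Y(a) + (\<integral>\<^sub>a\<^sup>b \<mu>) Y(b)\<close>: it at most doubles over an interval on which
  \<open>\<mu>\<close> has integral at most 1/2. By uniform continuity of the primitive of \<open>\<mu>\<close>, boundedly many such
  intervals cover \<open>[0,T]\<close>.
\<close>

lemma gronwall_L1:
  fixes \<mu> :: "real \<Rightarrow> real"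
  assumes \<mu>: "integrable lborel \<mu>" "\<And>s. 0 \<le> \<mu> s" and T: "T > 0"
  shows "\<exists>C\<ge>0. \<forall>y \<epsilon>. 0 \<le> \<epsilon> \<longrightarrow> (\<forall>s. 0 \<le> y s) \<longrightarrow> integrable lborel (\<lambda>s. \<mu> s * y s) \<longrightarrow>
           (AE t in lborel. 0 < t \<and> t < T \<longrightarrow> y t \<le> \<epsilon> + prim (\<lambda>s. \<mu> s * y s) t) \<longrightarrow>
           (AE t in lborel. 0 < t \<and> t < T \<longrightarrow> y t \<le> C * \<epsilon>)"
proof -
  have [measurable]: "\<mu> \<in> borel_measurable borel" using \<mu> by simp
  have "uniformly_continuous_on {0..T} (prim \<mu>)"
    by (intro compact_uniformly_continuous prim_continuous \<mu> compact_Icc)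
  then obtain d where d: "d > 0" "\<And>a b. a \<in> {0..T} \<Longrightarrow> b \<in> {0..T} \<Longrightarrow> dist a b < d \<Longrightarrow> dist (prim \<mu> a) (prim \<mu> b) < 1/2"
    unfolding uniformly_continuous_on_def by (metis half_gt_zero_iff zero_less_one)
  obtain N where N: "N > 0" "T / real N < d"
    using reals_Archimedean2[of "T / d"] d(1) T
    by (metis divide_less_eq divide_pos_pos mult.commute of_nat_0_less_iff order_less_trans)
  show ?thesis
  proof (intro exI[of _ "2 ^ N"] conjI allI impI)
    fix y :: "real \<Rightarrow> real" and \<epsilon> :: real
    assume \<epsilon>: "0 \<le> \<epsilon>" and y: "\<forall>s. 0 \<le> y s" and i: "integrable lborel (\<lambda>s. \<mu> s * y s)"
      and le: "AE t in lborel. 0 < t \<and> t < T \<longrightarrow> y t \<le> \<epsilon> + prim (\<lambda>s. \<mu> s * y s) t"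
    let ?Y = "\<lambda>t. \<epsilon> + prim (\<lambda>s. \<mu> s * y s) t"
    have mono: "?Y a \<le> ?Y b" if "a \<le> b" for a b
      unfolding prim_def using that \<mu>(2) y
      by (intro add_left_mono integral_mono integrable_indicat_mult i) (auto simp: indicator_def)
    have step: "?Y b \<le> ?Y a + (prim \<mu> b - prim \<mu> a) * ?Y b" if ab: "0 \<le> a" "a \<le> b" "b \<le> T" for a b
    proof -
      have df: "prim h b - prim h a = (LBINT s. indicat_real ({0<..<b} - {0<..<a}) s * h s)" if "integrable lborel h" for h
      proof -
        have "prim h b - prim h a = (LBINT s. indicat_real {0<..<b} s * h s - indicat_real {0<..<a} s * h s)"
          unfolding prim_def by (simp add: integrable_indicat_mult that)
        also have "\<dots> = (LBINT s. indicat_real ({0<..<b} - {0<..<a}) s * h s)"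
          using ab by (intro Bochner_Integration.integral_cong) (auto simp: indicator_def)
        finally show ?thesis .
      qed
      have "?Y b - ?Y a = (LBINT s. indicat_real ({0<..<b} - {0<..<a}) s * (\<mu> s * y s))" using df[OF i] by simp
      also have "\<dots> \<le> (LBINT s. indicat_real ({0<..<b} - {0<..<a}) s * \<mu> s * ?Y b)"
      proof (rule integral_mono_AE)
        show "integrable lborel (\<lambda>s. indicat_real ({0<..<b} - {0<..<a}) s * (\<mu> s * y s))"
          by (rule integrable_indicat_mult[OF i]) simp
        show "integrable lborel (\<lambda>s. indicat_real ({0<..<b} - {0<..<a}) s * \<mu> s * ?Y b)"
          by (intro integrable_mult_left integrable_indicat_mult \<mu>) simp
        show "AE s in lborel. indicat_real ({0<..<b} - {0<..<a}) s * (\<mu> s * y s) \<le> indicat_real ({0<..<b} - {0<..<a}) s * \<mu> s * ?Y b"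
          using le
        proof eventually_elim
          case (elim s)
          show ?case
          proof (cases "0 < s \<and> s < b")
            case True
            then have "y s \<le> ?Y b" using elim ab mono[of s b] by auto
            then show ?thesis unfolding mult.assoc by (intro mult_left_mono \<mu>(2)) auto
          qed (auto simp: indicator_def)
        qed
      qed
      also have "\<dots> = (prim \<mu> b - prim \<mu> a) * ?Y b" using df[OF \<mu>(1)] by simp
      finally show ?thesis by simp
    qed
    have Y0: "?Y 0 = \<epsilon>" by (simp add: prim_def)
    have Ypos: "0 \<le> ?Y b" if "0 \<le> b" for b using mono[OF that] Y0 \<epsilon> by simp
    have "?Y (real i * (T / real N)) \<le> 2 ^ i * \<epsilon>" if "i \<le> N" for i
      using that
    proof (induction i)
      case 0 then show ?case using Y0 by simp
    next
      case (Suc i)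
      let ?a = "real i * (T / real N)" and ?b = "real (Suc i) * (T / real N)"
      have ab: "0 \<le> ?a" "?a \<le> ?b" using T by (simp, intro mult_right_mono) auto
      have bT: "?b \<le> T"
      proof -
        have "?b \<le> real N * (T / real N)" using Suc.prems T by (intro mult_right_mono) auto
        then show ?thesis using N by simp
      qed
      have "?b = ?a + T / real N" by (simp add: distrib_right add_divide_distrib)
      then have "dist ?b ?a < d" using N T by (simp add: dist_real_def)
      then have "dist (prim \<mu> ?b) (prim \<mu> ?a) < 1/2" using ab bT by (intro d(2)) auto
      then have "prim \<mu> ?b - prim \<mu> ?a \<le> 1/2" unfolding dist_real_def by linarith
      then have "(prim \<mu> ?b - prim \<mu> ?a) * ?Y ?b \<le> 1/2 * ?Y ?b"
        using Ypos[of ?b] ab by (intro mult_right_mono) auto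
      then have "?Y ?b \<le> ?Y ?a + 1/2 * ?Y ?b" using step[OF ab bT] by (meson add_left_mono order_trans)
      moreover have "v \<le> 2 * u" if "v \<le> u + 1/2 * v" for u v :: real using that by simp
      ultimately have "?Y ?b \<le> 2 * ?Y ?a" by blast
      also have "\<dots> \<le> 2 * (2 ^ i * \<epsilon>)" using Suc by simp
      finally show ?case by simp
    qed
    from this[of N] have YT: "?Y T \<le> 2 ^ N * \<epsilon>" using N by simp
    show "AE t in lborel. 0 < t \<and> t < T \<longrightarrow> y t \<le> 2 ^ N * \<epsilon>"
      using le
    proof eventually_elim
      case (elim t) then show ?case using mono[of t T] YT by auto
    qed
  qed simp
qed

text \<open>
  Smooth functions supported in \<open>[a,b]\<close> that increase to the indicator of \<open>(a,b)\<close> as \<open>j\<close> grows: the argument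
  of the outer function is positive exactly on \<open>(a,b)\<close>, and \<open>flat [:1:]\<close> tends to 1 at infinity.
\<close>

definition bump :: "real \<Rightarrow> real \<Rightarrow> nat \<Rightarrow> real \<Rightarrow> real" where
  "bump a b j t = flat [:1:] (real (Suc j) * flat [:1:] (t - a) * flat [:1:] (b - t))"

lemma esmooth_imp_smooth_real:
  assumes "esmooth (g :: real \<Rightarrow> real)"
  shows "smooth_real g"
proof (rule smooth_real_coinduct[of _ "Collect esmooth"])
  fix g :: "real \<Rightarrow> real" assume "g \<in> Collect esmooth"
  then obtain g' where g': "\<And>x. (g has_derivative g' x) (at x)" "\<And>v. esmooth (\<lambda>x. g' x v)"
    using esmooth_has_derivative by blast
  have "(g has_real_derivative g' x 1) (at x)" for x
    using g'(1)[of x] by (metis has_derivative_imp_has_field_derivative has_derivative_linear linear_times mult.commute mult.right_neutral real_scaleR_def linear_cmul)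
  then show "\<exists>g'\<in>Collect esmooth. \<forall>x. (g has_real_derivative g' x) (at x)"
    using g'(2)[of 1] by (intro bexI[of _ "\<lambda>x. g' x 1"]) auto
qed (use assms in simp)

lemma smooth_real_bump: "smooth_real (bump a b j)"
proof (rule esmooth_imp_smooth_real)
  have "esmooth (\<lambda>t::real. t + (- a))" "esmooth (\<lambda>t::real. b + (-1) * t)"
    by (intro esmooth.add esmooth.mult esmooth.const esmooth.linear bounded_linear_ident)+
  then have "esmooth (\<lambda>t. flat [:1:] (real (Suc j) * flat [:1:] (t + - a) * flat [:1:] (b + (-1) * t)))"
    by (intro esmooth.comp[OF smooth_real_flat, of "\<lambda>t. real (Suc j) * flat [:1:] (t + - a) * flat [:1:] (b + (-1) * t)"]
        esmooth.mult esmooth.const) (auto intro: esmooth.comp[OF smooth_real_flat])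
  then show "esmooth (bump a b j)" by (simp add: bump_def[abs_def])
qed

lemma flat_1_simps: "0 \<le> flat [:1:] x" "flat [:1:] x \<le> 1" "flat [:1:] x > 0 \<longleftrightarrow> x > 0"
  by (auto simp: flat_def)

lemma bump_bounds: "0 \<le> bump a b j t" "bump a b j t \<le> 1"
  unfolding bump_def by (rule flat_1_simps)+

lemma bump_outside: "t \<le> a \<or> b \<le> t \<Longrightarrow> bump a b j t = 0"
  by (auto simp: bump_def flat_def)

lemma bump_tendsto: "(\<lambda>j. bump a b j t) \<longlonglongrightarrow> indicat_real {a<..<b} t"
proof (cases "a < t \<and> t < b")
  case True
  define c where "c = flat [:1:] (t - a) * flat [:1:] (b - t)"
  have c: "c > 0" unfolding c_def using True by (intro mult_pos_pos) (auto simp: flat_1_simps)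
  have "(\<lambda>j. exp (- ((1 / real (Suc j)) * (1 / c)))) \<longlonglongrightarrow> exp (- (0 * (1 / c)))"
    by (intro tendsto_intros LIMSEQ_Suc[OF lim_1_over_n])
  moreover have "bump a b j t = exp (- ((1 / real (Suc j)) * (1 / c)))" for j
    using c unfolding bump_def mult.assoc c_def[symmetric] by (simp add: flat_def)
  ultimately show ?thesis using True by simp
next
  case False
  then have "bump a b j t = 0" for j by (intro bump_outside) auto
  with False show ?thesis by simp
qed

lemma bump_continuous: "isCont (bump a b j) t"
  using smooth_real_step[OF smooth_real_bump] DERIV_isCont by blast

lemma borel_measurable_bump[measurable]: "bump a b j \<in> borel_measurable borel"
  by (intro borel_measurable_continuous_onI continuous_at_imp_continuous_on ballI bump_continuous)

text \<open>
  The test function in time: it equals a constant up to time \<open>a\<close>, in particular it does not vanish at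
  \<open>t = 0\<close>, and it decreases to zero between \<open>a\<close> and \<open>b\<close>.
\<close>

lemma bump_primitive:
  assumes "a < b"
  shows "\<exists>\<theta>. smooth_real \<theta> \<and> (\<forall>t. (\<theta> has_real_derivative - bump a b j t) (at t)) \<and> (\<forall>t\<ge>b. \<theta> t = 0) \<and>
           (\<forall>t. \<theta> t = (LBINT s. indicat_real {t<..} s * bump a b j s))"
proof -
  obtain F where F0: "\<And>t. (F has_vector_derivative bump a b j t) (at t)"
    using einterval_antiderivative[of "-\<infinity>" \<infinity> "bump a b j"] bump_continuous by auto
  then have F: "(F has_real_derivative bump a b j t) (at t)" for t
    by (simp add: has_real_derivative_iff_has_vector_derivative)
  define \<theta> where "\<theta> t = F b - F t" for t
  have d: "(\<theta> has_real_derivative - bump a b j t) (at t)" for t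
    unfolding \<theta>_def using DERIV_diff[OF DERIV_const F[of t], of "F b"] by simp
  have neg: "smooth_real (\<lambda>t. - bump a b j t)"
  proof -
    have "esmooth (\<lambda>t::real. (-1) * bump a b j t)"
      by (intro esmooth.mult esmooth.const esmooth.comp[OF smooth_real_bump, of "\<lambda>t. t"] esmooth.linear bounded_linear_ident)
    then show ?thesis using esmooth_imp_smooth_real by simp
  qed
  have val: "\<theta> t = (LBINT s. indicat_real {t<..} s * bump a b j s)" if "t \<le> b" for t
  proof -
    have "(LBINT s. bump a b j s * indicat_real {t..b} s) = F b - F t"
      by (rule integral_FTC_Icc_real[OF that F bump_continuous])
    moreover have "(LBINT s. bump a b j s * indicat_real {t..b} s) = (LBINT s. indicat_real {t<..} s * bump a b j s)"
      by (rule integral_cong_AE) (use AE_lborel_singleton[of t] bump_outside in \<open>auto simp: indicator_def elim!: eventually_mono\<close>)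
    ultimately show ?thesis by (simp add: \<theta>_def)
  qed
  have z: "\<theta> t = 0" if "b \<le> t" for t
  proof -
    have "(LBINT s. bump a b j s * indicat_real {b..t} s) = F t - F b"
      by (rule integral_FTC_Icc_real[OF that F bump_continuous])
    moreover have "(LBINT s. bump a b j s * indicat_real {b..t} s) = (LBINT s::real. 0)"
      by (rule Bochner_Integration.integral_cong) (use bump_outside in \<open>auto simp: indicator_def\<close>)
    ultimately show ?thesis by (simp add: \<theta>_def)
  qed
  have val': "\<theta> t = (LBINT s. indicat_real {t<..} s * bump a b j s)" for t
  proof (cases "t \<le> b")
    case False
    then have "(LBINT s. indicat_real {t<..} s * bump a b j s) = (LBINT s::real. 0)"
      by (intro Bochner_Integration.integral_cong) (use bump_outside in \<open>auto simp: indicator_def\<close>)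
    with z[of t] False show ?thesis by simp
  qed (rule val)
  show ?thesis using smooth_real_antiderivative[OF neg d] d z val' by (intro exI[of _ \<theta>]) auto
qed

text \<open>
  Testing with primitives of \<open>bump a b j\<close> and exchanging the order of integration shows that \<open>prim f - m\<close>
  is orthogonal to every bump, hence has zero integral over every interval \<open>(a,b)\<close>. That the test functions
  need not vanish at \<open>t = 0\<close> fixes the constant of integration. The bound \<open>B\<close> on \<open>\<theta>\<close> and \<open>\<theta>'\<close> is there so
  that the integrability of products with \<open>\<theta>\<close> is at hand where the weak equation is supplied.
\<close>

lemma primitive_of_weak_derivative:
  fixes m f :: "real \<Rightarrow> real"
  assumes m: "integrable lborel m" and f: "integrable lborel f"
    and fsupp: "\<And>s. s \<le> 0 \<or> T \<le> s \<Longrightarrow> f s = 0"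
    and weak: "\<And>\<theta> \<theta>' b B. smooth_real \<theta> \<Longrightarrow> (\<And>t. (\<theta> has_real_derivative \<theta>' t) (at t)) \<Longrightarrow> b < T \<Longrightarrow> (\<And>t. t \<ge> b \<Longrightarrow> \<theta> t = 0) \<Longrightarrow>
        (\<And>t. \<bar>\<theta> t\<bar> \<le> B \<and> \<bar>\<theta>' t\<bar> \<le> B) \<Longrightarrow> (LBINT t. m t * \<theta>' t + f t * \<theta> t) = 0"
  shows "AE t in lborel. 0 < t \<and> t < T \<longrightarrow> m t = prim f t"
proof -
  have [measurable]: "m \<in> borel_measurable borel" "f \<in> borel_measurable borel" using m f by simp_all
  let ?h = "\<lambda>t. indicat_real {0<..<T} t * (prim f t - m t)"
  have ip: "integrable lborel (\<lambda>t. indicat_real {0<..<T} t * prim f t)"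
    using integrable_mult_bounded[OF integrable_indicat_Ioo[of 0 T], of "prim f" "LBINT s. \<bar>f s\<bar>"] prim_bound[OF f]
    by (simp add: mult.commute)
  have ih: "integrable lborel ?h"
    using ip integrable_indicat_mult[OF m, of "{0<..<T}"] by (simp add: right_diff_distrib)
  have "AE t in lborel. ?h t = 0"
  proof (rule AE_zero_of_interval_integrals[OF ih])
    fix a b :: real assume ab: "0 < a" "a < b" "b < T"
    have z: "(LBINT t. bump a b j t * ?h t) = 0" for j
    proof -
      obtain \<theta> where \<theta>: "smooth_real \<theta>" "\<And>t. (\<theta> has_real_derivative - bump a b j t) (at t)" "\<And>t. t \<ge> b \<Longrightarrow> \<theta> t = 0"
        "\<And>t. \<theta> t = (LBINT s. indicat_real {t<..} s * bump a b j s)"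
        using bump_primitive[OF ab(2), of j] by blast
      have ib: "integrable lborel (bump a b j)"
      proof (rule Bochner_Integration.integrable_bound[OF integrable_indicat_Ioo[of a b]])
        have "norm (bump a b j s) \<le> norm (indicat_real {a<..<b} s)" for s
          using bump_bounds[of a b j s] bump_outside[of s a b j] by (cases "a < s \<and> s < b") (auto simp: not_less)
        then show "AE s in lborel. norm (bump a b j s) \<le> norm (indicat_real {a<..<b} s)" by simp
      qed measurable
      have \<theta>b: "\<bar>\<theta> t\<bar> \<le> b" for t
      proof -
        have "0 \<le> \<theta> t" unfolding \<theta>(4) by (intro integral_nonneg_AE AE_I2) (simp add: bump_bounds)
        moreover have "\<theta> t \<le> (LBINT s. indicat_real {a<..<b} s)" unfolding \<theta>(4)
        proof (rule integral_mono'[OF integrable_indicat_Ioo])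
          fix s show "indicat_real {t<..} s * bump a b j s \<le> indicat_real {a<..<b} s"
            using bump_bounds[of a b j s] bump_outside[of s a b j]
            by (cases "a < s \<and> s < b") (auto simp: not_less indicator_def)
        qed (simp add: bump_bounds)
        ultimately show ?thesis using ab by simp
      qed
      have "(LBINT t. m t * (- bump a b j t) + f t * \<theta> t) = 0"
      proof (rule weak[OF \<theta>(1,2) ab(3) \<theta>(3)])
        show "\<bar>\<theta> t\<bar> \<le> b + 1 \<and> \<bar>- bump a b j t\<bar> \<le> b + 1" for t
          using \<theta>b[of t] bump_bounds[of a b j t] ab by simp
      qed
      moreover have im: "integrable lborel (\<lambda>t. m t * (- bump a b j t))"
        using integrable_mult_bounded[OF m, of "\<lambda>t. - bump a b j t" 1] bump_bounds by (simp add: mult.commute)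
      moreover have if\<theta>: "integrable lborel (\<lambda>t. f t * \<theta> t)"
      proof -
        have "continuous_on UNIV \<theta>" using \<theta>(2) by (intro continuous_at_imp_continuous_on) (auto intro: DERIV_isCont)
        then have "\<theta> \<in> borel_measurable borel" by (rule borel_measurable_continuous_onI)
        then show ?thesis using integrable_mult_bounded[OF f, of \<theta> b] \<theta>b by (simp add: mult.commute)
      qed
      ultimately have e: "(LBINT t. f t * \<theta> t) = (LBINT t. m t * bump a b j t)" by simp
      have "(LBINT t. f t * \<theta> t) = (LBINT t. LBINT s. (if t < s then f t * bump a b j s else 0))"
      proof (rule Bochner_Integration.integral_cong[OF refl])
        fix t
        have "f t * \<theta> t = (LBINT s. f t * (indicat_real {t<..} s * bump a b j s))" by (simp add: \<theta>(4))
        also have "\<dots> = (LBINT s. (if t < s then f t * bump a b j s else 0))"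
          by (rule Bochner_Integration.integral_cong) (auto simp: indicator_def)
        finally show "f t * \<theta> t = \<dots>" .
      qed
      also have "\<dots> = (LBINT s. LBINT t. (if t < s then f t * bump a b j s else 0))"
      proof (rule lborel_pair.Fubini_integral[symmetric])
        have "integrable lborel (\<lambda>p. (if fst p < snd p then 1 else 0) *\<^sub>R (f (fst p) * bump a b j (snd p)))"
          by (rule integrable_mult_bounded[OF integrable_lborel_tensor[OF f ib], of _ 1]) auto
        then show "integrable (lborel \<Otimes>\<^sub>M lborel) (\<lambda>(t, s). if t < s then f t * bump a b j s else 0)"
          unfolding lborel_prod by (rule back_subst[of "integrable lborel"]) (auto simp: split_beta')
      qed
      also have "\<dots> = (LBINT s. bump a b j s * prim f s)"
      proof (rule Bochner_Integration.integral_cong[OF refl])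
        fix s
        have "(LBINT t. (if t < s then f t * bump a b j s else 0)) = (LBINT t. bump a b j s * (indicat_real {0<..<s} t * f t))"
          by (rule Bochner_Integration.integral_cong) (use fsupp in \<open>auto simp: indicator_def not_less\<close>)
        then show "(LBINT t. (if t < s then f t * bump a b j s else 0)) = bump a b j s * prim f s" by (simp add: prim_def)
      qed
      finally have e2: "(LBINT s. bump a b j s * prim f s) = (LBINT t. bump a b j t * m t)"
        using e by (simp add: mult.commute)
      have "(LBINT t. bump a b j t * ?h t) = (LBINT t. bump a b j t * prim f t - bump a b j t * m t)"
        by (rule Bochner_Integration.integral_cong) (use bump_outside ab in \<open>auto simp: indicator_def right_diff_distrib not_less\<close>)
      also have "\<dots> = 0"
      proof (subst Bochner_Integration.integral_diff)
        show "integrable lborel (\<lambda>t. bump a b j t * prim f t)"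
          using integrable_mult_bounded[OF ib, of "prim f" "LBINT s. \<bar>f s\<bar>"] prim_bound[OF f] by (simp add: mult.commute)
        show "integrable lborel (\<lambda>t. bump a b j t * m t)" using im by (simp add: mult.commute)
      qed (simp add: e2)
      finally show ?thesis .
    qed
    have "(\<lambda>j. LBINT t. bump a b j t * ?h t) \<longlonglongrightarrow> (LBINT t. indicat_real {a<..<b} t * ?h t)"
    proof (rule integral_dominated_convergence[where w="\<lambda>t. \<bar>?h t\<bar>"])
      show "AE t in lborel. (\<lambda>j. bump a b j t * ?h t) \<longlonglongrightarrow> indicat_real {a<..<b} t * ?h t"
        by (intro AE_I2 tendsto_mult bump_tendsto tendsto_const)
      show "AE t in lborel. norm (bump a b j t * ?h t) \<le> \<bar>?h t\<bar>" for j
        using bump_bounds[of a b j] by (intro AE_I2) (simp add: abs_mult mult_left_le_one_le)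
      show "integrable lborel (\<lambda>t. \<bar>?h t\<bar>)" using ih by (rule integrable_abs)
    qed measurable
    then show "(LBINT t. indicat_real {a<..<b} t * ?h t) = 0" unfolding z by (simp add: LIMSEQ_const_iff)
  qed (auto simp: indicator_def)
  then show ?thesis by eventually_elim (auto simp: indicator_def)
qed

section \<open>Energy estimate for the linear difference equation\<close>

lemma borel_measurable_section[measurable (raw)]:
  fixes f :: "'a::euclidean_space \<times> 'b::euclidean_space \<Rightarrow> 'c::euclidean_space"
  assumes "f \<in> borel_measurable borel"
  shows "(\<lambda>x. f (t, x)) \<in> borel_measurable borel"
  using measurable_compose[OF _ assms, of "\<lambda>x. (t, x)" borel] by measurable

lemma borel_measurable_ft_param:
  fixes h :: "real \<times> 'a::euclidean_space \<Rightarrow> real"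
  assumes [measurable]: "h \<in> borel_measurable borel"
  shows "(\<lambda>p. ft (\<lambda>x. h (fst p, x)) (snd p)) \<in> borel_measurable (borel :: (real \<times> 'a) measure)"
proof -
  have "(\<lambda>p::real \<times> 'a. LBINT x. h (fst p, x) *\<^sub>R cis (snd p \<bullet> x)) \<in> borel_measurable lborel"
    by (rule lborel.borel_measurable_lebesgue_integral) (simp add: lborel_prod split_beta', measurable)
  then show ?thesis by (simp add: ft_def)
qed

lemma borel_measurable_integral_param:
  fixes h :: "real \<times> 'a::euclidean_space \<Rightarrow> 'b::euclidean_space"
  assumes [measurable]: "h \<in> borel_measurable borel"
  shows "(\<lambda>t. LBINT x. h (t, x)) \<in> borel_measurable borel"
proof -
  have "(\<lambda>t. LBINT x. h (t, x)) \<in> borel_measurable lborel"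
    by (rule lborel.borel_measurable_lebesgue_integral) (simp add: lborel_prod split_beta')
  then show ?thesis by simp
qed

lemma borel_measurable_esmooth: "esmooth f \<Longrightarrow> f \<in> borel_measurable borel"
  by (intro borel_measurable_continuous_onI esmooth_continuous)

lemma integrable_cutoff:
  fixes g h :: "'a::euclidean_space \<Rightarrow> real"
  assumes [measurable]: "g \<in> borel_measurable borel" "h \<in> borel_measurable borel"
    and h: "integrable lborel (\<lambda>x. (h x)\<^sup>2)" and g: "\<And>x. \<bar>g x\<bar> \<le> B" "\<And>x. norm x > R \<Longrightarrow> g x = 0"
  shows "integrable lborel (\<lambda>x. g x * h x)"
proof (rule integrable_mult_L2[OF _ _ _ h])
  show "integrable lborel (\<lambda>x. (g x)\<^sup>2)"
  proof (rule Bochner_Integration.integrable_bound)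
    show "integrable lborel (\<lambda>x::'a. B\<^sup>2 * indicat_real (cball 0 R) x)"
      using emeasure_lborel_cball_finite[of "0::'a" R] by (simp add: integrable_indicator_iff)
    show "AE x in lborel. norm ((g x)\<^sup>2) \<le> norm (B\<^sup>2 * indicat_real (cball 0 R) x)"
    proof (intro AE_I2)
      fix x
      have "(g x)\<^sup>2 \<le> B\<^sup>2" using power_mono[OF g(1)[of x], of 2] by simp
      then show "norm ((g x)\<^sup>2) \<le> norm (B\<^sup>2 * indicat_real (cball 0 R) x)"
        using g(2)[of x] by (auto simp: indicator_def)
    qed
  qed measurable
qed measurable

lemma abs_sq_le: "\<bar>a\<bar> \<le> c \<Longrightarrow> a\<^sup>2 \<le> c\<^sup>2" for a c :: real
  using power_mono[of "\<bar>a\<bar>" c 2] by simp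

lemma sq_sum_le: "(a + b)\<^sup>2 \<le> 2 * a\<^sup>2 + 2 * b\<^sup>2" for a b :: real
  using sum_squares_bound[of a b] by (simp add: power2_sum)

lemma young_weighted:
  fixes a b l :: real
  assumes "l > 0"
  shows "2 * (a * b) \<le> l * a\<^sup>2 + b\<^sup>2 / l"
proof -
  have "0 \<le> (l * a - b)\<^sup>2" by simp
  also have "\<dots> = l * a\<^sup>2 * l + b\<^sup>2 - 2 * (a * b) * l" by (simp add: power2_eq_square algebra_simps)
  also have "l * a\<^sup>2 * l + b\<^sup>2 = (l * a\<^sup>2 + b\<^sup>2 / l) * l" using assms by (simp add: distrib_right)
  finally have "2 * (a * b) * l \<le> (l * a\<^sup>2 + b\<^sup>2 / l) * l" by simp
  then show ?thesis using assms by (rule mult_right_le_imp_le)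
qed

text \<open>
  The energy balance at one frequency, with \<open>H = 1 + |\<xi>|\<^sup>2\<close>, \<open>m\<close> and \<open>w\<close> the transforms of the truncated \<open>z\<close>
  and \<open>w\<close>, and \<open>Q\<close> collecting all first-order terms. As \<open>(H - 1)/H = 1 - 1/H\<close>, the Laplacian produces the
  full pairing \<open>m w\<close> plus a remainder weighted by \<open>1/H\<close>; this remainder and \<open>Q\<close> are split by Young's
  inequality, \<open>k\<close> and \<open>l\<close> being free to be chosen later.
\<close>

lemma spectral_energy_bound:
  fixes m w Q :: complex and H q k l :: real
  assumes H: "H \<ge> 1" and Q: "(norm Q)\<^sup>2 \<le> H * q" and k: "k > 0" and l: "l > 0"
  shows "2 * Re (cnj m * (Q - (H - 1) *\<^sub>R w)) / H \<le>
           - 2 * Re (m * cnj w) + (1 / k + l) * ((norm m)\<^sup>2 / H) + k * (norm w)\<^sup>2 + q / l"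
    and "2 * \<bar>Re (cnj m * (Q - (H - 1) *\<^sub>R w)) / H\<bar> \<le> (1 + l) * (norm m)\<^sup>2 + (norm w)\<^sup>2 + q / l"
proof -
  have H0: "H > 0" using H by simp
  define x where "x = Re (cnj m * Q)"
  define r where "r = Re (m * cnj w)"
  have r': "Re (cnj m * w) = r" by (simp add: r_def algebra_simps)
  have "cnj m * (Q - (H - 1) *\<^sub>R w) = cnj m * Q - (H - 1) *\<^sub>R (cnj m * w)"
    by (simp only: right_diff_distrib mult_scaleR_right)
  then have "Re (cnj m * (Q - (H - 1) *\<^sub>R w)) = x - (H - 1) * r"
    using r' by (simp only: x_def minus_complex.sel scaleR_complex.sel)
  then have split: "Re (cnj m * (Q - (H - 1) *\<^sub>R w)) / H = x / H - r + r / H"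
    using H0 by (simp only: diff_divide_distrib left_diff_distrib) simp
  have rb: "\<bar>r\<bar> \<le> norm m * norm w"
    using abs_Re_le_cmod[of "m * cnj w"] by (simp add: r_def norm_mult)
  have Qb: "\<bar>x\<bar> \<le> norm m * norm Q"
    using abs_Re_le_cmod[of "cnj m * Q"] unfolding x_def by (simp add: norm_mult)
  have Qy: "2 * (norm m * norm Q) / H \<le> l * ((norm m)\<^sup>2 / H) + q / l"
  proof -
    have "2 * (norm m * norm Q) / H \<le> (l * (norm m)\<^sup>2 + (norm Q)\<^sup>2 / l) / H"
      using young_weighted[OF l] H0 by (intro divide_right_mono) auto
    also have "\<dots> \<le> (l * (norm m)\<^sup>2 + H * q / l) / H"
      using Q l H0 by (intro divide_right_mono add_left_mono) auto
    also have "\<dots> = l * ((norm m)\<^sup>2 / H) + q / l" using H0 by (simp add: add_divide_distrib)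
    finally show ?thesis .
  qed
  have w2: "(norm w)\<^sup>2 / H \<le> (norm w)\<^sup>2" "(norm m)\<^sup>2 / H \<le> (norm m)\<^sup>2"
    using H H0 by (simp_all add: divide_le_eq mult_le_cancel_left1)
  have ry: "2 * (r / H) \<le> (1 / k) * ((norm m)\<^sup>2 / H) + k * (norm w)\<^sup>2"
  proof -
    have "2 * (r / H) \<le> 2 * (norm m * norm w) / H" using rb H0 by (auto simp: divide_right_mono)
    also have "\<dots> \<le> ((1/k) * (norm m)\<^sup>2 + (norm w)\<^sup>2 / (1/k)) / H"
      using young_weighted[of "1/k" "norm m" "norm w"] k H0 by (intro divide_right_mono) auto
    also have "\<dots> = (1 / k) * ((norm m)\<^sup>2 / H) + k * ((norm w)\<^sup>2 / H)" by (simp add: add_divide_distrib)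
    also have "\<dots> \<le> (1 / k) * ((norm m)\<^sup>2 / H) + k * (norm w)\<^sup>2"
      using w2(1) k by (intro add_left_mono mult_left_mono) auto
    finally show ?thesis .
  qed
  have Q1: "2 * (\<bar>x\<bar> / H) \<le> 2 * (norm m * norm Q) / H" using Qb H0 by (simp add: divide_right_mono)
  have "2 * (x / H) \<le> 2 * (\<bar>x\<bar> / H)"
    using H0 by (intro mult_left_mono divide_right_mono abs_ge_self) auto
  then have "2 * Re (cnj m * (Q - (H - 1) *\<^sub>R w)) / H \<le>
      (l * ((norm m)\<^sup>2 / H) + q / l) - 2 * r + ((1 / k) * ((norm m)\<^sup>2 / H) + k * (norm w)\<^sup>2)"
    proof -
    assume "2 * (x / H) \<le> 2 * (\<bar>x\<bar> / H)"
    then have 1: "2 * (x / H) \<le> l * ((norm m)\<^sup>2 / H) + q / l" using Q1 Qy by (meson order_trans)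
    have "2 * (x / H - r + r / H) = 2 * (x / H) - 2 * r + 2 * (r / H)" by (simp add: distrib_left right_diff_distrib)
    also have "\<dots> \<le> (l * ((norm m)\<^sup>2 / H) + q / l) - 2 * r + ((1 / k) * ((norm m)\<^sup>2 / H) + k * (norm w)\<^sup>2)"
      by (intro add_mono diff_mono 1 ry order_refl)
    finally show ?thesis unfolding times_divide_eq_right[symmetric] split .
  qed
  then show "2 * Re (cnj m * (Q - (H - 1) *\<^sub>R w)) / H \<le>
           - 2 * Re (m * cnj w) + (1 / k + l) * ((norm m)\<^sup>2 / H) + k * (norm w)\<^sup>2 + q / l"
  proof -
    define a where "a = (norm m)\<^sup>2 / H"
    have e: "(l * a + q / l) - 2 * r + ((1 / k) * a + k * (norm w)\<^sup>2) = - 2 * r + (1 / k + l) * a + k * (norm w)\<^sup>2 + q / l"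
      by (simp add: distrib_right)
    assume "2 * Re (cnj m * (Q - (H - 1) *\<^sub>R w)) / H \<le>
      (l * ((norm m)\<^sup>2 / H) + q / l) - 2 * r + ((1 / k) * ((norm m)\<^sup>2 / H) + k * (norm w)\<^sup>2)"
    then show ?thesis unfolding r_def[symmetric] a_def[symmetric] e .
  qed
  have h1: "\<bar>- r + r / H\<bar> \<le> \<bar>r\<bar>"
  proof -
    have "- r + r / H = - (r * (1 - 1 / H))" by (simp add: algebra_simps)
    moreover have "\<bar>1 - 1 / H\<bar> \<le> 1" using H H0 by (simp add: abs_le_iff)
    ultimately show ?thesis by (simp add: abs_mult mult_left_le)
  qed
  have f1: "\<bar>Re (cnj m * (Q - (H - 1) *\<^sub>R w)) / H\<bar> \<le> \<bar>x\<bar> / H + \<bar>r\<bar>"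
    unfolding split using abs_triangle_ineq[of "x / H" "- r + r / H"] h1 H0 by (simp add: abs_divide)
  have f2: "2 * \<bar>r\<bar> \<le> (norm m)\<^sup>2 + (norm w)\<^sup>2"
    using rb sum_squares_bound[of "norm m" "norm w"] by (simp add: mult.assoc)
  have f3: "l * ((norm m)\<^sup>2 / H) \<le> l * (norm m)\<^sup>2" using w2(2) l by (intro mult_left_mono) auto
  have gen: "2 * e \<le> u + v + s" if "e \<le> a + b" "2 * b \<le> s" "t \<le> u" "2 * a \<le> y" "y \<le> t + v" for e a b s t u v y :: real
    using that by linarith
  have "2 * \<bar>Re (cnj m * (Q - (H - 1) *\<^sub>R w)) / H\<bar> \<le> l * (norm m)\<^sup>2 + q / l + ((norm m)\<^sup>2 + (norm w)\<^sup>2)"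
    by (rule gen[OF f1 f2 f3 Q1 Qy])
  then show "2 * \<bar>Re (cnj m * (Q - (H - 1) *\<^sub>R w)) / H\<bar> \<le> (1 + l) * (norm m)\<^sup>2 + (norm w)\<^sup>2 + q / l"
  proof -
    have e: "l * (norm m)\<^sup>2 + q / l + ((norm m)\<^sup>2 + (norm w)\<^sup>2) = (1 + l) * (norm m)\<^sup>2 + (norm w)\<^sup>2 + q / l"
      by (simp add: distrib_right)
    assume "2 * \<bar>Re (cnj m * (Q - (H - 1) *\<^sub>R w)) / H\<bar> \<le> l * (norm m)\<^sup>2 + q / l + ((norm m)\<^sup>2 + (norm w)\<^sup>2)"
    then show ?thesis unfolding e .
  qed
qed

text \<open>
  The equation \<open>\<partial>\<^sub>t Z = \<Delta>W - div F\<close> with zero initial value, in weak form, and what the energy estimate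
  needs to know about it. In the application \<open>Z\<close>, \<open>W\<close> and \<open>F\<close>, extended by
  zero to times outside \<open>(0,T)\<close>, are the differences of \<open>u\<close>, \<open>\<beta>(u)\<close> and of the flux. The function \<open>G\<close> bounds the
  flux at time \<open>t\<close> relative to \<open>Z(t)\<close> and is merely integrable.
\<close>

locale weak_difference =
  fixes Z W :: "real \<times> (real^'n) \<Rightarrow> real" and F :: "real \<times> (real^'n) \<Rightarrow> real^'n"
    and G :: "real \<Rightarrow> real" and T M \<alpha> L :: real
  assumes T: "T > 0" and \<alpha>: "\<alpha> > 0" and L: "L \<ge> 0"
    and measZ[measurable]: "Z \<in> borel_measurable borel"
    and measW[measurable]: "W \<in> borel_measurable borel"
    and measF[measurable]: "F \<in> borel_measurable borel"
    and Zb: "\<And>z. \<bar>Z z\<bar> \<le> M" and Zi: "integrable lborel Z"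
    and Wb: "\<And>z. \<bar>W z\<bar> \<le> L * \<bar>Z z\<bar>"
    and WZ: "\<And>z. \<alpha> * (Z z)\<^sup>2 \<le> Z z * W z"
    and suppZ: "\<And>t x. t \<le> 0 \<or> T \<le> t \<Longrightarrow> Z (t, x) = 0"
    and suppF: "\<And>t x. t \<le> 0 \<or> T \<le> t \<Longrightarrow> F (t, x) = 0"
    and Gi: "integrable lborel G" and G0: "\<And>t. 0 \<le> G t"
    and FL2: "AE t in lborel. integrable lborel (\<lambda>x. (norm (F (t, x)))\<^sup>2) \<and>
               (LBINT x. (norm (F (t, x)))\<^sup>2) \<le> G t * (LBINT x. (Z (t, x))\<^sup>2)"
    and F_cutoff_integrable: "\<And>g B R i. g \<in> borel_measurable borel \<Longrightarrow> (\<And>x. \<bar>g x\<bar> \<le> B) \<Longrightarrow>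
        (\<And>x. norm x > R \<Longrightarrow> g x = 0) \<Longrightarrow> integrable lborel (\<lambda>z. g (snd z) * F z $ i)"
    and weak: "\<And>\<theta> \<theta>' b B \<psi> R. smooth_real \<theta> \<Longrightarrow> (\<And>t. (\<theta> has_real_derivative \<theta>' t) (at t)) \<Longrightarrow> b < T \<Longrightarrow>
        (\<And>t. t \<ge> b \<Longrightarrow> \<theta> t = 0) \<Longrightarrow> (\<And>t. \<bar>\<theta> t\<bar> \<le> B \<and> \<bar>\<theta>' t\<bar> \<le> B) \<Longrightarrow>
        esmooth \<psi> \<Longrightarrow> (\<And>x. norm x > R \<Longrightarrow> \<psi> x = 0) \<Longrightarrow>
        (LBINT z. Z z * (\<theta>' (fst z) * \<psi> (snd z)) +
           \<theta> (fst z) * (W z * laplacian \<psi> (snd z) + F z \<bullet> grad \<psi> (snd z))) = 0"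
begin

lemma suppW: "t \<le> 0 \<or> T \<le> t \<Longrightarrow> W (t, x) = 0"
  using Wb[of "(t, x)"] suppZ[of t x] by simp

lemma M0: "0 \<le> M" using Zb[of "(0, 0)"] by linarith

definition z2 :: "real \<Rightarrow> real" where "z2 t = (LBINT x. (Z (t, x))\<^sup>2)"

lemma Z2i: "integrable lborel (\<lambda>z. (Z z)\<^sup>2)"
  using integrable_mult_bounded[OF Zi, of Z M] Zb by (simp add: power2_eq_square)

lemma z2_nonneg: "0 \<le> z2 t" by (simp add: z2_def)

lemma z2i: "integrable lborel z2"
  using lborel_pair.integrable_fst'[of "\<lambda>z. (Z z)\<^sup>2"] Z2i by (simp add: lborel_prod z2_def[abs_def])

lemma measz2[measurable]: "z2 \<in> borel_measurable borel"
  using z2i by simp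

lemma measG[measurable]: "G \<in> borel_measurable borel" using Gi by simp

text \<open>
  Times at which the sections of \<open>Z\<close> and \<open>F\<close> have the integrability that holds almost everywhere.
\<close>

definition good :: "real \<Rightarrow> bool" where
  "good t \<longleftrightarrow> integrable lborel (\<lambda>x. Z (t, x)) \<and> integrable lborel (\<lambda>x. (norm (F (t, x)))\<^sup>2) \<and>
     (LBINT x. (norm (F (t, x)))\<^sup>2) \<le> G t * z2 t"

lemma AE_good: "AE t in lborel. good t"
  using FL2 lborel_pair.AE_integrable_fst'[of Z] Zi unfolding lborel_prod good_def z2_def
  by auto

lemma good_Z2: "good t \<Longrightarrow> integrable lborel (\<lambda>x. (Z (t, x))\<^sup>2)"
  using integrable_mult_bounded[of lborel "\<lambda>x. Z (t, x)" "\<lambda>x. Z (t, x)" M] Zb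
  by (simp add: power2_eq_square good_def)

lemma good_W: "good t \<Longrightarrow> integrable lborel (\<lambda>x. W (t, x))"
  by (rule Bochner_Integration.integrable_bound[of _ "\<lambda>x. L * Z (t, x)"])
     (auto simp: good_def abs_mult intro!: Wb order_trans[OF Wb] mult_right_mono)

lemma W2_le: "(W z)\<^sup>2 \<le> L\<^sup>2 * (Z z)\<^sup>2"
  using power_mono[OF Wb[of z], of 2] by (simp add: power_mult_distrib)

lemma Fi2_le: "(F z $ i)\<^sup>2 \<le> (norm (F z))\<^sup>2"
  using power_mono[OF component_le_norm_cart[of "F z" i], of 2] by simp

lemma measFi[measurable]: "(\<lambda>z. F z $ i) \<in> borel_measurable borel"
  using measF by (rule measurable_compose) (auto intro!: borel_measurable_continuous_onI continuous_intros)

lemma good_F2: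
  assumes "good t"
  shows "integrable lborel (\<lambda>x. (F (t, x) $ i)\<^sup>2)"
proof (rule Bochner_Integration.integrable_bound)
  show "integrable lborel (\<lambda>x. (norm (F (t, x)))\<^sup>2)" using assms by (simp add: good_def)
  show "(\<lambda>x. (F (t, x) $ i)\<^sup>2) \<in> borel_measurable lborel"
    using borel_measurable_section[OF measFi[of i], of t] by simp
qed (simp add: Fi2_le)

lemma Wi: "integrable lborel W"
  by (rule Bochner_Integration.integrable_bound[of _ "\<lambda>z. L * Z z"])
     (use Zi in \<open>auto simp: abs_mult intro!: order_trans[OF Wb] mult_right_mono\<close>)

text \<open>
  Its integral in space is the time derivative of the moment \<open>\<integral> Z(t) \<psi>\<close>.
\<close>

definition rate :: "(real^'n \<Rightarrow> real) \<Rightarrow> real \<times> (real^'n) \<Rightarrow> real" where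
  "rate \<psi> z = W z * laplacian \<psi> (snd z) + F z \<bullet> grad \<psi> (snd z)"

lemma rate_measurable[measurable]: "esmooth \<psi> \<Longrightarrow> rate \<psi> \<in> borel_measurable borel"
proof -
  assume \<psi>: "esmooth \<psi>"
  note [measurable] = borel_measurable_esmooth[OF esmooth_laplacian[OF \<psi>]] borel_measurable_esmooth[OF esmooth_pd[OF \<psi>]]
  show ?thesis unfolding rate_def[abs_def] inner_grad by measurable
qed

lemma rate_integrable:
  assumes \<psi>: "esmooth \<psi>" "\<And>x. norm x > R \<Longrightarrow> \<psi> x = 0"
  shows "integrable lborel (rate \<psi>)"
proof -
  note [measurable] = borel_measurable_esmooth[OF esmooth_laplacian[OF \<psi>(1)]] borel_measurable_esmooth[OF esmooth_pd[OF \<psi>(1)]]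
  have o1: "norm x > R \<Longrightarrow> pd i \<psi> x = 0" for x i by (rule pd_outside[OF \<psi>(2)])
  have o2: "norm x > R \<Longrightarrow> laplacian \<psi> x = 0" for x
    unfolding laplacian_esmooth[OF \<psi>(1)] by (intro sum.neutral ballI pd_outside[OF o1])
  obtain B where B: "\<And>x. \<bar>laplacian \<psi> x\<bar> \<le> B" using esmooth_bounded[OF esmooth_laplacian[OF \<psi>(1)] o2] by blast
  have "integrable lborel (\<lambda>z. laplacian \<psi> (snd z) *\<^sub>R W z)"
    by (rule integrable_mult_bounded[OF Wi _ B]) measurable
  moreover have "integrable lborel (\<lambda>z. pd i \<psi> (snd z) * F z $ i)" for i
  proof -
    obtain C where "\<And>x. \<bar>pd i \<psi> x\<bar> \<le> C" using esmooth_bounded[OF esmooth_pd[OF \<psi>(1)] o1] by blast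
    then show ?thesis by (intro F_cutoff_integrable[where g="pd i \<psi>" and B=C and R=R] o1) measurable
  qed
  ultimately show ?thesis unfolding rate_def[abs_def] inner_grad
    by (intro Bochner_Integration.integrable_add Bochner_Integration.integrable_sum) (simp_all add: mult.commute)
qed

text \<open>
  Fubini turns the weak equation, tested with \<open>\<theta>(t) \<psi>(x)\<close>, into a weak equation in time alone.
\<close>

lemma moment_primitive:
  assumes \<psi>: "esmooth \<psi>" "\<And>x. norm x > R \<Longrightarrow> \<psi> x = 0"
  shows "integrable lborel (\<lambda>t. LBINT x. Z (t, x) * \<psi> x)"
    and "integrable lborel (\<lambda>t. LBINT x. rate \<psi> (t, x))"
    and "AE t in lborel. 0 < t \<and> t < T \<longrightarrow>
       (LBINT x. Z (t, x) * \<psi> x) = prim (\<lambda>s. LBINT x. rate \<psi> (s, x)) t"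
proof -
  note [measurable] = borel_measurable_esmooth[OF \<psi>(1)]
  obtain B where B: "\<And>x. \<bar>\<psi> x\<bar> \<le> B" using esmooth_bounded[OF \<psi>] by blast
  have iZ: "integrable lborel (\<lambda>z. \<psi> (snd z) *\<^sub>R Z z)" by (rule integrable_mult_bounded[OF Zi _ B]) measurable
  have iR: "integrable lborel (rate \<psi>)" by (rule rate_integrable[OF \<psi>])
  show i1: "integrable lborel (\<lambda>t. LBINT x. Z (t, x) * \<psi> x)"
    using lborel_pair.integrable_fst'[of "\<lambda>z. \<psi> (snd z) *\<^sub>R Z z"] iZ by (simp add: lborel_prod mult.commute)
  show i2: "integrable lborel (\<lambda>t. LBINT x. rate \<psi> (t, x))"
    using lborel_pair.integrable_fst'[of "rate \<psi>"] iR by (simp add: lborel_prod)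
  show "AE t in lborel. 0 < t \<and> t < T \<longrightarrow>
       (LBINT x. Z (t, x) * \<psi> x) = prim (\<lambda>s. LBINT x. rate \<psi> (s, x)) t"
  proof (rule primitive_of_weak_derivative[OF i1 i2])
    show "(LBINT x. rate \<psi> (s, x)) = 0" if "s \<le> 0 \<or> T \<le> s" for s
      using suppW[OF that] suppF[OF that] by (simp add: rate_def)
    fix \<theta> \<theta>' :: "real \<Rightarrow> real" and b C :: real
    assume \<theta>: "smooth_real \<theta>" "\<And>t. (\<theta> has_real_derivative \<theta>' t) (at t)" "b < T" "\<And>t. b \<le> t \<Longrightarrow> \<theta> t = 0"
      "\<And>t. \<bar>\<theta> t\<bar> \<le> C \<and> \<bar>\<theta>' t\<bar> \<le> C"
    note [measurable] = smooth_real_measurable[OF \<theta>(1,2)]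
    have j1: "integrable lborel (\<lambda>z. Z z * (\<theta>' (fst z) * \<psi> (snd z)))"
    proof -
      have "integrable lborel (\<lambda>z. \<theta>' (fst z) *\<^sub>R (\<psi> (snd z) *\<^sub>R Z z))"
        by (rule integrable_mult_bounded[OF iZ]) (use \<theta>(5) in auto)
      then show ?thesis by (simp add: mult_ac)
    qed
    have j2: "integrable lborel (\<lambda>z. \<theta> (fst z) * rate \<psi> z)"
    proof -
      have "integrable lborel (\<lambda>z. \<theta> (fst z) *\<^sub>R rate \<psi> z)"
        by (rule integrable_mult_bounded[OF iR]) (use \<theta>(5) in auto)
      then show ?thesis by simp
    qed
    have "0 = (LBINT z. Z z * (\<theta>' (fst z) * \<psi> (snd z)) + \<theta> (fst z) * rate \<psi> z)"
      using weak[OF \<theta> \<psi>] by (simp add: rate_def)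
    also have "\<dots> = (LBINT z. Z z * (\<theta>' (fst z) * \<psi> (snd z))) + (LBINT z. \<theta> (fst z) * rate \<psi> z)"
      by (rule Bochner_Integration.integral_add[OF j1 j2])
    also have "(LBINT z. Z z * (\<theta>' (fst z) * \<psi> (snd z))) = (LBINT t. LBINT x. Z (t, x) * (\<theta>' t * \<psi> x))"
      using lborel_pair.integral_fst'[of "\<lambda>z. Z z * (\<theta>' (fst z) * \<psi> (snd z))"] j1 by (simp add: lborel_prod)
    also have "\<dots> = (LBINT t. (LBINT x. Z (t, x) * \<psi> x) * \<theta>' t)"
      by (subst integral_mult_left_zero[symmetric]) (simp add: mult_ac)
    also have "(LBINT z. \<theta> (fst z) * rate \<psi> z) = (LBINT t. LBINT x. \<theta> t * rate \<psi> (t, x))"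
      using lborel_pair.integral_fst'[of "\<lambda>z. \<theta> (fst z) * rate \<psi> z"] j2 by (simp add: lborel_prod)
    also have "\<dots> = (LBINT t. (LBINT x. rate \<psi> (t, x)) * \<theta> t)" by (simp add: mult.commute)
    finally have e: "0 = (LBINT t. (LBINT x. Z (t, x) * \<psi> x) * \<theta>' t) + (LBINT t. (LBINT x. rate \<psi> (t, x)) * \<theta> t)" .
    have k1: "integrable lborel (\<lambda>t. (LBINT x. Z (t, x) * \<psi> x) * \<theta>' t)"
      using integrable_mult_bounded[OF i1, of \<theta>' C] \<theta>(5) by (simp add: mult.commute)
    have k2: "integrable lborel (\<lambda>t. (LBINT x. rate \<psi> (t, x)) * \<theta> t)"
      using integrable_mult_bounded[OF i2, of \<theta> C] \<theta>(5) by (simp add: mult.commute)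
    show "(LBINT t. (LBINT x. Z (t, x) * \<psi> x) * \<theta>' t + (LBINT x. rate \<psi> (t, x)) * \<theta> t) = 0"
      using e Bochner_Integration.integral_add[OF k1 k2] by simp
  qed
qed

section \<open>The truncated equation on the Fourier side\<close>

text \<open>
  Multiplying the equation by the cutoff \<open>\<chi>\<close> gives
  \<open>\<partial>\<^sub>t(\<chi> Z) = \<Delta>(\<chi> W) - div(2 W \<nabla>\<chi> + \<chi> F) + (W \<Delta>\<chi> + F \<cdot> \<nabla>\<chi>)\<close>;
  \<open>flux R\<close> and \<open>src R\<close> are the vector field under the divergence and the last bracket.
\<close>

definition cutZ :: "real \<Rightarrow> real \<times> (real^'n) \<Rightarrow> real" where "cutZ R z = cut R (snd z) * Z z"
definition cutW :: "real \<Rightarrow> real \<times> (real^'n) \<Rightarrow> real" where "cutW R z = cut R (snd z) * W z"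
definition src :: "real \<Rightarrow> real \<times> (real^'n) \<Rightarrow> real" where
  "src R z = W z * laplacian (cut R) (snd z) + F z \<bullet> grad (cut R) (snd z)"
definition flux :: "real \<Rightarrow> 'n \<Rightarrow> real \<times> (real^'n) \<Rightarrow> real" where
  "flux R i z = 2 * W z * pd i (cut R) (snd z) + cut R (snd z) * F z $ i"

lemma cut_measurable[measurable]:
  "(cut R :: real^'n \<Rightarrow> real) \<in> borel_measurable borel"
  "(\<lambda>x::real^'n. pd i (cut R) x) \<in> borel_measurable borel"
  "(\<lambda>x::real^'n. laplacian (cut R) x) \<in> borel_measurable borel"
  by (intro borel_measurable_esmooth esmooth_cut esmooth_pd esmooth_laplacian)+

lemma cut_products_measurable[measurable]:
  "cutZ R \<in> borel_measurable borel" "cutW R \<in> borel_measurable borel"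
  "src R \<in> borel_measurable borel" "flux R i \<in> borel_measurable borel"
  unfolding cutZ_def[abs_def] cutW_def[abs_def] src_def[abs_def] flux_def[abs_def] inner_grad by measurable

lemma cutZ_le: "\<bar>cutZ R z\<bar> \<le> \<bar>Z z\<bar>" "\<bar>cutW R z\<bar> \<le> \<bar>W z\<bar>"
  using cut_bounds[of R "snd z"] by (simp_all add: cutZ_def cutW_def abs_mult mult_left_le_one_le)

lemma cutZ2_le: "(cutZ R z)\<^sup>2 \<le> (Z z)\<^sup>2" "(cutW R z)\<^sup>2 \<le> L\<^sup>2 * (Z z)\<^sup>2"
  using power_mono[OF cutZ_le(1)[of R z], of 2] power_mono[OF cutZ_le(2)[of R z], of 2] W2_le[of z] by simp_all

lemma good_cut:
  assumes "good t"
  shows "integrable lborel (\<lambda>x. cutZ R (t, x))" "integrable lborel (\<lambda>x. (cutZ R (t, x))\<^sup>2)"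
    "integrable lborel (\<lambda>x. cutW R (t, x))" "integrable lborel (\<lambda>x. (cutW R (t, x))\<^sup>2)"
proof -
  show "integrable lborel (\<lambda>x. cutZ R (t, x))"
    by (rule Bochner_Integration.integrable_bound[of _ "\<lambda>x. Z (t, x)"])
       (use assms in \<open>auto simp: good_def cutZ_le\<close>)
  show "integrable lborel (\<lambda>x. cutW R (t, x))"
    by (rule Bochner_Integration.integrable_bound[OF good_W[OF assms]]) (auto simp: cutZ_le)
  show "integrable lborel (\<lambda>x. (cutZ R (t, x))\<^sup>2)"
    by (rule Bochner_Integration.integrable_bound[OF good_Z2[OF assms]]) (auto simp: cutZ2_le)
  show "integrable lborel (\<lambda>x. (cutW R (t, x))\<^sup>2)"
    by (rule Bochner_Integration.integrable_bound[of _ "\<lambda>x. L\<^sup>2 * (Z (t, x))\<^sup>2"])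
       (auto simp: cutZ2_le good_Z2[OF assms])
qed

lemma cutZ_outside: "R > 0 \<Longrightarrow> norm x > R \<Longrightarrow> cutZ R (t, x) = 0"
  by (simp add: cutZ_def cut_eq_0)

text \<open>
  The choice is made once for all \<open>R \<ge> 1\<close>, so that every constant derived from it is uniform in \<open>R\<close>.
\<close>

definition cut_const :: real where
  "cut_const = (SOME C. 0 \<le> C \<and> (\<forall>R\<ge>1. \<forall>x::real^'n. (\<forall>i. \<bar>pd i (cut R) x\<bar> \<le> C) \<and> \<bar>laplacian (cut R) x\<bar> \<le> C))"

lemma cut_const: "0 \<le> cut_const" "R \<ge> 1 \<Longrightarrow> \<bar>pd i (cut R) (x::real^'n)\<bar> \<le> cut_const" "R \<ge> 1 \<Longrightarrow> \<bar>laplacian (cut R) (x::real^'n)\<bar> \<le> cut_const"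
proof -
  have "0 \<le> cut_const \<and> (\<forall>R\<ge>1. \<forall>x::real^'n. (\<forall>i. \<bar>pd i (cut R) x\<bar> \<le> cut_const) \<and> \<bar>laplacian (cut R) x\<bar> \<le> cut_const)"
    unfolding cut_const_def by (rule someI_ex) (rule cut_derivative_bounds)
  then show "0 \<le> cut_const" "R \<ge> 1 \<Longrightarrow> \<bar>pd i (cut R) (x::real^'n)\<bar> \<le> cut_const" "R \<ge> 1 \<Longrightarrow> \<bar>laplacian (cut R) (x::real^'n)\<bar> \<le> cut_const"
    by blast+
qed

text \<open>
  Large enough to serve as the factor of both \<open>Z\<^sup>2\<close> and \<open>|F|\<^sup>2\<close> in the pointwise estimate of \<open>src R\<close> and
  \<open>flux R\<close> below.
\<close>

definition src_const :: real where
  "src_const = 1 + (2 * cut_const\<^sup>2 + real CARD('n) * 8 * cut_const\<^sup>2) * L\<^sup>2 + (2 * real CARD('n) * cut_const\<^sup>2 + 2)"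

lemma src_const_ge_1: "src_const \<ge> 1" unfolding src_const_def by simp

lemma source_bound:
  assumes R: "R \<ge> 1"
  shows "(src R z)\<^sup>2 + (\<Sum>i\<in>UNIV. (flux R i z)\<^sup>2) \<le> src_const * ((Z z)\<^sup>2 + (norm (F z))\<^sup>2)"
proof -
  let ?n = "real CARD('n)" and ?w = "L\<^sup>2 * (Z z)\<^sup>2" and ?f = "(norm (F z))\<^sup>2"
  have c2: "(pd i (cut R) (snd z))\<^sup>2 \<le> cut_const\<^sup>2" for i by (rule abs_sq_le[OF cut_const(2)[OF R]])
  have l2: "(laplacian (cut R) (snd z))\<^sup>2 \<le> cut_const\<^sup>2" by (rule abs_sq_le[OF cut_const(3)[OF R]])
  have g2: "(norm (grad (cut R) (snd z)))\<^sup>2 \<le> ?n * cut_const\<^sup>2"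
  proof -
    have "(norm (grad (cut R) (snd z)))\<^sup>2 = (\<Sum>i\<in>UNIV. (pd i (cut R) (snd z))\<^sup>2)"
      by (simp add: grad_nth flip: sum_square_vec)
    also have "\<dots> \<le> (\<Sum>i\<in>(UNIV::'n set). cut_const\<^sup>2)" by (intro sum_mono c2)
    finally show ?thesis by simp
  qed
  have "(src R z)\<^sup>2 \<le> 2 * (W z * laplacian (cut R) (snd z))\<^sup>2 + 2 * (F z \<bullet> grad (cut R) (snd z))\<^sup>2"
    unfolding src_def by (rule sq_sum_le)
  also have "(W z * laplacian (cut R) (snd z))\<^sup>2 \<le> ?w * cut_const\<^sup>2"
    unfolding power_mult_distrib by (intro mult_mono W2_le l2) auto
  also have "(F z \<bullet> grad (cut R) (snd z))\<^sup>2 \<le> ?f * (?n * cut_const\<^sup>2)"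
  proof -
    have "(F z \<bullet> grad (cut R) (snd z))\<^sup>2 \<le> (norm (F z) * norm (grad (cut R) (snd z)))\<^sup>2"
      by (rule abs_sq_le[OF Cauchy_Schwarz_ineq2])
    also have "\<dots> \<le> ?f * (?n * cut_const\<^sup>2)" unfolding power_mult_distrib by (intro mult_left_mono g2) auto
    finally show ?thesis .
  qed
  finally have s: "(src R z)\<^sup>2 \<le> 2 * (?w * cut_const\<^sup>2) + 2 * (?f * (?n * cut_const\<^sup>2))" by simp
  have "(flux R i z)\<^sup>2 \<le> 8 * (?w * cut_const\<^sup>2) + 2 * (F z $ i)\<^sup>2" for i
  proof -
    have "(flux R i z)\<^sup>2 \<le> 2 * (2 * W z * pd i (cut R) (snd z))\<^sup>2 + 2 * (cut R (snd z) * F z $ i)\<^sup>2"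
      unfolding flux_def by (rule sq_sum_le)
    moreover have "(2 * W z * pd i (cut R) (snd z))\<^sup>2 \<le> 4 * (?w * cut_const\<^sup>2)"
    proof -
      have "(W z)\<^sup>2 * (pd i (cut R) (snd z))\<^sup>2 \<le> ?w * cut_const\<^sup>2" by (intro mult_mono W2_le c2) auto
      then show ?thesis by (simp add: power_mult_distrib)
    qed
    moreover have "(cut R (snd z) * F z $ i)\<^sup>2 \<le> (F z $ i)\<^sup>2"
    proof -
      have "(cut R (snd z))\<^sup>2 \<le> 1" using cut_bounds[of R "snd z"] by (simp add: power_le_one)
      then show ?thesis unfolding power_mult_distrib by (simp add: mult_left_le_one_le)
    qed
    ultimately show ?thesis by linarith
  qed
  then have "(\<Sum>i\<in>UNIV. (flux R i z)\<^sup>2) \<le> (\<Sum>i\<in>UNIV. 8 * (?w * cut_const\<^sup>2) + 2 * (F z $ i)\<^sup>2)" by (rule sum_mono)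
  also have "\<dots> = ?n * 8 * (?w * cut_const\<^sup>2) + 2 * ?f"
    by (simp add: sum.distrib sum_square_vec flip: sum_distrib_left)
  finally have "(src R z)\<^sup>2 + (\<Sum>i\<in>UNIV. (flux R i z)\<^sup>2) \<le>
      (2 * cut_const\<^sup>2 + ?n * 8 * cut_const\<^sup>2) * L\<^sup>2 * (Z z)\<^sup>2 + (2 * ?n * cut_const\<^sup>2 + 2) * ?f"
    using s by (simp add: algebra_simps)
  also have "\<dots> \<le> src_const * (Z z)\<^sup>2 + src_const * ?f"
  proof -
    have c1: "(2 * cut_const\<^sup>2 + ?n * 8 * cut_const\<^sup>2) * L\<^sup>2 \<le> src_const" "2 * ?n * cut_const\<^sup>2 + 2 \<le> src_const" unfolding src_const_def by simp_all
    show ?thesis by (intro add_mono mult_right_mono c1) auto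
  qed
  finally show ?thesis by (simp add: distrib_left)
qed

lemma good_src:
  assumes t: "good t" and R: "R \<ge> 1"
  shows "integrable lborel (\<lambda>x. src R (t, x))" "integrable lborel (\<lambda>x. (src R (t, x))\<^sup>2)"
    "integrable lborel (\<lambda>x. flux R i (t, x))" "integrable lborel (\<lambda>x. (flux R i (t, x))\<^sup>2)"
    "(LBINT x. (src R (t, x))\<^sup>2) + (\<Sum>i\<in>UNIV. LBINT x. (flux R i (t, x))\<^sup>2) \<le> src_const * (1 + G t) * z2 t"
proof -
  have R0: "R > 0" using R by simp
  have b: "integrable lborel (\<lambda>x. src_const * ((Z (t, x))\<^sup>2 + (norm (F (t, x)))\<^sup>2))"
    using good_Z2[OF t] t by (simp add: good_def)
  have f0: "0 \<le> (\<Sum>i\<in>UNIV. (flux R i z)\<^sup>2)" for z by (simp add: sum_nonneg)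
  have fi: "(flux R i z)\<^sup>2 \<le> (\<Sum>i\<in>UNIV. (flux R i z)\<^sup>2)" for z i by (intro member_le_sum) auto
  have s1: "(src R z)\<^sup>2 \<le> src_const * ((Z z)\<^sup>2 + (norm (F z))\<^sup>2)" for z using source_bound[OF R, of z] f0[of z] by linarith
  have s2: "(flux R i z)\<^sup>2 \<le> src_const * ((Z z)\<^sup>2 + (norm (F z))\<^sup>2)" for z i
    using source_bound[OF R, of z] fi[of i z] zero_le_power2[of "src R z"] by linarith
  show src2: "integrable lborel (\<lambda>x. (src R (t, x))\<^sup>2)"
    by (rule Bochner_Integration.integrable_bound[OF b]) (auto intro: order_trans[OF s1 abs_ge_self])
  have flux2: "integrable lborel (\<lambda>x. (flux R i (t, x))\<^sup>2)" for i
    by (rule Bochner_Integration.integrable_bound[OF b]) (auto intro: order_trans[OF s2 abs_ge_self])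
  then show "integrable lborel (\<lambda>x. (flux R i (t, x))\<^sup>2)" .
  have o1: "norm x > R \<Longrightarrow> pd i (cut R) x = 0" for i and x :: "real^'n" by (rule pd_outside[OF cut_eq_0[OF R0]])
  have cF: "integrable lborel (\<lambda>x. cut R x * F (t, x) $ i)" for i
  proof (rule integrable_cutoff[OF _ _ good_F2[OF t]])
    show "\<bar>cut R (x::real^'n)\<bar> \<le> 1" for x using cut_bounds[of R x] by simp
  qed (use cut_eq_0[OF R0] in auto)
  have pF: "integrable lborel (\<lambda>x. pd i (cut R) x * F (t, x) $ i)" for i
    by (rule integrable_cutoff[where g="pd i (cut R)" and B=cut_const and R=R, OF _ _ good_F2[OF t] cut_const(2)[OF R] o1]) auto
  have lW: "integrable lborel (\<lambda>x. laplacian (cut R) x * W (t, x))"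
    using integrable_mult_bounded[OF good_W[OF t], of "laplacian (cut R)" cut_const] cut_const(3)[OF R] by simp
  have pW: "integrable lborel (\<lambda>x. pd i (cut R) x * W (t, x))" for i
    using integrable_mult_bounded[OF good_W[OF t], of "pd i (cut R)" cut_const] cut_const(2)[OF R] by simp
  show "integrable lborel (\<lambda>x. src R (t, x))"
    unfolding src_def inner_grad using lW pF by (simp add: mult.commute)
  show "integrable lborel (\<lambda>x. flux R i (t, x))"
    unfolding flux_def using pW[of i] cF[of i] by (simp add: mult_ac)
  have "(LBINT x. (src R (t, x))\<^sup>2) + (\<Sum>i\<in>UNIV. LBINT x. (flux R i (t, x))\<^sup>2) =
      (LBINT x. (src R (t, x))\<^sup>2 + (\<Sum>i\<in>UNIV. (flux R i (t, x))\<^sup>2))"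
    using src2 flux2 by simp
  also have "\<dots> \<le> (LBINT x. src_const * ((Z (t, x))\<^sup>2 + (norm (F (t, x)))\<^sup>2))"
    using src2 flux2 b source_bound[OF R] by (intro integral_mono) auto
  also have "\<dots> = src_const * (z2 t + (LBINT x. (norm (F (t, x)))\<^sup>2))"
    using good_Z2[OF t] t by (simp add: good_def z2_def)
  also have "\<dots> \<le> src_const * (z2 t + G t * z2 t)"
    using t src_const_ge_1 by (intro mult_left_mono add_left_mono) (auto simp: good_def)
  finally show "(LBINT x. (src R (t, x))\<^sup>2) + (\<Sum>i\<in>UNIV. LBINT x. (flux R i (t, x))\<^sup>2) \<le> src_const * (1 + G t) * z2 t"
    by (simp add: algebra_simps)
qed

text \<open>
  Transforms in space, as functions of the pair \<open>(t,\<xi>)\<close>: \<open>Zh\<close> and \<open>Wh\<close> of \<open>\<chi> Z\<close> and \<open>\<chi> W\<close>, \<open>Qh\<close> of the terms of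
  order at most one, and \<open>fh\<close> of the whole right-hand side.
\<close>

definition Zh :: "real \<Rightarrow> real \<times> (real^'n) \<Rightarrow> complex" where "Zh R p = ft (\<lambda>x. cutZ R (fst p, x)) (snd p)"
definition Wh :: "real \<Rightarrow> real \<times> (real^'n) \<Rightarrow> complex" where "Wh R p = ft (\<lambda>x. cutW R (fst p, x)) (snd p)"
definition Qh :: "real \<Rightarrow> real \<times> (real^'n) \<Rightarrow> complex" where
  "Qh R p = ft (\<lambda>x. src R (fst p, x)) (snd p) + \<i> * (\<Sum>i\<in>UNIV. (snd p $ i) *\<^sub>R ft (\<lambda>x. flux R i (fst p, x)) (snd p))"
definition fh :: "real \<Rightarrow> real \<times> (real^'n) \<Rightarrow> complex" where
  "fh R p = Qh R p - (norm (snd p))\<^sup>2 *\<^sub>R Wh R p"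

lemma measurable_vec_nth[measurable]: "(\<lambda>p::real \<times> (real^'n). snd p $ i) \<in> borel_measurable borel"
  by (intro borel_measurable_continuous_onI continuous_intros)

lemma hat_measurable[measurable]:
  "Zh R \<in> borel_measurable borel" "Wh R \<in> borel_measurable borel" "Qh R \<in> borel_measurable borel" "fh R \<in> borel_measurable borel"
proof -
  note m = borel_measurable_ft_param
  show 1: "Zh R \<in> borel_measurable borel" unfolding Zh_def[abs_def] by (rule m) measurable
  show 2: "Wh R \<in> borel_measurable borel" unfolding Wh_def[abs_def] by (rule m) measurable
  have [measurable]: "(\<lambda>p::real \<times> (real^'n). ft (\<lambda>x. src R (fst p, x)) (snd p)) \<in> borel_measurable borel"
    "(\<lambda>p::real \<times> (real^'n). ft (\<lambda>x. flux R i (fst p, x)) (snd p)) \<in> borel_measurable borel" for i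
    by (rule m, measurable)+
  show 3: "Qh R \<in> borel_measurable borel" unfolding Qh_def[abs_def] by measurable
  note [measurable] = 2 3
  show "fh R \<in> borel_measurable borel" unfolding fh_def[abs_def] by measurable
qed

text \<open>
  The right-hand side, tested with the real and the imaginary part of \<open>\<chi>(x) exp(i \<xi> \<cdot> x)\<close>.
\<close>

lemma rate_trig:
  assumes t: "good t" and R: "R \<ge> 1"
  shows "(LBINT x. rate (\<lambda>x. cut R x * cos (\<xi> \<bullet> x)) (t, x)) = Re (fh R (t, \<xi>))"
    and "(LBINT x. rate (\<lambda>x. cut R x * sin (\<xi> \<bullet> x)) (t, x)) = Im (fh R (t, \<xi>))"
proof -
  note es = esmooth_cut esmooth_trig
  note i = good_src[OF t R] good_cut[OF t, of R]
  have ic: "integrable lborel (\<lambda>x. h x * cos (\<xi> \<bullet> x))" "integrable lborel (\<lambda>x. h x * sin (\<xi> \<bullet> x))"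
    if "integrable lborel h" for h
    using integrable_mult_bounded[OF that, of "\<lambda>x. cos (\<xi> \<bullet> x)" 1] integrable_mult_bounded[OF that, of "\<lambda>x. sin (\<xi> \<bullet> x)" 1]
    by (simp_all add: mult.commute)
  have c: "rate (\<lambda>x. cut R x * cos (\<xi> \<bullet> x)) (t, x) = src R (t, x) * cos (\<xi> \<bullet> x) -
      (\<Sum>i\<in>UNIV. \<xi> $ i * (flux R i (t, x) * sin (\<xi> \<bullet> x))) - (norm \<xi>)\<^sup>2 * (cutW R (t, x) * cos (\<xi> \<bullet> x))" for x
    unfolding rate_def src_def flux_def cutW_def inner_grad
    by (simp add: laplacian_trig es pd_mult pd_trig sum.distrib sum_subtractf sum_distrib_left sum_distrib_right algebra_simps)
  have s: "rate (\<lambda>x. cut R x * sin (\<xi> \<bullet> x)) (t, x) = src R (t, x) * sin (\<xi> \<bullet> x) +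
      (\<Sum>i\<in>UNIV. \<xi> $ i * (flux R i (t, x) * cos (\<xi> \<bullet> x))) - (norm \<xi>)\<^sup>2 * (cutW R (t, x) * sin (\<xi> \<bullet> x))" for x
    unfolding rate_def src_def flux_def cutW_def inner_grad
    by (simp add: laplacian_trig es pd_mult pd_trig sum.distrib sum_subtractf sum_distrib_left sum_distrib_right algebra_simps)
  have "(LBINT x. rate (\<lambda>x. cut R x * cos (\<xi> \<bullet> x)) (t, x)) =
      (LBINT x. src R (t, x) * cos (\<xi> \<bullet> x)) - (\<Sum>i\<in>UNIV. \<xi> $ i * (LBINT x. flux R i (t, x) * sin (\<xi> \<bullet> x)))
      - (norm \<xi>)\<^sup>2 * (LBINT x. cutW R (t, x) * cos (\<xi> \<bullet> x))"
    unfolding c using ic[OF i(1)] ic[OF i(3)] ic[OF i(8)] by simp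
  then show "(LBINT x. rate (\<lambda>x. cut R x * cos (\<xi> \<bullet> x)) (t, x)) = Re (fh R (t, \<xi>))"
    by (simp add: fh_def Qh_def Wh_def ft_Re_Im i)
  have "(LBINT x. rate (\<lambda>x. cut R x * sin (\<xi> \<bullet> x)) (t, x)) =
      (LBINT x. src R (t, x) * sin (\<xi> \<bullet> x)) + (\<Sum>i\<in>UNIV. \<xi> $ i * (LBINT x. flux R i (t, x) * cos (\<xi> \<bullet> x)))
      - (norm \<xi>)\<^sup>2 * (LBINT x. cutW R (t, x) * sin (\<xi> \<bullet> x))"
    unfolding s using ic[OF i(1)] ic[OF i(3)] ic[OF i(8)] by simp
  then show "(LBINT x. rate (\<lambda>x. cut R x * sin (\<xi> \<bullet> x)) (t, x)) = Im (fh R (t, \<xi>))"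
    by (simp add: fh_def Qh_def Wh_def ft_Re_Im i)
qed

lemma hat_eq_prim:
  assumes R: "R \<ge> 1"
  shows "AE t in lborel. 0 < t \<and> t < T \<longrightarrow> Re (Zh R (t, \<xi>)) = prim (\<lambda>s. Re (fh R (s, \<xi>))) t \<and>
           Im (Zh R (t, \<xi>)) = prim (\<lambda>s. Im (fh R (s, \<xi>))) t"
    and "integrable lborel (\<lambda>s. Re (fh R (s, \<xi>)))" and "integrable lborel (\<lambda>s. Im (fh R (s, \<xi>)))"
proof -
  have R0: "R > 0" using R by simp
  let ?c = "\<lambda>x::real^'n. cut R x * cos (\<xi> \<bullet> x)" and ?s = "\<lambda>x::real^'n. cut R x * sin (\<xi> \<bullet> x)"
  have es: "esmooth ?c" "esmooth ?s" by (intro esmooth.mult esmooth_cut esmooth_trig)+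
  have o: "norm x > R \<Longrightarrow> ?c x = 0" "norm x > R \<Longrightarrow> ?s x = 0" for x using cut_eq_0[OF R0] by auto
  have c: "integrable lborel (\<lambda>t. LBINT x. rate ?c (t, x))"
    "AE t in lborel. 0 < t \<and> t < T \<longrightarrow> (LBINT x. Z (t, x) * ?c x) = prim (\<lambda>s. LBINT x. rate ?c (s, x)) t"
    using moment_primitive(2,3)[OF es(1), of R] o(1) by blast+
  have s: "integrable lborel (\<lambda>t. LBINT x. rate ?s (t, x))"
    "AE t in lborel. 0 < t \<and> t < T \<longrightarrow> (LBINT x. Z (t, x) * ?s x) = prim (\<lambda>s. LBINT x. rate ?s (s, x)) t"
    using moment_primitive(2,3)[OF es(2), of R] o(2) by blast+
  have mR: "(\<lambda>s. Re (fh R (s, \<xi>))) \<in> borel_measurable borel" "(\<lambda>s. Im (fh R (s, \<xi>))) \<in> borel_measurable borel"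
    by measurable
  have aR: "AE t in lborel. (LBINT x. rate ?c (t, x)) = Re (fh R (t, \<xi>))"
    "AE t in lborel. (LBINT x. rate ?s (t, x)) = Im (fh R (t, \<xi>))"
    using AE_good by (eventually_elim, simp add: rate_trig R)+
  have mr: "(\<lambda>t. LBINT x. rate ?c (t, x)) \<in> borel_measurable borel" "(\<lambda>t. LBINT x. rate ?s (t, x)) \<in> borel_measurable borel"
    using c(1) s(1) by simp_all
  show "integrable lborel (\<lambda>s. Re (fh R (s, \<xi>)))"
    using c(1) by (rule integrable_cong_AE_imp) (use mR aR in \<open>auto elim: eventually_mono\<close>)
  show "integrable lborel (\<lambda>s. Im (fh R (s, \<xi>)))"
    using s(1) by (rule integrable_cong_AE_imp) (use mR aR in \<open>auto elim: eventually_mono\<close>)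
  have pe: "prim (\<lambda>t. LBINT x. rate ?c (t, x)) t = prim (\<lambda>s. Re (fh R (s, \<xi>))) t"
    "prim (\<lambda>t. LBINT x. rate ?s (t, x)) t = prim (\<lambda>s. Im (fh R (s, \<xi>))) t" for t
    unfolding prim_def
    by (rule integral_cong_AE; (use mr mR aR in \<open>auto elim: eventually_mono\<close>))+
  show "AE t in lborel. 0 < t \<and> t < T \<longrightarrow> Re (Zh R (t, \<xi>)) = prim (\<lambda>s. Re (fh R (s, \<xi>))) t \<and>
           Im (Zh R (t, \<xi>)) = prim (\<lambda>s. Im (fh R (s, \<xi>))) t"
    using AE_good c(2) s(2) unfolding pe
  proof eventually_elim
    case (elim t)
    have "Re (Zh R (t, \<xi>)) = (LBINT x. Z (t, x) * ?c x)" "Im (Zh R (t, \<xi>)) = (LBINT x. Z (t, x) * ?s x)"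
      using good_cut(1)[OF elim(1), of R] by (simp_all add: Zh_def ft_Re_Im cutZ_def mult_ac)
    with elim show ?case by simp
  qed
qed

section \<open>Energy inequality and conclusion\<close>

text \<open>
  The constant of Plancherel's identity, \<open>(2\<pi>)\<^sup>d\<close>.
\<close>

definition ft_const :: real where "ft_const = (gauss_mass TYPE(real^'n))\<^sup>2"

text \<open>
  Half of the time derivative of the energy density at frequency \<open>\<xi>\<close>.
\<close>

definition En :: "real \<Rightarrow> real \<times> (real^'n) \<Rightarrow> real" where
  "En R p = Re (cnj (Zh R p) * fh R p) / (1 + (norm (snd p))\<^sup>2)"

definition energy :: "real \<Rightarrow> real \<Rightarrow> real" where
  "energy R t = (LBINT \<xi>. (norm (Zh R (t, \<xi>)))\<^sup>2 / (1 + (norm \<xi>)\<^sup>2))"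

text \<open>
  By Cauchy--Schwarz this dominates \<open>|Qh|\<^sup>2 / (1 + |\<xi>|\<^sup>2)\<close>, and being a sum of squared transforms it can be
  integrated by Plancherel.
\<close>

definition src_power :: "real \<Rightarrow> real \<times> (real^'n) \<Rightarrow> real" where
  "src_power R p = (norm (ft (\<lambda>x. src R (fst p, x)) (snd p)))\<^sup>2 + (\<Sum>i\<in>UNIV. (norm (ft (\<lambda>x. flux R i (fst p, x)) (snd p)))\<^sup>2)"

lemma ft_const_pos: "ft_const > 0" using gauss_mass_pos[where 'a="real^'n"] by (simp add: ft_const_def)

lemma En_measurable[measurable]: "En R \<in> borel_measurable borel"
  unfolding En_def[abs_def] by measurable

lemma energy_measurable[measurable]: "energy R \<in> borel_measurable borel"
  using borel_measurable_integral_param[of "\<lambda>p::real \<times> (real^'n). (norm (Zh R p))\<^sup>2 / (1 + (norm (snd p))\<^sup>2)"]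
  by (simp add: energy_def[abs_def])

lemma hat_outside:
  assumes "t \<le> 0 \<or> T \<le> t"
  shows "Zh R (t, \<xi>) = 0" "fh R (t, \<xi>) = 0"
  using suppZ[OF assms] suppW[OF assms] suppF[OF assms]
  by (simp_all add: Zh_def fh_def Wh_def Qh_def cutZ_def cutW_def src_def flux_def ft_def)

lemma Qh_bound: "(norm (Qh R p))\<^sup>2 \<le> (1 + (norm (snd p))\<^sup>2) * src_power R p"
proof -
  let ?a = "norm (ft (\<lambda>x. src R (fst p, x)) (snd p))" and ?b = "\<lambda>i. norm (ft (\<lambda>x. flux R i (fst p, x)) (snd p))"
  let ?s = "\<Sum>i\<in>UNIV. \<bar>snd p $ i\<bar> * ?b i" and ?x = "norm (snd p)" and ?y = "\<Sum>i\<in>UNIV. (?b i)\<^sup>2"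
  have "norm (Qh R p) \<le> ?a + norm (\<i> * (\<Sum>i\<in>UNIV. (snd p $ i) *\<^sub>R ft (\<lambda>x. flux R i (fst p, x)) (snd p)))"
    unfolding Qh_def by (rule norm_triangle_ineq)
  also have "norm (\<i> * (\<Sum>i\<in>UNIV. (snd p $ i) *\<^sub>R ft (\<lambda>x. flux R i (fst p, x)) (snd p))) \<le> ?s"
    unfolding norm_mult norm_ii by (simp, rule order_trans[OF norm_sum]) simp
  finally have n: "norm (Qh R p) \<le> ?a + ?s" by simp
  have s0: "0 \<le> ?s" by (intro sum_nonneg) simp
  have s2: "?s\<^sup>2 \<le> ?x\<^sup>2 * ?y"
    using Cauchy_Schwarz_ineq_sum[of "\<lambda>i. \<bar>snd p $ i\<bar>" ?b UNIV] by (simp add: sum_square_vec)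
  have "(norm (Qh R p))\<^sup>2 \<le> (?a + ?s)\<^sup>2" by (rule power_mono[OF n norm_ge_zero])
  also have "\<dots> \<le> (1 + ?x\<^sup>2) * (?a\<^sup>2 + ?y)"
  proof -
    have y0: "0 \<le> ?y" by (simp add: sum_nonneg)
    have "(?a * ?s)\<^sup>2 \<le> (?a\<^sup>2 * ?x\<^sup>2) * ?y" unfolding power_mult_distrib mult.assoc using s2 by (intro mult_left_mono) auto
    also have "\<dots> = (?a * ?x)\<^sup>2 * (sqrt ?y)\<^sup>2" using y0 by (simp add: power_mult_distrib)
    also have "\<dots> = ((?a * ?x) * sqrt ?y)\<^sup>2" by (simp add: power_mult_distrib)
    finally have "?a * ?s \<le> (?a * ?x) * sqrt ?y" by (rule power2_le_imp_le) (use y0 in simp)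
    moreover have "2 * ((?a * ?x) * sqrt ?y) \<le> (?a * ?x)\<^sup>2 + (sqrt ?y)\<^sup>2"
      using sum_squares_bound[of "?a * ?x" "sqrt ?y"] by (simp add: mult.assoc)
    ultimately have "2 * (?a * ?s) \<le> ?a\<^sup>2 * ?x\<^sup>2 + ?y" using y0 by (simp add: power_mult_distrib)
    moreover have "(?a + ?s)\<^sup>2 = ?a\<^sup>2 + 2 * (?a * ?s) + ?s\<^sup>2" by (simp add: power2_sum)
    moreover have "(1 + ?x\<^sup>2) * (?a\<^sup>2 + ?y) = ?a\<^sup>2 + (?a\<^sup>2 * ?x\<^sup>2 + ?y) + ?x\<^sup>2 * ?y" by (simp add: algebra_simps)
    ultimately show ?thesis using s2 by linarith
  qed
  finally show ?thesis by (simp add: src_power_def)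
qed

lemma En_bound:
  assumes "k > 0" "l > 0"
  shows "2 * En R p \<le> - 2 * Re (Zh R p * cnj (Wh R p)) + (1 / k + l) * ((norm (Zh R p))\<^sup>2 / (1 + (norm (snd p))\<^sup>2))
           + k * (norm (Wh R p))\<^sup>2 + src_power R p / l"
    and "2 * \<bar>En R p\<bar> \<le> (1 + l) * (norm (Zh R p))\<^sup>2 + (norm (Wh R p))\<^sup>2 + src_power R p / l"
  using spectral_energy_bound[of "1 + (norm (snd p))\<^sup>2" "Qh R p" "src_power R p" k l "Zh R p" "Wh R p", OF _ Qh_bound assms]
  by (simp_all add: En_def fh_def)

definition zR2 :: "real \<Rightarrow> real \<Rightarrow> real" where "zR2 R t = (LBINT x. (cutZ R (t, x))\<^sup>2)"

lemma hat_L2: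
  assumes t: "good t"
  shows "integrable lborel (\<lambda>\<xi>. (norm (Zh R (t, \<xi>)))\<^sup>2)" "(LBINT \<xi>. (norm (Zh R (t, \<xi>)))\<^sup>2) \<le> ft_const * zR2 R t"
    "integrable lborel (\<lambda>\<xi>. (norm (Wh R (t, \<xi>)))\<^sup>2)" "(LBINT \<xi>. (norm (Wh R (t, \<xi>)))\<^sup>2) \<le> ft_const * (L\<^sup>2 * z2 t)"
    "integrable lborel (\<lambda>\<xi>. Re (Zh R (t, \<xi>) * cnj (Wh R (t, \<xi>))))"
    "ft_const * (\<alpha> * zR2 R t) \<le> (LBINT \<xi>. Re (Zh R (t, \<xi>) * cnj (Wh R (t, \<xi>))))"
proof -
  note c = good_cut[OF t, of R]
  show "integrable lborel (\<lambda>\<xi>. (norm (Zh R (t, \<xi>)))\<^sup>2)" "(LBINT \<xi>. (norm (Zh R (t, \<xi>)))\<^sup>2) \<le> ft_const * zR2 R t"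
    "integrable lborel (\<lambda>\<xi>. (norm (Wh R (t, \<xi>)))\<^sup>2)"
    using ft_L2_bound[OF c(1,2)] ft_L2_bound[OF c(3,4)] by (simp_all add: Zh_def Wh_def zR2_def ft_const_def)
  have "(LBINT \<xi>. (norm (Wh R (t, \<xi>)))\<^sup>2) \<le> ft_const * (LBINT x. (cutW R (t, x))\<^sup>2)"
    using ft_L2_bound[OF c(3,4)] by (simp add: Wh_def ft_const_def)
  also have "\<dots> \<le> ft_const * (LBINT x. L\<^sup>2 * (Z (t, x))\<^sup>2)"
    using c(4) good_Z2[OF t] ft_const_pos by (intro mult_left_mono integral_mono) (auto simp: cutZ2_le)
  finally show "(LBINT \<xi>. (norm (Wh R (t, \<xi>)))\<^sup>2) \<le> ft_const * (L\<^sup>2 * z2 t)" by (simp add: z2_def)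
  have b: "\<bar>cutZ R (t, x)\<bar> \<le> M" for x using cutZ_le(1)[of R "(t, x)"] Zb[of "(t, x)"] by linarith
  note P = ft_plancherel[OF c(1,2) b c(3,4)]
  show "integrable lborel (\<lambda>\<xi>. Re (Zh R (t, \<xi>) * cnj (Wh R (t, \<xi>))))" using P(1) by (simp add: Zh_def Wh_def)
  have "\<alpha> * zR2 R t = (LBINT x. \<alpha> * (cutZ R (t, x))\<^sup>2)" by (simp add: zR2_def)
  also have "\<dots> \<le> (LBINT x. cutZ R (t, x) * cutW R (t, x))"
  proof (rule integral_mono)
    show "integrable lborel (\<lambda>x. cutZ R (t, x) * cutW R (t, x))" by (intro integrable_mult_L2 c) auto
    show "\<alpha> * (cutZ R (t, x))\<^sup>2 \<le> cutZ R (t, x) * cutW R (t, x)" for x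
    proof -
      have "(cut R x)\<^sup>2 * (\<alpha> * (Z (t, x))\<^sup>2) \<le> (cut R x)\<^sup>2 * (Z (t, x) * W (t, x))" by (intro mult_left_mono WZ) simp
      then show ?thesis by (simp add: cutZ_def cutW_def power2_eq_square mult_ac)
    qed
  qed (use c in simp)
  finally have "\<alpha> * zR2 R t \<le> (LBINT x. cutZ R (t, x) * cutW R (t, x))" .
  then show "ft_const * (\<alpha> * zR2 R t) \<le> (LBINT \<xi>. Re (Zh R (t, \<xi>) * cnj (Wh R (t, \<xi>))))"
    using P(2) ft_const_pos by (simp add: Zh_def Wh_def ft_const_def)
qed

lemma src_power_L1:
  assumes t: "good t" and R: "R \<ge> 1"
  shows "integrable lborel (\<lambda>\<xi>. src_power R (t, \<xi>))" "(LBINT \<xi>. src_power R (t, \<xi>)) \<le> ft_const * (src_const * (1 + G t) * z2 t)"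
proof -
  note s = good_src[OF t R]
  have i: "integrable lborel (\<lambda>\<xi>. (norm (ft (\<lambda>x. src R (t, x)) \<xi>))\<^sup>2)" "integrable lborel (\<lambda>\<xi>. (norm (ft (\<lambda>x. flux R i (t, x)) \<xi>))\<^sup>2)" for i
    using ft_L2_bound(1)[OF s(1,2)] ft_L2_bound(1)[OF s(3,4)] by simp_all
  then show "integrable lborel (\<lambda>\<xi>. src_power R (t, \<xi>))" by (simp add: src_power_def)
  have "(LBINT \<xi>. src_power R (t, \<xi>)) = (LBINT \<xi>. (norm (ft (\<lambda>x. src R (t, x)) \<xi>))\<^sup>2) +
      (\<Sum>i\<in>UNIV. LBINT \<xi>. (norm (ft (\<lambda>x. flux R i (t, x)) \<xi>))\<^sup>2)"
    using i by (simp add: src_power_def)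
  also have "\<dots> \<le> ft_const * (LBINT x. (src R (t, x))\<^sup>2) + (\<Sum>i\<in>UNIV. ft_const * (LBINT x. (flux R i (t, x))\<^sup>2))"
    unfolding ft_const_def by (intro add_mono sum_mono ft_L2_bound(2) s)
  also have "\<dots> = ft_const * ((LBINT x. (src R (t, x))\<^sup>2) + (\<Sum>i\<in>UNIV. LBINT x. (flux R i (t, x))\<^sup>2))"
    by (simp add: distrib_left sum_distrib_left)
  also have "\<dots> \<le> ft_const * (src_const * (1 + G t) * z2 t)" using s(5) ft_const_pos by (intro mult_left_mono) auto
  finally show "(LBINT \<xi>. src_power R (t, \<xi>)) \<le> ft_const * (src_const * (1 + G t) * z2 t)" .
qed

lemma div_H_integrable:
  assumes "integrable lborel (f :: real^'n \<Rightarrow> real)"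
  shows "integrable lborel (\<lambda>\<xi>. f \<xi> / (1 + (norm \<xi>)\<^sup>2))"
proof -
  have 1: "\<bar>1 / (1 + (norm \<xi>)\<^sup>2)\<bar> \<le> 1" for \<xi> :: "real^'n"
  proof -
    define a where "a = (norm \<xi>)\<^sup>2"
    have "0 \<le> a" by (simp add: a_def)
    then show ?thesis unfolding a_def[symmetric] by simp
  qed
  have 2: "(\<lambda>\<xi>::real^'n. 1 / (1 + (norm \<xi>)\<^sup>2)) \<in> borel_measurable lborel" by measurable
  have "integrable lborel (\<lambda>\<xi>. (1 / (1 + (norm \<xi>)\<^sup>2)) *\<^sub>R f \<xi>)"
    by (rule integrable_mult_bounded[OF assms 2 1])
  then show ?thesis by simp
qed

text \<open>
  The inequality of \<open>spectral_energy_bound\<close> integrated over all frequencies. For the second claim the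
  weight is \<open>l = 1 + G t\<close>, which leaves a bound that is integrable in time for fixed \<open>R\<close>. For the third one
  \<open>l\<close> is chosen so large that the source term costs only \<open>k\<close> times the squared \<open>L\<^sup>2\<close> norm of \<open>Z(t)\<close>.
\<close>

lemma good_En:
  assumes t: "good t" and R: "R \<ge> 1"
  shows "integrable lborel (\<lambda>\<xi>. En R (t, \<xi>))"
    and "(LBINT \<xi>. \<bar>En R (t, \<xi>)\<bar>) \<le> ft_const * ((2 + G t) * zR2 R t + (L\<^sup>2 + src_const) * z2 t)"
    and "k > 0 \<Longrightarrow> 2 * (LBINT \<xi>. En R (t, \<xi>)) \<le>
          - 2 * (ft_const * (\<alpha> * zR2 R t)) + (1 / k + src_const * (1 + G t) / k) * energy R t + ft_const * (k * (L\<^sup>2 + 1) * z2 t)"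
proof -
  note h = hat_L2[OF t, of R] and qq = src_power_L1[OF t R]
  have G1: "1 + G t > 0" using G0[of t] by simp
  let ?b = "\<lambda>\<xi>. (1 + (1 + G t)) * (norm (Zh R (t, \<xi>)))\<^sup>2 + (norm (Wh R (t, \<xi>)))\<^sup>2 + src_power R (t, \<xi>) / (1 + G t)"
  have ib: "integrable lborel ?b" using h qq by simp
  have le: "2 * \<bar>En R (t, \<xi>)\<bar> \<le> ?b \<xi>" for \<xi>
    using En_bound(2)[OF zero_less_one G1, of R "(t, \<xi>)"] by simp
  show i: "integrable lborel (\<lambda>\<xi>. En R (t, \<xi>))"
  proof (rule Bochner_Integration.integrable_bound[OF ib])
    have "norm (En R (t, \<xi>)) \<le> norm (?b \<xi>)" for \<xi> using le[of \<xi>] by simp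
    then show "AE \<xi> in lborel. norm (En R (t, \<xi>)) \<le> norm (?b \<xi>)" by simp
  qed measurable
  have "2 * (LBINT \<xi>. \<bar>En R (t, \<xi>)\<bar>) = (LBINT \<xi>. 2 * \<bar>En R (t, \<xi>)\<bar>)" by simp
  also have "\<dots> \<le> (LBINT \<xi>. ?b \<xi>)" using i ib le by (intro integral_mono) auto
  also have "\<dots> = (1 + (1 + G t)) * (LBINT \<xi>. (norm (Zh R (t, \<xi>)))\<^sup>2) + (LBINT \<xi>. (norm (Wh R (t, \<xi>)))\<^sup>2)
      + (LBINT \<xi>. src_power R (t, \<xi>)) / (1 + G t)" using h qq by simp
  also have "\<dots> \<le> (1 + (1 + G t)) * (ft_const * zR2 R t) + ft_const * (L\<^sup>2 * z2 t) + ft_const * (src_const * (1 + G t) * z2 t) / (1 + G t)"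
    using h(2,4) qq(2) G1 by (intro add_mono mult_left_mono divide_right_mono) auto
  also have "\<dots> = ft_const * ((2 + G t) * zR2 R t + (L\<^sup>2 + src_const) * z2 t)"
  proof -
    have "ft_const * (src_const * (1 + G t) * z2 t) / (1 + G t) = ft_const * (src_const * z2 t)" using G1 by simp
    then show ?thesis by (simp add: algebra_simps)
  qed
  finally show "(LBINT \<xi>. \<bar>En R (t, \<xi>)\<bar>) \<le> ft_const * ((2 + G t) * zR2 R t + (L\<^sup>2 + src_const) * z2 t)"
  proof -
    assume "2 * (LBINT \<xi>. \<bar>En R (t, \<xi>)\<bar>) \<le> ft_const * ((2 + G t) * zR2 R t + (L\<^sup>2 + src_const) * z2 t)"
    moreover have "0 \<le> (LBINT \<xi>. \<bar>En R (t, \<xi>)\<bar>)" by simp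
    ultimately show ?thesis by linarith
  qed
  assume k: "k > 0"
  let ?l = "src_const * (1 + G t) / k"
  have l: "?l > 0" using src_const_ge_1 G1 k by simp
  let ?e = "\<lambda>\<xi>. - 2 * Re (Zh R (t, \<xi>) * cnj (Wh R (t, \<xi>))) + (1 / k + ?l) * ((norm (Zh R (t, \<xi>)))\<^sup>2 / (1 + (norm \<xi>)\<^sup>2))
           + k * (norm (Wh R (t, \<xi>)))\<^sup>2 + src_power R (t, \<xi>) / ?l"
  note iA = div_H_integrable[OF h(1)]
  have ie: "integrable lborel ?e"
    by (intro Bochner_Integration.integrable_add integrable_mult_right integrable_divide iA h qq)
  have "2 * (LBINT \<xi>. En R (t, \<xi>)) = (LBINT \<xi>. 2 * En R (t, \<xi>))" by simp
  also have "\<dots> \<le> (LBINT \<xi>. ?e \<xi>)"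
    using i ie En_bound(1)[OF k l, of R "(t, _)"] by (intro integral_mono) auto
  also have "\<dots> = - 2 * (LBINT \<xi>. Re (Zh R (t, \<xi>) * cnj (Wh R (t, \<xi>)))) + (1 / k + ?l) * energy R t
      + k * (LBINT \<xi>. (norm (Wh R (t, \<xi>)))\<^sup>2) + (LBINT \<xi>. src_power R (t, \<xi>)) / ?l"
  proof -
    have lin: "(LBINT \<xi>. - 2 * r \<xi> + c * a \<xi> + k * w \<xi> + v \<xi> / l) =
        - 2 * (LBINT \<xi>. r \<xi>) + c * (LBINT \<xi>. a \<xi>) + k * (LBINT \<xi>. w \<xi>) + (LBINT \<xi>. v \<xi>) / l"
      if "integrable lborel r" "integrable lborel a" "integrable lborel w" "integrable lborel v"
      for r a w v :: "real^'n \<Rightarrow> real" and c l :: real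
      using that by simp
    show ?thesis unfolding energy_def by (rule lin) (intro iA h qq)+
  qed
  also have "\<dots> \<le> - 2 * (ft_const * (\<alpha> * zR2 R t)) + (1 / k + ?l) * energy R t + k * (ft_const * (L\<^sup>2 * z2 t)) + ft_const * (src_const * (1 + G t) * z2 t) / ?l"
    using h(4,6) qq(2) k l by (intro add_mono mult_left_mono divide_right_mono mult_left_mono_neg order_refl) auto
  also have "\<dots> = - 2 * (ft_const * (\<alpha> * zR2 R t)) + (1 / k + ?l) * energy R t + ft_const * (k * (L\<^sup>2 + 1) * z2 t)"
  proof -
    have "ft_const * (src_const * (1 + G t) * z2 t) / ?l = ft_const * (k * z2 t)" 
    proof -
      define c where "c = src_const * (1 + G t)"
      have "c > 0" using src_const_ge_1 G1 by (simp add: c_def)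
      then show ?thesis unfolding c_def[symmetric] using k by (simp add: field_simps)
    qed
    then show ?thesis by (simp add: algebra_simps)
  qed
  finally show "2 * (LBINT \<xi>. En R (t, \<xi>)) \<le>
          - 2 * (ft_const * (\<alpha> * zR2 R t)) + (1 / k + src_const * (1 + G t) / k) * energy R t + ft_const * (k * (L\<^sup>2 + 1) * z2 t)" .
qed

lemma Zh_sq_primitive:
  assumes R: "R \<ge> 1"
  shows "AE t in lborel. 0 < t \<and> t < T \<longrightarrow> (norm (Zh R (t, \<xi>)))\<^sup>2 / (1 + (norm \<xi>)\<^sup>2) = 2 * prim (\<lambda>s. En R (s, \<xi>)) t"
proof -
  let ?u = "\<lambda>s. Re (fh R (s, \<xi>))" and ?v = "\<lambda>s. Im (fh R (s, \<xi>))" and ?H = "1 + (norm \<xi>)\<^sup>2"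
  note h = hat_eq_prim[OF R, of \<xi>]
  note pu = prim_square[OF h(2)] and pv = prim_square[OF h(3)]
  have [measurable]: "?u \<in> borel_measurable borel" "?v \<in> borel_measurable borel"
    "(\<lambda>s. Re (Zh R (s, \<xi>))) \<in> borel_measurable borel" "(\<lambda>s. Im (Zh R (s, \<xi>))) \<in> borel_measurable borel" by measurable
  have au: "AE s in lborel. ?u s * prim ?u s = ?u s * Re (Zh R (s, \<xi>))"
    "AE s in lborel. ?v s * prim ?v s = ?v s * Im (Zh R (s, \<xi>))"
  proof -
    have "AE s in lborel. ?u s * prim ?u s = ?u s * Re (Zh R (s, \<xi>)) \<and> ?v s * prim ?v s = ?v s * Im (Zh R (s, \<xi>))"
      using h(1)
    proof eventually_elim
      case (elim s) then show ?case using hat_outside(2)[of s R \<xi>] by (cases "0 < s \<and> s < T") auto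
    qed
    then show "AE s in lborel. ?u s * prim ?u s = ?u s * Re (Zh R (s, \<xi>))"
      "AE s in lborel. ?v s * prim ?v s = ?v s * Im (Zh R (s, \<xi>))" by auto
  qed
  have iu: "integrable lborel (\<lambda>s. ?u s * Re (Zh R (s, \<xi>)))"
    by (rule integrable_cong_AE_imp[OF pu(1)]) (use au(1) in \<open>auto elim: eventually_mono\<close>)
  have iv: "integrable lborel (\<lambda>s. ?v s * Im (Zh R (s, \<xi>)))"
    by (rule integrable_cong_AE_imp[OF pv(1)]) (use au(2) in \<open>auto elim: eventually_mono\<close>)
  have eu: "prim (\<lambda>s. ?u s * prim ?u s) t = prim (\<lambda>s. ?u s * Re (Zh R (s, \<xi>))) t" for t
    unfolding prim_def[of _ t] by (rule integral_cong_AE) (use au(1) in \<open>auto elim: eventually_mono\<close>)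
  have ev: "prim (\<lambda>s. ?v s * prim ?v s) t = prim (\<lambda>s. ?v s * Im (Zh R (s, \<xi>))) t" for t
    unfolding prim_def[of _ t] by (rule integral_cong_AE) (use au(2) in \<open>auto elim: eventually_mono\<close>)
  have En': "En R (s, \<xi>) = (?u s * Re (Zh R (s, \<xi>)) + ?v s * Im (Zh R (s, \<xi>))) / ?H" for s
    by (simp add: En_def algebra_simps)
  have pE: "prim (\<lambda>s. En R (s, \<xi>)) t =
      (prim (\<lambda>s. ?u s * Re (Zh R (s, \<xi>))) t + prim (\<lambda>s. ?v s * Im (Zh R (s, \<xi>))) t) / ?H" for t
  proof -
    have lin: "prim (\<lambda>s. (a s + b s) / c) t = (prim a t + prim b t) / c"
      if "integrable lborel a" "integrable lborel b" for a b and c :: real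
    proof -
      have "prim (\<lambda>s. (a s + b s) / c) t = (LBINT s. (indicat_real {0<..<t} s * a s + indicat_real {0<..<t} s * b s) / c)"
        unfolding prim_def by (rule Bochner_Integration.integral_cong) (auto simp: distrib_left)
      also have "\<dots> = (prim a t + prim b t) / c"
        unfolding prim_def using integrable_indicat_mult[OF that(1)] integrable_indicat_mult[OF that(2)] by simp
      finally show ?thesis .
    qed
    show ?thesis unfolding En' by (rule lin[OF iu iv])
  qed
  show ?thesis
    using h(1)
  proof eventually_elim
    case (elim t)
    show ?case
    proof (intro impI)
      assume t: "0 < t \<and> t < T"
      have "(norm (Zh R (t, \<xi>)))\<^sup>2 = (prim ?u t)\<^sup>2 + (prim ?v t)\<^sup>2"
        using elim t by (simp add: cmod_power2)
      also have "\<dots> = 2 * (prim (\<lambda>s. ?u s * Re (Zh R (s, \<xi>))) t + prim (\<lambda>s. ?v s * Im (Zh R (s, \<xi>))) t)"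
        unfolding pu(2) pv(2) eu ev by simp
      finally show "(norm (Zh R (t, \<xi>)))\<^sup>2 / ?H = 2 * prim (\<lambda>s. En R (s, \<xi>)) t" unfolding pE by simp
    qed
  qed
qed

lemma zR2_le:
  assumes R: "R > 0"
  shows "zR2 R t \<le> M\<^sup>2 * measure lborel (cball (0::real^'n) R)"
proof -
  have cfin: "emeasure lborel (cball (0::real^'n) R) < \<infinity>" by (rule emeasure_lborel_cball_finite)
  have "zR2 R t \<le> (LBINT x. M\<^sup>2 * indicat_real (cball (0::real^'n) R) x)"
    unfolding zR2_def
  proof (rule integral_mono')
    show "integrable lborel (\<lambda>x. M\<^sup>2 * indicat_real (cball (0::real^'n) R) x)"
      using cfin by (simp add: integrable_indicator_iff)
    fix x
    have "(cutZ R (t, x))\<^sup>2 \<le> M\<^sup>2" using cutZ_le(1)[of R "(t, x)"] Zb[of "(t, x)"] by (intro abs_sq_le) linarith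
    then show "(cutZ R (t, x))\<^sup>2 \<le> M\<^sup>2 * indicat_real (cball 0 R) x"
      using cutZ_outside[OF R, of x t] by (auto simp: indicator_def)
  qed simp
  then show ?thesis using cfin by simp
qed

lemma zR2_measurable[measurable]: "zR2 R \<in> borel_measurable borel"
  unfolding zR2_def[abs_def] using borel_measurable_integral_param[of "\<lambda>z. (cutZ R z)\<^sup>2"] by simp

lemma zR2_outside: "t \<le> 0 \<or> T \<le> t \<Longrightarrow> zR2 R t = 0"
  using suppZ[of t] by (simp add: zR2_def cutZ_def)

lemma zR2_nonneg: "0 \<le> zR2 R t" by (simp add: zR2_def)

lemma weight_zR2_integrable:
  assumes R: "R > 0"
  shows "integrable lborel (\<lambda>t. zR2 R t)" "integrable lborel (\<lambda>t. G t * zR2 R t)"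
proof -
  let ?K = "M\<^sup>2 * measure lborel (cball (0::real^'n) R)"
  show "integrable lborel (\<lambda>t. zR2 R t)"
  proof (rule Bochner_Integration.integrable_bound)
    show "integrable lborel (\<lambda>t. ?K * indicat_real {0<..<T} t)" by (intro integrable_mult_right integrable_indicat_Ioo)
    have "norm (zR2 R t) \<le> norm (?K * indicat_real {0<..<T} t)" for t
      using zR2_le[OF R, of t] zR2_nonneg[of R t] zR2_outside[of t R] by (cases "0 < t \<and> t < T") (auto simp: not_less)
    then show "AE t in lborel. norm (zR2 R t) \<le> norm (?K * indicat_real {0<..<T} t)" by simp
  qed measurable
  show "integrable lborel (\<lambda>t. G t * zR2 R t)"
    using integrable_mult_bounded[OF Gi, of "zR2 R" ?K] zR2_le[OF R] zR2_nonneg by (simp add: mult.commute)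
qed

text \<open>
  The truncation is essential here: \<open>G(t)\<close> times the squared \<open>L\<^sup>2\<close> norm of \<open>\<chi> Z(t)\<close> is integrable in time
  because that norm is bounded for bounded \<open>Z\<close> and compactly supported \<open>\<chi>\<close>.
\<close>

lemma En_integrable:
  assumes R: "R \<ge> 1"
  shows "integrable lborel (En R)"
proof -
  have R0: "R > 0" using R by simp
  have "integrable (lborel \<Otimes>\<^sub>M lborel) (En R)"
  proof (rule lborel_pair.Fubini_integrable)
    show "En R \<in> borel_measurable (lborel \<Otimes>\<^sub>M lborel)" unfolding lborel_prod by measurable
    show "AE t in lborel. integrable lborel (\<lambda>\<xi>. En R (t, \<xi>))"
      using AE_good by eventually_elim (rule good_En(1)[OF _ R])
    show "integrable lborel (\<lambda>t. LBINT \<xi>. norm (En R (t, \<xi>)))"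
    proof (rule Bochner_Integration.integrable_bound)
      let ?w = "\<lambda>t. ft_const * ((2 * zR2 R t + G t * zR2 R t) + (L\<^sup>2 + src_const) * z2 t)"
      show "integrable lborel ?w"
        by (intro integrable_mult_right Bochner_Integration.integrable_add z2i weight_zR2_integrable[OF R0])
      show "(\<lambda>t. LBINT \<xi>. norm (En R (t, \<xi>))) \<in> borel_measurable lborel"
        using borel_measurable_integral_param[of "\<lambda>p. norm (En R p)"] by simp
      show "AE t in lborel. norm (LBINT \<xi>. norm (En R (t, \<xi>))) \<le> norm (?w t)"
        using AE_good
      proof eventually_elim
        case (elim t)
        have "(LBINT \<xi>. \<bar>En R (t, \<xi>)\<bar>) \<le> ?w t" using good_En(2)[OF elim R] by (simp add: distrib_right)
        then show ?case by (auto intro: order_trans[OF _ abs_ge_self])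
      qed
    qed
  qed
  then show ?thesis by (simp add: lborel_prod)
qed

text \<open>
  The balance holds for each frequency at almost every time. Exchanging the quantifiers gives, for
  almost every time, the balance at almost every frequency, and this may be integrated.
\<close>

lemma energy_primitive:
  assumes R: "R \<ge> 1"
  shows "AE t in lborel. 0 < t \<and> t < T \<longrightarrow> energy R t = 2 * prim (\<lambda>s. LBINT \<xi>. En R (s, \<xi>)) t"
proof -
  let ?P = "\<lambda>\<xi> t. 0 < t \<and> t < T \<longrightarrow> (norm (Zh R (t, \<xi>)))\<^sup>2 / (1 + (norm \<xi>)\<^sup>2) = 2 * prim (\<lambda>s. En R (s, \<xi>)) t"
  have mp: "(\<lambda>p::(real^'n) \<times> real. prim (\<lambda>s. En R (s, fst p)) (snd p)) \<in> borel_measurable borel"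
  proof -
    have "(\<lambda>p::(real^'n) \<times> real. LBINT s. indicat_real {0<..<snd p} s * En R (s, fst p)) \<in> borel_measurable lborel"
    proof (rule lborel.borel_measurable_lebesgue_integral)
      have "(\<lambda>w::((real^'n) \<times> real) \<times> real. (if 0 < snd w \<and> snd w < snd (fst w) then 1 else 0) * En R (snd w, fst (fst w))) \<in> borel_measurable borel"
        by measurable
      moreover have "(\<lambda>(p, s). indicat_real {0<..<snd p} s * En R (s, fst p)) =
         (\<lambda>w::((real^'n) \<times> real) \<times> real. (if 0 < snd w \<and> snd w < snd (fst w) then 1 else 0) * En R (snd w, fst (fst w)))"
        by (auto simp: fun_eq_iff indicator_def)
      ultimately show "(\<lambda>(p, s). indicat_real {0<..<snd p} s * En R (s, fst p)) \<in> borel_measurable (lborel \<Otimes>\<^sub>M lborel)"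
        by (simp add: lborel_prod)
    qed
    then show ?thesis by (simp add: prim_def)
  qed
  note [measurable] = mp
  have set: "{x \<in> space (lborel \<Otimes>\<^sub>M lborel). ?P (fst x) (snd x)} \<in> sets (lborel \<Otimes>\<^sub>M lborel :: ((real^'n) \<times> real) measure)"
    unfolding lborel_prod by measurable
  have "AE \<xi> in lborel. AE t in lborel. ?P \<xi> t" using Zh_sq_primitive[OF R] by simp
  then have ae: "AE t in lborel. AE \<xi> in lborel. ?P \<xi> t" unfolding lborel_pair.AE_commute[OF set] .
  show ?thesis
    using ae
  proof eventually_elim
    case (elim t)
    show ?case
    proof (intro impI)
      assume t: "0 < t \<and> t < T"
      have m2: "(\<lambda>\<xi>. prim (\<lambda>s. En R (s, \<xi>)) t) \<in> borel_measurable borel"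
        using measurable_compose[OF _ mp, of "\<lambda>\<xi>. (\<xi>, t)" borel] by simp
      have "energy R t = (LBINT \<xi>. 2 * prim (\<lambda>s. En R (s, \<xi>)) t)"
        unfolding energy_def by (rule integral_cong_AE) (use elim t m2 in \<open>auto elim: eventually_mono\<close>)
      also have "\<dots> = 2 * (LBINT \<xi>. LBINT s. indicat_real {0<..<t} s * En R (s, \<xi>))" by (simp add: prim_def)
      also have "(LBINT \<xi>. LBINT s. indicat_real {0<..<t} s * En R (s, \<xi>)) =
                 (LBINT s. LBINT \<xi>. indicat_real {0<..<t} s * En R (s, \<xi>))"
      proof (rule lborel_pair.Fubini_integral)
        have "integrable lborel (\<lambda>p. indicat_real {0<..<t} (fst p) *\<^sub>R En R p)"
        proof (rule integrable_mult_bounded[OF En_integrable[OF R]])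
          show "\<bar>indicat_real {0<..<t} (fst p)\<bar> \<le> 1" for p :: "real \<times> (real^'n)" by (simp add: indicator_def)
        qed measurable
        then show "integrable (lborel \<Otimes>\<^sub>M lborel) (\<lambda>(s, \<xi>). indicat_real {0<..<t} s * En R (s, \<xi>))"
          unfolding lborel_prod by (simp add: split_beta')
      qed
      also have "\<dots> = prim (\<lambda>s. LBINT \<xi>. En R (s, \<xi>)) t" by (simp add: prim_def)
      finally show "energy R t = 2 * prim (\<lambda>s. LBINT \<xi>. En R (s, \<xi>)) t" .
    qed
  qed
qed

text \<open>
  With this choice the terms weighted by \<open>kappa\<close> amount to \<open>\<alpha>\<close> times the squared \<open>L\<^sup>2\<close> norm of \<open>Z(t)\<close>; the
  coercive term provides twice that amount for \<open>\<chi> Z\<close>, and \<open>eps R\<close> accounts for the mismatch between \<open>Z\<close> and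
  \<open>\<chi> Z\<close>.
\<close>

definition kappa :: real where "kappa = \<alpha> / (L\<^sup>2 + 1)"
definition mu :: "real \<Rightarrow> real" where "mu t = indicat_real {0<..<T} t * (1 / kappa) + src_const * (indicat_real {0<..<T} t + G t) / kappa"
definition eps :: "real \<Rightarrow> real" where "eps R = ft_const * \<alpha> * (LBINT t. z2 t - zR2 R t)"

lemma kappa: "kappa > 0" "kappa * (L\<^sup>2 + 1) = \<alpha>"
proof -
  have "L\<^sup>2 + 1 > 0" by (rule add_nonneg_pos) auto
  then show "kappa > 0" "kappa * (L\<^sup>2 + 1) = \<alpha>" using \<alpha> by (simp_all add: kappa_def)
qed

lemma mu: "integrable lborel mu" "0 \<le> mu t"
proof -
  show "integrable lborel mu" unfolding mu_def[abs_def]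
    by (intro Bochner_Integration.integrable_add integrable_divide integrable_mult_left integrable_mult_right integrable_indicat_Ioo Gi)
  show "0 \<le> mu t" unfolding mu_def using kappa(1) src_const_ge_1 G0[of t] by simp
qed

lemma energy_nonneg: "0 \<le> energy R t" by (simp add: energy_def)

lemma energy_le: "good t \<Longrightarrow> energy R t \<le> ft_const * zR2 R t"
proof -
  assume t: "good t"
  note h = hat_L2[OF t, of R]
  have "energy R t \<le> (LBINT \<xi>. (norm (Zh R (t, \<xi>)))\<^sup>2)"
    unfolding energy_def
  proof (rule integral_mono[OF div_H_integrable[OF h(1)] h(1)])
    fix \<xi> :: "real^'n"
    define a where "a = (norm \<xi>)\<^sup>2"
    have "0 \<le> a" by (simp add: a_def)
    then show "(norm (Zh R (t, \<xi>)))\<^sup>2 / (1 + (norm \<xi>)\<^sup>2) \<le> (norm (Zh R (t, \<xi>)))\<^sup>2"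
      unfolding a_def[symmetric] by (simp add: divide_le_eq mult_le_cancel_left1)
  qed
  with h(2) show ?thesis by simp
qed

lemma zR2_le_z2: "good t \<Longrightarrow> zR2 R t \<le> z2 t"
  unfolding zR2_def z2_def by (intro integral_mono good_cut good_Z2) (auto simp: cutZ2_le)

lemma mu_energy_integrable:
  assumes R: "R \<ge> 1"
  shows "integrable lborel (\<lambda>t. mu t * energy R t)"
proof (rule Bochner_Integration.integrable_bound)
  let ?K = "ft_const * (M\<^sup>2 * measure lborel (cball (0::real^'n) R))"
  have R0: "R > 0" using R by simp
  show "integrable lborel (\<lambda>t. mu t * ?K)" by (intro integrable_mult_left mu)
  show "(\<lambda>t. mu t * energy R t) \<in> borel_measurable lborel" using mu(1) by measurable
  show "AE t in lborel. norm (mu t * energy R t) \<le> norm (mu t * ?K)"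
    using AE_good
  proof eventually_elim
    case (elim t)
    have "energy R t \<le> ?K"
      by (rule order_trans[OF energy_le[OF elim] mult_left_mono[OF zR2_le[OF R0] less_imp_le[OF ft_const_pos]]])
    then have "mu t * energy R t \<le> mu t * ?K" by (intro mult_left_mono mu)
    then show ?case using mu(2)[of t] energy_nonneg[of R t] by (simp add: order_trans[OF _ abs_ge_self])
  qed
qed

lemma energy_inequality:
  assumes R: "R \<ge> 1"
  shows "AE t in lborel. 0 < t \<and> t < T \<longrightarrow> energy R t \<le> eps R + prim (\<lambda>s. mu s * energy R s) t"
proof -
  have R0: "R > 0" using R by simp
  let ?E = "\<lambda>s. LBINT \<xi>. En R (s, \<xi>)" and ?d = "\<lambda>s. ft_const * \<alpha> * (z2 s - zR2 R s)"
  have iE: "integrable lborel ?E"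
    using lborel_pair.integrable_fst'[of "En R"] En_integrable[OF R] by (simp add: lborel_prod)
  have id: "integrable lborel ?d" using z2i weight_zR2_integrable(1)[OF R0] by simp
  have pw: "AE s in lborel. 0 < s \<and> s < T \<longrightarrow> 2 * ?E s \<le> mu s * energy R s + ?d s"
    using AE_good
  proof eventually_elim
    case (elim s)
    show ?case
    proof (intro impI)
      assume s: "0 < s \<and> s < T"
      have "2 * ?E s \<le> - 2 * (ft_const * (\<alpha> * zR2 R s)) + (1 / kappa + src_const * (1 + G s) / kappa) * energy R s + ft_const * (kappa * (L\<^sup>2 + 1) * z2 s)"
        by (rule good_En(3)[OF elim R kappa(1)])
      also have "(1 / kappa + src_const * (1 + G s) / kappa) = mu s" using s by (simp add: mu_def)
      also have "- 2 * (ft_const * (\<alpha> * zR2 R s)) + mu s * energy R s + ft_const * (kappa * (L\<^sup>2 + 1) * z2 s) =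
          mu s * energy R s + ?d s - ft_const * (\<alpha> * zR2 R s)" unfolding kappa(2) by (simp add: algebra_simps)
      also have "\<dots> \<le> mu s * energy R s + ?d s" using ft_const_pos \<alpha> zR2_nonneg[of R s] by simp
      finally show "2 * ?E s \<le> mu s * energy R s + ?d s" .
    qed
  qed
  have d0: "AE s in lborel. 0 \<le> ?d s"
    using AE_good by eventually_elim (use ft_const_pos \<alpha> zR2_le_z2 in simp)
  show ?thesis
    using energy_primitive[OF R]
  proof eventually_elim
    case (elim t)
    show ?case
    proof (intro impI)
      assume t: "0 < t \<and> t < T"
      have "energy R t = (LBINT s. indicat_real {0<..<t} s * (2 * ?E s))"
        using elim t by (simp add: prim_def mult.left_commute)
      also have "\<dots> \<le> (LBINT s. indicat_real {0<..<t} s * (mu s * energy R s) + ?d s)"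
      proof (rule integral_mono_AE)
        show "integrable lborel (\<lambda>s. indicat_real {0<..<t} s * (2 * ?E s))"
          using iE by (intro integrable_indicat_mult integrable_mult_right) auto
        show "integrable lborel (\<lambda>s. indicat_real {0<..<t} s * (mu s * energy R s) + ?d s)"
          by (intro Bochner_Integration.integrable_add integrable_indicat_mult mu_energy_integrable[OF R] id) auto
        show "AE s in lborel. indicat_real {0<..<t} s * (2 * ?E s) \<le> indicat_real {0<..<t} s * (mu s * energy R s) + ?d s"
          using pw d0
        proof eventually_elim
          case (elim s) then show ?case using t by (cases "0 < s \<and> s < t") (auto simp: indicator_def)
        qed
      qed
      also have "\<dots> = prim (\<lambda>s. mu s * energy R s) t + (LBINT s. ?d s)"
        unfolding prim_def by (rule Bochner_Integration.integral_add[OF integrable_indicat_mult[OF mu_energy_integrable[OF R]] id]) simp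
      finally show "energy R t \<le> eps R + prim (\<lambda>s. mu s * energy R s) t" by (simp add: eps_def)
    qed
  qed
qed

lemma AE_zR2_tendsto:
  assumes t: "good t"
  shows "(\<lambda>n. zR2 (real (Suc n)) t) \<longlonglongrightarrow> z2 t"
  unfolding zR2_def z2_def
proof (rule integral_dominated_convergence[where w="\<lambda>x. (Z (t, x))\<^sup>2"])
  show "AE x in lborel. (\<lambda>n. (cutZ (real (Suc n)) (t, x))\<^sup>2) \<longlonglongrightarrow> (Z (t, x))\<^sup>2"
  proof (intro AE_I2)
    fix x
    have "(\<lambda>n. (cut (real (Suc n)) x * Z (t, x))\<^sup>2) \<longlonglongrightarrow> (1 * Z (t, x))\<^sup>2"
      by (intro tendsto_intros cut_tendsto)
    then show "(\<lambda>n. (cutZ (real (Suc n)) (t, x))\<^sup>2) \<longlonglongrightarrow> (Z (t, x))\<^sup>2" by (simp add: cutZ_def)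
  qed
qed (use good_Z2[OF t] in \<open>auto simp: cutZ2_le\<close>)

lemma eps_tendsto: "(\<lambda>n. eps (real (Suc n))) \<longlonglongrightarrow> 0"
proof -
  have "(\<lambda>n. LBINT t. z2 t - zR2 (real (Suc n)) t) \<longlonglongrightarrow> (LBINT t::real. 0)"
  proof (rule integral_dominated_convergence[OF _ _ z2i])
    show "AE t in lborel. (\<lambda>n. z2 t - zR2 (real (Suc n)) t) \<longlonglongrightarrow> 0"
      using AE_good
    proof eventually_elim
      case (elim t)
      have "(\<lambda>n. z2 t - zR2 (real (Suc n)) t) \<longlonglongrightarrow> z2 t - z2 t" by (intro tendsto_intros AE_zR2_tendsto[OF elim])
      then show ?case by simp
    qed
    show "AE t in lborel. norm (z2 t - zR2 (real (Suc n)) t) \<le> z2 t" for n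
      using AE_good
    proof eventually_elim
      case (elim t) then show ?case using zR2_le_z2[OF elim, of "real (Suc n)"] zR2_nonneg[of "real (Suc n)" t] by simp
    qed
  qed measurable
  from tendsto_mult[OF tendsto_const[of "ft_const * \<alpha>"] this] show ?thesis by (simp add: eps_def)
qed

lemma eps_nonneg: "0 \<le> eps R"
proof -
  have "0 \<le> (LBINT t. z2 t - zR2 R t)"
    by (rule integral_nonneg_AE) (use AE_good zR2_le_z2 in \<open>auto elim!: eventually_mono\<close>)
  then show ?thesis unfolding eps_def using ft_const_pos \<alpha> by simp
qed

text \<open>
  Gronwall bounds the energy of the truncations by a multiple of \<open>eps R\<close>, which tends to zero. By
  Fatou's lemma the untruncated energy is zero, so the transform of \<open>Z(t)\<close> vanishes almost everywhere, and
  Plancherel's identity gives \<open>Z(t) = 0\<close>.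
\<close>

lemma difference_vanishes: "AE z in lborel. Z z = 0"
proof -
  obtain C where C: "C \<ge> 0" "\<And>y \<epsilon>. 0 \<le> \<epsilon> \<Longrightarrow> (\<And>s. 0 \<le> y s) \<Longrightarrow> integrable lborel (\<lambda>s. mu s * y s) \<Longrightarrow>
           (AE t in lborel. 0 < t \<and> t < T \<longrightarrow> y t \<le> \<epsilon> + prim (\<lambda>s. mu s * y s) t) \<Longrightarrow>
           (AE t in lborel. 0 < t \<and> t < T \<longrightarrow> y t \<le> C * \<epsilon>)"
    using gronwall_L1[OF mu T] by blast
  have "AE t in lborel. 0 < t \<and> t < T \<longrightarrow> energy (real (Suc n)) t \<le> C * eps (real (Suc n))" for n
    by (rule C(2)[OF eps_nonneg energy_nonneg mu_energy_integrable energy_inequality]) simp_all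
  then have all: "AE t in lborel. \<forall>n. 0 < t \<and> t < T \<longrightarrow> energy (real (Suc n)) t \<le> C * eps (real (Suc n))"
    unfolding AE_all_countable by blast
  have zero: "AE t in lborel. z2 t = 0"
    using all AE_good
  proof eventually_elim
    case (elim t)
    show ?case
    proof (cases "0 < t \<and> t < T")
      case False
      then have "Z (t, x) = 0" for x using suppZ[of t x] by auto
      then show ?thesis by (simp add: z2_def)
    next
      case True
      have l: "(\<lambda>n. C * eps (real (Suc n))) \<longlonglongrightarrow> 0"
        using tendsto_mult[OF tendsto_const[of C] eps_tendsto] by simp
      have Al: "(\<lambda>n. energy (real (Suc n)) t) \<longlonglongrightarrow> 0"
      proof (rule tendsto_sandwich[OF _ _ tendsto_const l])
        show "\<forall>\<^sub>F n in sequentially. 0 \<le> energy (real (Suc n)) t" by (intro always_eventually allI energy_nonneg)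
        show "\<forall>\<^sub>F n in sequentially. energy (real (Suc n)) t \<le> C * eps (real (Suc n))"
          using elim(1) True by (intro always_eventually allI) blast
      qed
      let ?z = "ft (\<lambda>x. Z (t, x))" and ?H = "\<lambda>\<xi>::real^'n. 1 + (norm \<xi>)\<^sup>2"
      have Hpos: "0 < ?H \<xi>" for \<xi> by (rule add_pos_nonneg) auto
      have Zt: "integrable lborel (\<lambda>x. Z (t, x))" using elim(2) by (simp add: good_def)
      have lim: "(\<lambda>n. Zh (real (Suc n)) (t, \<xi>)) \<longlonglongrightarrow> ?z \<xi>" for \<xi>
        unfolding Zh_def ft_def fst_conv snd_conv
      proof (rule integral_dominated_convergence[where w="\<lambda>x. \<bar>Z (t, x)\<bar>"])
        show "AE x in lborel. (\<lambda>n. cutZ (real (Suc n)) (t, x) *\<^sub>R cis (\<xi> \<bullet> x)) \<longlonglongrightarrow> Z (t, x) *\<^sub>R cis (\<xi> \<bullet> x)"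
        proof (intro AE_I2)
          fix x
          have "(\<lambda>n. (cut (real (Suc n)) x * Z (t, x)) *\<^sub>R cis (\<xi> \<bullet> x)) \<longlonglongrightarrow> (1 * Z (t, x)) *\<^sub>R cis (\<xi> \<bullet> x)"
            by (intro tendsto_intros cut_tendsto)
          then show "(\<lambda>n. cutZ (real (Suc n)) (t, x) *\<^sub>R cis (\<xi> \<bullet> x)) \<longlonglongrightarrow> Z (t, x) *\<^sub>R cis (\<xi> \<bullet> x)"
            by (simp add: cutZ_def)
        qed
        show "AE x in lborel. norm (cutZ (real (Suc n)) (t, x) *\<^sub>R cis (\<xi> \<bullet> x)) \<le> \<bar>Z (t, x)\<bar>" for n
          by (intro AE_I2) (simp add: cutZ_le)
        show "integrable lborel (\<lambda>x. \<bar>Z (t, x)\<bar>)" using Zt by (rule integrable_abs)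
      qed measurable
      have "(\<integral>\<^sup>+\<xi>. ennreal ((norm (?z \<xi>))\<^sup>2 / ?H \<xi>) \<partial>lborel) =
          (\<integral>\<^sup>+\<xi>. liminf (\<lambda>n. ennreal ((norm (Zh (real (Suc n)) (t, \<xi>)))\<^sup>2 / ?H \<xi>)) \<partial>lborel)"
      proof (rule nn_integral_cong)
        fix \<xi> :: "real^'n"
        have "(\<lambda>n. (norm (Zh (real (Suc n)) (t, \<xi>)))\<^sup>2 / ?H \<xi>) \<longlonglongrightarrow> (norm (?z \<xi>))\<^sup>2 / ?H \<xi>"
          using Hpos[of \<xi>] by (intro tendsto_intros lim) simp
        from lim_imp_Liminf[OF sequentially_bot tendsto_ennrealI[OF this]]
        show "ennreal ((norm (?z \<xi>))\<^sup>2 / ?H \<xi>) = liminf (\<lambda>n. ennreal ((norm (Zh (real (Suc n)) (t, \<xi>)))\<^sup>2 / ?H \<xi>))" by simp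
      qed
      also have "\<dots> \<le> liminf (\<lambda>n. \<integral>\<^sup>+\<xi>. ennreal ((norm (Zh (real (Suc n)) (t, \<xi>)))\<^sup>2 / ?H \<xi>) \<partial>lborel)"
        by (rule nn_integral_liminf) measurable
      also have "(\<lambda>n. \<integral>\<^sup>+\<xi>. ennreal ((norm (Zh (real (Suc n)) (t, \<xi>)))\<^sup>2 / ?H \<xi>) \<partial>lborel) = (\<lambda>n. ennreal (energy (real (Suc n)) t))"
        unfolding energy_def
        by (intro ext nn_integral_eq_integral div_H_integrable hat_L2(1)[OF elim(2)]) (simp add: Hpos less_imp_le)
      also have "liminf (\<lambda>n. ennreal (energy (real (Suc n)) t)) = 0"
        using lim_imp_Liminf[OF sequentially_bot tendsto_ennrealI[OF Al]] by simp
      finally have "(\<integral>\<^sup>+\<xi>. ennreal ((norm (?z \<xi>))\<^sup>2 / ?H \<xi>) \<partial>lborel) = 0" by simp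
      then have "AE \<xi> in lborel. ennreal ((norm (?z \<xi>))\<^sup>2 / ?H \<xi>) = 0"
        by (subst (asm) nn_integral_0_iff_AE) auto
      then have z0: "AE \<xi> in lborel. ?z \<xi> = 0"
      proof eventually_elim
        case (elim \<xi>)
        then have "(norm (?z \<xi>))\<^sup>2 / ?H \<xi> \<le> 0" by (simp only: ennreal_eq_0_iff)
        then show ?case using Hpos[of \<xi>] by (simp add: divide_le_0_iff not_le)
      qed
      have "ft_const * z2 t = (LBINT \<xi>. Re (?z \<xi> * cnj (?z \<xi>)))"
        using ft_plancherel(2)[OF Zt good_Z2[OF elim(2)] Zb Zt good_Z2[OF elim(2)]]
        by (simp add: ft_const_def z2_def power2_eq_square)
      also have "\<dots> = (LINT \<xi>::real^'n|lborel. 0)"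
        by (rule integral_cong_AE) (use z0 in \<open>auto elim!: eventually_mono\<close>)
      finally show "z2 t = 0" using ft_const_pos by simp
    qed
  qed
  have "(LBINT z. (Z z)\<^sup>2) = (LBINT t. z2 t)"
    using lborel_pair.integral_fst'[of "\<lambda>z. (Z z)\<^sup>2"] Z2i by (simp add: lborel_prod z2_def)
  also have "\<dots> = (LBINT t::real. 0)" by (rule integral_cong_AE) (use zero in auto)
  finally have "AE z in lborel. (Z z)\<^sup>2 = 0"
    using integral_nonneg_eq_0_iff_AE[OF Z2i] by simp
  then show ?thesis by eventually_elim simp
qed

end

section \<open>Convolution with the interaction kernel\<close>

lemma cauchy_schwarz_integral:
  fixes f g :: "'a \<Rightarrow> real"
  assumes [measurable]: "f \<in> borel_measurable M" "g \<in> borel_measurable M"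
    and f: "integrable M (\<lambda>x. (f x)\<^sup>2)" and g: "integrable M (\<lambda>x. (g x)\<^sup>2)"
  shows "(LINT x|M. \<bar>f x * g x\<bar>)\<^sup>2 \<le> (LINT x|M. (f x)\<^sup>2) * (LINT x|M. (g x)\<^sup>2)"
proof -
  have fg: "integrable M (\<lambda>x. \<bar>f x * g x\<bar>)" by (intro integrable_abs integrable_mult_L2 f g) auto
  have "(\<integral>\<^sup>+x. ennreal \<bar>f x\<bar> * ennreal \<bar>g x\<bar> \<partial>M)\<^sup>2 \<le> (\<integral>\<^sup>+x. (ennreal \<bar>f x\<bar>)\<^sup>2 \<partial>M) * (\<integral>\<^sup>+x. (ennreal \<bar>g x\<bar>)\<^sup>2 \<partial>M)"
    by (rule Cauchy_Schwarz_nn_integral) auto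
  moreover have "(\<integral>\<^sup>+x. ennreal \<bar>f x\<bar> * ennreal \<bar>g x\<bar> \<partial>M) = ennreal (LINT x|M. \<bar>f x * g x\<bar>)"
    using nn_integral_eq_integral[OF fg] by (simp add: abs_mult ennreal_mult)
  moreover have "(\<integral>\<^sup>+x. (ennreal \<bar>f x\<bar>)\<^sup>2 \<partial>M) = ennreal (LINT x|M. (f x)\<^sup>2)"
    using nn_integral_eq_integral[OF f] by (simp add: ennreal_power)
  moreover have "(\<integral>\<^sup>+x. (ennreal \<bar>g x\<bar>)\<^sup>2 \<partial>M) = ennreal (LINT x|M. (g x)\<^sup>2)"
    using nn_integral_eq_integral[OF g] by (simp add: ennreal_power)
  ultimately have "ennreal ((LINT x|M. \<bar>f x * g x\<bar>)\<^sup>2) \<le> ennreal ((LINT x|M. (f x)\<^sup>2) * (LINT x|M. (g x)\<^sup>2))"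
    by (simp add: ennreal_power ennreal_mult)
  then show ?thesis by (simp add: ennreal_le_iff)
qed

text \<open>
  The parts of the kernel near and away from the origin enter the estimates only through two scalar
  majorants, one in \<open>L\<^sup>1\<close> and one in \<open>L\<^sup>2\<close>.
\<close>

locale split_kernel =
  fixes K :: "'a::euclidean_space \<Rightarrow> 'a" and \<kappa>1 \<kappa>2 :: "'a \<Rightarrow> real"
  assumes measK[measurable]: "K \<in> borel_measurable borel"
    and meas1[measurable]: "\<kappa>1 \<in> borel_measurable borel" and meas2[measurable]: "\<kappa>2 \<in> borel_measurable borel"
    and K_le: "\<And>y. norm (K y) \<le> \<kappa>1 y + \<kappa>2 y" and nonneg: "\<And>y. 0 \<le> \<kappa>1 y" "\<And>y. 0 \<le> \<kappa>2 y"
    and int1: "integrable lborel \<kappa>1" and int2: "integrable lborel (\<lambda>y. (\<kappa>2 y)\<^sup>2)"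
begin

definition conv :: "('a \<Rightarrow> real) \<Rightarrow> 'a \<Rightarrow> 'a" where "conv v x = (LBINT y. v y *\<^sub>R K (x - y))"
definition c1 :: real where "c1 = (LBINT y. \<kappa>1 y)"
definition c2 :: real where "c2 = (LBINT y. (\<kappa>2 y)\<^sup>2)"

lemma c_nonneg: "0 \<le> c1" "0 \<le> c2" using nonneg by (simp_all add: c1_def c2_def)

lemma bounded_L1_L2:
  fixes v :: "'a \<Rightarrow> real"
  assumes "integrable lborel v" "\<And>x. \<bar>v x\<bar> \<le> M"
  shows "integrable lborel (\<lambda>x. (v x)\<^sup>2)" "(LBINT x. (v x)\<^sup>2) \<le> M * (LBINT x. \<bar>v x\<bar>)"
proof -
  show i: "integrable lborel (\<lambda>x. (v x)\<^sup>2)"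
    using integrable_mult_bounded[OF assms(1), of v M] assms by (simp add: power2_eq_square)
  have "(LBINT x. (v x)\<^sup>2) \<le> (LBINT x. M * \<bar>v x\<bar>)"
  proof (rule integral_mono[OF i])
    show "(v x)\<^sup>2 \<le> M * \<bar>v x\<bar>" for x
      using mult_right_mono[OF assms(2)[of x] abs_ge_zero[of "v x"]] by (simp add: power2_eq_square abs_mult_self_eq)
  qed (use assms(1) in simp)
  then show "(LBINT x. (v x)\<^sup>2) \<le> M * (LBINT x. \<bar>v x\<bar>)" by simp
qed

context
  fixes v :: "'a \<Rightarrow> real" and M :: real
  assumes v: "integrable lborel v" and vb: "\<And>x. \<bar>v x\<bar> \<le> M"
begin

lemma v_meas[measurable]: "v \<in> borel_measurable borel" using v by simp

lemma v2: "integrable lborel (\<lambda>x. (v x)\<^sup>2)" by (rule bounded_L1_L2[OF v vb])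

lemma near_integrable: "integrable lborel (\<lambda>y. \<kappa>1 y * \<bar>v (x - y)\<bar>)"
proof -
  have "integrable lborel (\<lambda>y. \<bar>v (x - y)\<bar> *\<^sub>R \<kappa>1 y)"
    by (rule integrable_mult_bounded[OF int1, of _ M]) (use vb in auto)
  then show ?thesis by (simp add: mult.commute)
qed

lemma far_integrable: "integrable lborel (\<lambda>y. \<kappa>2 y * \<bar>v (x - y)\<bar>)"
proof (rule integrable_mult_L2[OF _ _ int2])
  show "integrable lborel (\<lambda>y. \<bar>v (x - y)\<bar>\<^sup>2)"
    using integrable_lborel_translate_reflect(2)[OF v2, of x] by simp
qed measurable

lemma conv_integrable: "integrable lborel (\<lambda>y. v y *\<^sub>R K (x - y))"
proof -
  have "integrable lborel (\<lambda>y. v (x - y) *\<^sub>R K y)"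
  proof (rule Bochner_Integration.integrable_bound)
    show "integrable lborel (\<lambda>y. \<kappa>1 y * \<bar>v (x - y)\<bar> + \<kappa>2 y * \<bar>v (x - y)\<bar>)"
      by (intro Bochner_Integration.integrable_add near_integrable far_integrable)
    have "norm (v (x - y) *\<^sub>R K y) \<le> norm (\<kappa>1 y * \<bar>v (x - y)\<bar> + \<kappa>2 y * \<bar>v (x - y)\<bar>)" for y
      using mult_left_mono[OF K_le[of y], of "\<bar>v (x - y)\<bar>"] nonneg[of y]
      by (simp add: distrib_left mult.commute)
    then show "AE y in lborel. norm (v (x - y) *\<^sub>R K y) \<le> norm (\<kappa>1 y * \<bar>v (x - y)\<bar> + \<kappa>2 y * \<bar>v (x - y)\<bar>)" by simp
  qed measurable
  from integrable_lborel_translate_reflect(2)[OF this, of x] show ?thesis by simp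
qed

lemma conv_alt: "conv v x = (LBINT y. v (x - y) *\<^sub>R K y)"
  using integral_lborel_translate_reflect(2)[of "\<lambda>y. v (x - y) *\<^sub>R K y" x] by (simp add: conv_def)

text \<open>
  Cauchy--Schwarz, used for the near part with the weight \<open>\<kappa>1\<close> distributed evenly over both factors.
\<close>

lemma conv_sq: "(norm (conv v x))\<^sup>2 \<le> 2 * c1 * (LBINT y. \<kappa>1 y * (v (x - y))\<^sup>2) + 2 * c2 * (LBINT y. (v y)\<^sup>2)"
proof -
  let ?a = "LBINT y. \<kappa>1 y * \<bar>v (x - y)\<bar>" and ?b = "LBINT y. \<kappa>2 y * \<bar>v (x - y)\<bar>"
  \<comment> \<open>The contributions of the two majorants are estimated separately.\<close>
  have "norm (conv v x) \<le> (LBINT y. norm (v (x - y) *\<^sub>R K y))" unfolding conv_alt by (rule integral_norm_bound)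
  also have "\<dots> \<le> (LBINT y. \<kappa>1 y * \<bar>v (x - y)\<bar> + \<kappa>2 y * \<bar>v (x - y)\<bar>)"
  proof (rule integral_mono')
    show "integrable lborel (\<lambda>y. \<kappa>1 y * \<bar>v (x - y)\<bar> + \<kappa>2 y * \<bar>v (x - y)\<bar>)"
      by (intro Bochner_Integration.integrable_add near_integrable far_integrable)
    show "norm (v (x - y) *\<^sub>R K y) \<le> \<kappa>1 y * \<bar>v (x - y)\<bar> + \<kappa>2 y * \<bar>v (x - y)\<bar>" for y
      using mult_left_mono[OF K_le[of y], of "\<bar>v (x - y)\<bar>"] by (simp add: distrib_left mult.commute)
  qed (use nonneg in simp)
  also have "\<dots> = ?a + ?b" by (rule Bochner_Integration.integral_add[OF near_integrable far_integrable])
  finally have n: "norm (conv v x) \<le> ?a + ?b" .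
  have "(norm (conv v x))\<^sup>2 \<le> (?a + ?b)\<^sup>2" by (rule power_mono[OF n norm_ge_zero])
  also have "\<dots> \<le> 2 * ?a\<^sup>2 + 2 * ?b\<^sup>2" using sum_squares_bound[of ?a ?b] by (simp add: power2_sum)
  also have "?a\<^sup>2 \<le> c1 * (LBINT y. \<kappa>1 y * (v (x - y))\<^sup>2)"
  proof -
    have s: "integrable lborel (\<lambda>y. (sqrt (\<kappa>1 y))\<^sup>2)" "integrable lborel (\<lambda>y. (sqrt (\<kappa>1 y) * v (x - y))\<^sup>2)"
    proof -
      have "integrable lborel (\<lambda>y. (v (x - y))\<^sup>2 *\<^sub>R \<kappa>1 y)"
      proof (rule integrable_mult_bounded[OF int1, of _ "M\<^sup>2"])
        show "\<bar>(v (x - y))\<^sup>2\<bar> \<le> M\<^sup>2" for y using power_mono[OF vb[of "x - y"], of 2] by simp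
      qed measurable
      then show "integrable lborel (\<lambda>y. (sqrt (\<kappa>1 y) * v (x - y))\<^sup>2)" by (simp add: power_mult_distrib nonneg mult.commute)
    qed (use int1 nonneg in simp)
    have "(LBINT y. \<bar>sqrt (\<kappa>1 y) * (sqrt (\<kappa>1 y) * v (x - y))\<bar>)\<^sup>2 \<le>
        (LBINT y. (sqrt (\<kappa>1 y))\<^sup>2) * (LBINT y. (sqrt (\<kappa>1 y) * v (x - y))\<^sup>2)"
      by (rule cauchy_schwarz_integral[OF _ _ s]) measurable
    then show ?thesis using nonneg by (simp add: c1_def power_mult_distrib abs_mult flip: mult.assoc)
  qed
  also have "?b\<^sup>2 \<le> c2 * (LBINT y. (v y)\<^sup>2)"
  proof -
    have s: "integrable lborel (\<lambda>y. (v (x - y))\<^sup>2)"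
      using integrable_lborel_translate_reflect(2)[OF v2, of x] by simp
    have "(LBINT y. \<bar>\<kappa>2 y * v (x - y)\<bar>)\<^sup>2 \<le> (LBINT y. (\<kappa>2 y)\<^sup>2) * (LBINT y. (v (x - y))\<^sup>2)"
      by (rule cauchy_schwarz_integral[OF _ _ int2 s]) measurable
    moreover have "(LBINT y. (v (x - y))\<^sup>2) = (LBINT y. (v y)\<^sup>2)"
      by (rule integral_lborel_translate_reflect(2)[of "\<lambda>y. (v y)\<^sup>2"]) measurable
    ultimately show ?thesis using nonneg by (simp add: c2_def abs_mult)
  qed
  finally show ?thesis by simp
qed

lemma conv_bounded: "(norm (conv v x))\<^sup>2 \<le> 2 * c1\<^sup>2 * M\<^sup>2 + 2 * c2 * M * (LBINT y. \<bar>v y\<bar>)"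
proof -
  have "(LBINT y. \<kappa>1 y * (v (x - y))\<^sup>2) \<le> (LBINT y. \<kappa>1 y * M\<^sup>2)"
  proof (rule integral_mono')
    show "\<kappa>1 y * (v (x - y))\<^sup>2 \<le> \<kappa>1 y * M\<^sup>2" for y
      using power_mono[OF vb[of "x - y"], of 2] by (intro mult_left_mono nonneg) simp
  qed (use int1 nonneg in auto)
  then have "2 * c1 * (LBINT y. \<kappa>1 y * (v (x - y))\<^sup>2) \<le> 2 * c1 * (c1 * M\<^sup>2)"
    using c_nonneg by (intro mult_left_mono) (auto simp: c1_def)
  moreover have "2 * c2 * (LBINT y. (v y)\<^sup>2) \<le> 2 * c2 * (M * (LBINT y. \<bar>v y\<bar>))"
    using c_nonneg bounded_L1_L2(2)[OF v vb] by (intro mult_left_mono) auto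
  ultimately have "(norm (conv v x))\<^sup>2 \<le> 2 * c1 * (c1 * M\<^sup>2) + 2 * c2 * (M * (LBINT y. \<bar>v y\<bar>))"
    using conv_sq[of x] by linarith
  then show ?thesis by (simp add: power2_eq_square mult_ac)
qed

lemma conv_measurable[measurable]: "conv v \<in> borel_measurable borel"
proof -
  have "(\<lambda>x. LBINT y. v y *\<^sub>R K (x - y)) \<in> borel_measurable lborel"
    by (rule lborel.borel_measurable_lebesgue_integral) (simp add: lborel_prod split_beta', measurable)
  then show ?thesis by (simp add: conv_def[abs_def])
qed

text \<open>
  The near part is estimated by \<open>|h| \<le> B\<close> and Young's convolution inequality, the far part by its supremum times the
  \<open>L\<^sup>2\<close> norm of \<open>h\<close>. In the application \<open>h\<close> is one of the solutions and \<open>v\<close> their difference at a fixed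
  time.
\<close>

lemma conv_weighted:
  fixes h :: "'a \<Rightarrow> real"
  assumes h: "integrable lborel h" "\<And>x. \<bar>h x\<bar> \<le> B"
  shows "integrable lborel (\<lambda>x. (h x)\<^sup>2 * (norm (conv v x))\<^sup>2)"
    and "(LBINT x. (h x)\<^sup>2 * (norm (conv v x))\<^sup>2) \<le>
          (2 * c1\<^sup>2 * B\<^sup>2 + 2 * c2 * B * (LBINT x. \<bar>h x\<bar>)) * (LBINT x. (v x)\<^sup>2)"
proof -
  have hm[measurable]: "h \<in> borel_measurable borel" using h by simp
  let ?V = "LBINT x. (v x)\<^sup>2"
  let ?I = "\<lambda>x. LBINT y. \<kappa>1 y * (v (x - y))\<^sup>2"
  note h2 = bounded_L1_L2[OF h]
  have sh: "(LBINT x. (v (x - y))\<^sup>2) = ?V" for y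
    by (rule integral_lborel_shift[of "\<lambda>x. (v x)\<^sup>2"]) measurable
  have ip: "integrable (lborel \<Otimes>\<^sub>M lborel) (\<lambda>p. \<kappa>1 (fst p) * (v (snd p - fst p))\<^sup>2)"
  proof (rule lborel_pair.Fubini_integrable)
    show "(\<lambda>p. \<kappa>1 (fst p) * (v (snd p - fst p))\<^sup>2) \<in> borel_measurable (lborel \<Otimes>\<^sub>M lborel)" unfolding lborel_prod by measurable
    show "AE y in lborel. integrable lborel (\<lambda>x. \<kappa>1 (fst (y, x)) * (v (snd (y, x) - fst (y, x)))\<^sup>2)"
      using integrable_lborel_shift[OF v2] by simp
    show "integrable lborel (\<lambda>y. LBINT x. norm (\<kappa>1 (fst (y, x)) * (v (snd (y, x) - fst (y, x)))\<^sup>2))"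
      using int1 by (simp add: abs_mult sh nonneg)
  qed
  then have ip': "integrable (lborel \<Otimes>\<^sub>M lborel) (\<lambda>(y, x). \<kappa>1 y * (v (x - y))\<^sup>2)" by (simp add: split_beta')
  have iI: "integrable lborel ?I" using lborel_pair.integrable_snd[OF ip'] .
  have I: "(LBINT x. ?I x) = c1 * ?V"
    using lborel_pair.Fubini_integral[OF ip'] by (simp add: sh c1_def)
  have le: "(h x)\<^sup>2 * (norm (conv v x))\<^sup>2 \<le> 2 * c1 * B\<^sup>2 * ?I x + 2 * c2 * ?V * (h x)\<^sup>2" for x
  proof -
    have I0: "0 \<le> ?I x" using nonneg by simp
    have "(h x)\<^sup>2 * (norm (conv v x))\<^sup>2 \<le> (h x)\<^sup>2 * (2 * c1 * ?I x + 2 * c2 * ?V)"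
      by (intro mult_left_mono conv_sq) auto
    also have "\<dots> = (h x)\<^sup>2 * (2 * c1 * ?I x) + 2 * c2 * ?V * (h x)\<^sup>2" by (simp add: algebra_simps)
    also have "(h x)\<^sup>2 * (2 * c1 * ?I x) \<le> B\<^sup>2 * (2 * c1 * ?I x)"
      using power_mono[OF h(2)[of x], of 2] I0 c_nonneg by (intro mult_right_mono) auto
    finally show ?thesis by (simp add: mult_ac)
  qed
  have ir: "integrable lborel (\<lambda>x. 2 * c1 * B\<^sup>2 * ?I x + 2 * c2 * ?V * (h x)\<^sup>2)" using iI h2(1) by simp
  show il: "integrable lborel (\<lambda>x. (h x)\<^sup>2 * (norm (conv v x))\<^sup>2)"
  proof (rule Bochner_Integration.integrable_bound[OF ir])
    show "AE x in lborel. norm ((h x)\<^sup>2 * (norm (conv v x))\<^sup>2) \<le> norm (2 * c1 * B\<^sup>2 * ?I x + 2 * c2 * ?V * (h x)\<^sup>2)"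
    proof (intro AE_I2)
      fix x
      have "0 \<le> (h x)\<^sup>2 * (norm (conv v x))\<^sup>2" by simp
      with le[of x] show "norm ((h x)\<^sup>2 * (norm (conv v x))\<^sup>2) \<le> norm (2 * c1 * B\<^sup>2 * ?I x + 2 * c2 * ?V * (h x)\<^sup>2)"
        by (simp only: real_norm_def abs_of_nonneg abs_ge_self order_trans)
    qed
  qed measurable
  have "(LBINT x. (h x)\<^sup>2 * (norm (conv v x))\<^sup>2) \<le> (LBINT x. 2 * c1 * B\<^sup>2 * ?I x + 2 * c2 * ?V * (h x)\<^sup>2)"
    by (rule integral_mono[OF il ir le])
  also have "\<dots> = 2 * c1 * B\<^sup>2 * (c1 * ?V) + 2 * c2 * ?V * (LBINT x. (h x)\<^sup>2)"
    using iI h2(1) by (simp add: I)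
  also have "\<dots> \<le> 2 * c1 * B\<^sup>2 * (c1 * ?V) + 2 * c2 * ?V * (B * (LBINT x. \<bar>h x\<bar>))"
    using h2(2) c_nonneg by (intro add_left_mono mult_left_mono) auto
  finally show "(LBINT x. (h x)\<^sup>2 * (norm (conv v x))\<^sup>2) \<le>
          (2 * c1\<^sup>2 * B\<^sup>2 + 2 * c2 * B * (LBINT x. \<bar>h x\<bar>)) * (LBINT x. (v x)\<^sup>2)"
    by (simp add: power2_eq_square algebra_simps)
qed

end

lemma conv_diff:
  assumes "integrable lborel v" "\<And>x. \<bar>v x\<bar> \<le> M" "integrable lborel w" "\<And>x. \<bar>w x\<bar> \<le> M"
  shows "conv (\<lambda>y. v y - w y) x = conv v x - conv w x"
  using conv_integrable[OF assms(1,2), of x] conv_integrable[OF assms(3,4), of x]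
  by (simp add: conv_def scaleR_diff_left)

end

section \<open>Nonlinearities of class \<open>C\<^sup>1\<close>\<close>

lemma C1_lipschitz:
  fixes f :: "real \<Rightarrow> real"
  assumes "f C1_differentiable_on UNIV"
  shows "\<exists>L\<ge>0. \<forall>r s. \<bar>r\<bar> \<le> M \<longrightarrow> \<bar>s\<bar> \<le> M \<longrightarrow> \<bar>f r - f s\<bar> \<le> L * \<bar>r - s\<bar>"
proof -
  obtain D where D: "\<And>x. (f has_vector_derivative D x) (at x)" "continuous_on UNIV D"
    using assms by (auto simp: C1_differentiable_on_def)
  have "bounded (D ` {-M..M})"
    by (intro compact_imp_bounded compact_continuous_image continuous_on_subset[OF D(2)]) auto
  then obtain L where L: "L > 0" "\<And>x. x \<in> {-M..M} \<Longrightarrow> norm (D x) \<le> L" by (auto simp: bounded_pos)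
  have d: "(f has_real_derivative D x) (at x within {-M..M})" for x
    using D(1)[of x] by (simp add: has_real_derivative_iff_has_vector_derivative has_vector_derivative_at_within)
  have "norm (f r - f s) \<le> L * norm (r - s)" if "\<bar>r\<bar> \<le> M" "\<bar>s\<bar> \<le> M" for r s
    by (rule field_differentiable_bound[OF convex_real_interval(5)[of "-M" M] d L(2)]) (use that in auto)
  then show ?thesis using L(1) by (intro exI[of _ L]) auto
qed

lemma strongly_increasing:
  fixes f :: "real \<Rightarrow> real"
  assumes C1: "f C1_differentiable_on UNIV" and a: "\<And>r. deriv f r \<ge> a"
  shows "a * (r - s)\<^sup>2 \<le> (r - s) * (f r - f s)"
proof -
  obtain D where D: "\<And>x. (f has_vector_derivative D x) (at x)"
    using C1 by (auto simp: C1_differentiable_on_def)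
  then have d: "(f has_real_derivative D x) (at x)" for x
    by (simp add: has_real_derivative_iff_has_vector_derivative)
  then have Da: "D x \<ge> a" for x using a[of x] DERIV_imp_deriv[OF d[of x]] by simp
  have less: "a * (r - s)\<^sup>2 \<le> (r - s) * (f r - f s)" if rs: "s < r" for r s
  proof -
    obtain z where z: "f r - f s = (r - s) * D z" using MVT2[OF rs d] by blast
    have "(r - s)\<^sup>2 * a \<le> (r - s)\<^sup>2 * D z" by (intro mult_left_mono Da) simp
    then show ?thesis unfolding z by (simp add: power2_eq_square mult_ac)
  qed
  consider "s < r" | "r = s" | "r < s" by linarith
  then show ?thesis
  proof cases
    case 3
    from less[OF 3] show ?thesis by (simp add: power2_commute[of s r] algebra_simps)
  qed (use less in auto)
qed

lemma C1_continuous: "f C1_differentiable_on UNIV \<Longrightarrow> continuous_on UNIV f" for f :: "real \<Rightarrow> real"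
  by (rule C1_differentiable_imp_continuous_on)

section \<open>Borel representatives and the weak formulation\<close>

lemma QT_borel[measurable]: "(QT T :: (real \<times> (real^'n)) set) \<in> sets borel"
  unfolding QT_def by (intro borel_open open_Times) auto

text \<open>
  Sections of a Lebesgue measurable function in a product need not be measurable, so the solutions are
  first replaced by Borel functions, bounded everywhere and zero outside \<open>QT T\<close>.
\<close>

lemma borel_representative_L1_Linf:
  fixes u :: "real \<times> (real^'n) \<Rightarrow> real"
  assumes "u \<in> Lp_on 1 (QT T) \<inter> Linf_on (QT T)"
  shows "\<exists>U M. U \<in> borel_measurable borel \<and> integrable lborel U \<and> (\<forall>z. \<bar>U z\<bar> \<le> M) \<and>
           (\<forall>z. z \<notin> QT T \<longrightarrow> U z = 0) \<and> (AE z in lborel. z \<in> QT T \<longrightarrow> u z = U z)"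
proof -
  let ?Q = "QT T :: (real \<times> (real^'n)) set"
  have Q: "?Q \<in> sets lebesgue" by simp
  have um: "u \<in> borel_measurable (lebesgue_on ?Q)" and ui: "integrable (lebesgue_on ?Q) (\<lambda>z. norm (u z) powr 1)"
    using assms by (auto simp: Lp_on_def)
  obtain C where C: "AE z in lebesgue_on ?Q. norm (u z) \<le> C" using assms by (auto simp: Linf_on_def)
  have "(\<lambda>z. if z \<in> ?Q then u z else 0) \<in> borel_measurable lebesgue"
    using um Q by (simp add: borel_measurable_if)
  then obtain f where f[measurable]: "f \<in> borel_measurable borel" and fe: "AE z in lborel. (if z \<in> ?Q then u z else 0) = f z"
    using completion_ex_borel_measurable_real[of "\<lambda>z. if z \<in> ?Q then u z else 0" lborel] by auto
  define U where "U z = (if z \<in> ?Q \<and> \<bar>f z\<bar> \<le> C then f z else 0)" for z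
  have Um[measurable]: "U \<in> borel_measurable borel" unfolding U_def[abs_def] by measurable
  have C': "AE z in lborel. z \<in> ?Q \<longrightarrow> \<bar>u z\<bar> \<le> C"
    using C Q by (simp add: AE_restrict_space_iff AE_completion_iff)
  have ae: "AE z in lborel. z \<in> ?Q \<longrightarrow> u z = U z"
    using fe C' by eventually_elim (auto simp: U_def)
  have "integrable lebesgue (\<lambda>z. indicat_real ?Q z *\<^sub>R (norm (u z) powr 1))"
    using ui Q by (simp add: integrable_restrict_space)
  then have "integrable lebesgue U"
  proof (rule Bochner_Integration.integrable_bound)
    show "U \<in> borel_measurable lebesgue" using Um by (simp add: measurable_completion)
    have "AE z in lborel. norm (U z) \<le> norm (indicat_real ?Q z *\<^sub>R (norm (u z) powr 1))"
      using ae by eventually_elim (auto simp: U_def indicator_def)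
    then show "AE z in lebesgue. norm (U z) \<le> norm (indicat_real ?Q z *\<^sub>R (norm (u z) powr 1))" by (rule AE_completion)
  qed
  then have Ui: "integrable lborel U" using Um by (simp add: integrable_completion)
  have "\<bar>U z\<bar> \<le> max C 0" for z by (auto simp: U_def)
  then show ?thesis using Um Ui ae by (intro exI[of _ U] exI[of _ "max C 0"]) (auto simp: U_def)
qed

lemma borel_representative_Linf:
  fixes D :: "real^'n \<Rightarrow> real^'n"
  assumes "D \<in> Linf_on UNIV"
  shows "\<exists>D0 C. D0 \<in> borel_measurable borel \<and> 0 \<le> C \<and> (\<forall>x. norm (D0 x) \<le> C) \<and> (AE x in lborel. D x = D0 x)"
proof -
  have Dm: "D \<in> borel_measurable lebesgue" using assms by (simp add: Linf_on_def lebesgue_on_UNIV_eq)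
  obtain C where "AE x in lebesgue_on UNIV. norm (D x) \<le> C" using assms by (auto simp: Linf_on_def)
  then have C: "AE x in lborel. norm (D x) \<le> C" by (simp add: AE_restrict_space_iff AE_completion_iff)
  have "(\<lambda>x. D x $ i) \<in> borel_measurable lebesgue" for i
    by (rule measurable_compose[OF Dm]) (intro borel_measurable_continuous_onI continuous_intros)
  note c = completion_ex_borel_measurable_real[OF this]
  have "\<exists>f. \<forall>i. f i \<in> borel_measurable borel \<and> (AE x in lborel. D x $ i = f i x)"
  proof (rule choice, rule allI)
    fix i show "\<exists>f. f \<in> borel_measurable borel \<and> (AE x in lborel. D x $ i = f x)"
      using c[of i] unfolding Bex_def measurable_lborel2 .
  qed
  then obtain f where f: "\<And>i. f i \<in> borel_measurable borel" "\<And>i. AE x in lborel. D x $ i = f i x" by blast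
  define g where "g x = (\<chi> i. f i x)" for x
  have g[measurable]: "g \<in> borel_measurable borel"
  proof (subst borel_measurable_euclidean_space, intro ballI)
    fix e :: "real^'n" assume "e \<in> Basis"
    then obtain i where "e = axis i 1" by (auto simp: Basis_vec_def)
    then have "(\<lambda>x. g x \<bullet> e) = f i" by (simp add: g_def inner_axis fun_eq_iff)
    then show "(\<lambda>x. g x \<bullet> e) \<in> borel_measurable borel" using f(1) by simp
  qed
  have "AE x in lborel. \<forall>i\<in>UNIV. D x $ i = f i x" by (rule AE_finite_allI) (auto intro: f(2))
  then have ge: "AE x in lborel. D x = g x" by eventually_elim (simp add: g_def vec_eq_iff)
  define D0 where "D0 x = (if norm (g x) \<le> C then g x else 0)" for x
  have "D0 \<in> borel_measurable borel" unfolding D0_def[abs_def] by measurable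
  moreover have "AE x in lborel. D x = D0 x" using ge C by eventually_elim (auto simp: D0_def)
  moreover have "norm (D0 x) \<le> max C 0" for x by (auto simp: D0_def)
  ultimately show ?thesis by (intro exI[of _ D0] exI[of _ "max C 0"]) auto
qed

text \<open>
  Where \<open>|K| \<le> 1\<close> its square is at most \<open>|K|\<^sup>p\<close>, elsewhere outside the ball it is at most \<open>C\<^sup>2 |K|\<^sup>p\<close>. The value
  at the origin is set to zero to make \<open>K\<close> Borel measurable.
\<close>

lemma kernel_splitting:
  fixes K :: "real^'n \<Rightarrow> real^'n"
  assumes C1: "Ck_on 1 (UNIV - {0}) K" and near: "K \<in> Lp_on 1 (cball 0 1)"
    and far: "\<exists>p. 1 \<le> p \<and> p \<le> 2 \<and> K \<in> Lp_on p (- cball 0 1)" and bdd: "K \<in> Linf_on (- cball 0 1)"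
  shows "\<exists>\<kappa>1 \<kappa>2. split_kernel (\<lambda>x. indicator (UNIV - {0}) x *\<^sub>R K x) \<kappa>1 \<kappa>2"
proof -
  let ?K = "\<lambda>x. indicat_real (UNIV - {0}) x *\<^sub>R K x"
  let ?B = "cball (0::real^'n) 1"
  have cont: "continuous_on (UNIV - {0}) K"
    using C1 by (simp add: One_nat_def differentiable_imp_continuous_on)
  have Km[measurable]: "?K \<in> borel_measurable borel"
    by (rule borel_measurable_continuous_on_indicator[OF _ cont]) simp
  have AE0: "AE x in lborel. K x = ?K x"
    using AE_lborel_singleton[of "0::real^'n"] by eventually_elim simp
  define \<kappa>1 where "\<kappa>1 x = indicat_real ?B x * norm (?K x)" for x
  define \<kappa>2 where "\<kappa>2 x = indicat_real (- ?B) x * norm (?K x)" for x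
  have [measurable]: "?B \<in> sets borel" by simp
  have m[measurable]: "\<kappa>1 \<in> borel_measurable borel" "\<kappa>2 \<in> borel_measurable borel"
    unfolding \<kappa>1_def[abs_def] \<kappa>2_def[abs_def] by measurable
  have "integrable lebesgue (\<lambda>x. indicat_real ?B x *\<^sub>R (norm (K x) powr 1))"
    using near by (simp add: Lp_on_def integrable_restrict_space)
  then have "integrable lebesgue \<kappa>1"
  proof (rule Bochner_Integration.integrable_bound)
    show "\<kappa>1 \<in> borel_measurable lebesgue" using m by (simp add: measurable_completion)
    have "AE x in lborel. norm (\<kappa>1 x) \<le> norm (indicat_real ?B x *\<^sub>R (norm (K x) powr 1))"
      using AE0 by eventually_elim (auto simp: \<kappa>1_def indicator_def)
    then show "AE x in lebesgue. norm (\<kappa>1 x) \<le> norm (indicat_real ?B x *\<^sub>R (norm (K x) powr 1))" by (rule AE_completion)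
  qed
  then have i1: "integrable lborel \<kappa>1" using m by (simp add: integrable_completion)
  obtain p where p: "1 \<le> p" "p \<le> 2" "K \<in> Lp_on p (- ?B)" using far by blast
  obtain C where "AE x in lebesgue_on (- ?B). norm (K x) \<le> C" using bdd by (auto simp: Linf_on_def)
  then have C: "AE x in lborel. x \<in> - ?B \<longrightarrow> norm (K x) \<le> C"
    by (simp add: AE_restrict_space_iff AE_completion_iff)
  have "integrable lebesgue (\<lambda>x. indicat_real (- ?B) x *\<^sub>R (norm (K x) powr p))"
    using p(3) by (simp add: Lp_on_def integrable_restrict_space)
  then have "integrable lebesgue (\<lambda>x. (1 + C\<^sup>2) * (indicat_real (- ?B) x *\<^sub>R (norm (K x) powr p)))"
    by (rule integrable_mult_right)
  then have "integrable lebesgue (\<lambda>x. (\<kappa>2 x)\<^sup>2)"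
  proof (rule Bochner_Integration.integrable_bound)
    have "(\<lambda>x. (\<kappa>2 x)\<^sup>2) \<in> borel_measurable lborel" by measurable
    then show "(\<lambda>x. (\<kappa>2 x)\<^sup>2) \<in> borel_measurable lebesgue" by (rule measurable_completion)
    have "AE x in lborel. norm ((\<kappa>2 x)\<^sup>2) \<le> norm ((1 + C\<^sup>2) * (indicat_real (- ?B) x *\<^sub>R (norm (K x) powr p)))"
      using AE0 C
    proof eventually_elim
      case (elim x)
      show ?case
      proof (cases "x \<in> ?B")
        case False
        define n where "n = norm (K x)"
        have n: "0 \<le> n" "n \<le> C" using elim False by (auto simp: n_def)
        have "n\<^sup>2 \<le> (1 + C\<^sup>2) * n powr p"
        proof (cases "n \<le> 1")
          case True
          have "n\<^sup>2 \<le> n powr p"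
          proof (cases "n = 0")
            case False
            then have "n\<^sup>2 = n powr 2" using n by (simp add: powr_numeral)
            also have "\<dots> \<le> n powr p" using n True p by (intro powr_mono') auto
            finally show ?thesis .
          qed simp
          also have "\<dots> \<le> (1 + C\<^sup>2) * n powr p" by (simp add: mult_le_cancel_right1)
          finally show ?thesis .
        next
          case False
          have "n\<^sup>2 \<le> C\<^sup>2" using n by (intro power_mono) auto
          also have "\<dots> \<le> (1 + C\<^sup>2) * 1" by simp
          also have "\<dots> \<le> (1 + C\<^sup>2) * n powr p" using False p by (intro mult_left_mono ge_one_powr_ge_zero) auto
          finally show ?thesis .
        qed
        then show ?thesis using elim(1) False by (simp add: \<kappa>2_def n_def)
      qed (simp add: \<kappa>2_def)
    qed
    then show "AE x in lebesgue. norm ((\<kappa>2 x)\<^sup>2) \<le> norm ((1 + C\<^sup>2) * (indicat_real (- ?B) x *\<^sub>R (norm (K x) powr p)))"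
      by (rule AE_completion)
  qed
  then have i2: "integrable lborel (\<lambda>x. (\<kappa>2 x)\<^sup>2)" by (simp add: integrable_completion)
  have "split_kernel ?K \<kappa>1 \<kappa>2"
  proof
    show "norm (?K y) \<le> \<kappa>1 y + \<kappa>2 y" for y by (auto simp: \<kappa>1_def \<kappa>2_def indicator_def)
    show "0 \<le> \<kappa>1 y" "0 \<le> \<kappa>2 y" for y by (auto simp: \<kappa>1_def \<kappa>2_def)
  qed (use i1 i2 m Km in auto)
  then show ?thesis by blast
qed

lemma AE_pair_fst:
  assumes "AE t in lborel. P t"
  shows "AE z in (lborel :: ('a::euclidean_space \<times> 'b::euclidean_space) measure). P (fst z)"
proof -
  obtain N where N: "N \<in> null_sets lborel" "{t. \<not> P t} \<subseteq> N"
    using assms by (auto simp: eventually_ae_filter)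
  have "N \<times> (UNIV::'b set) \<in> null_sets (lborel \<Otimes>\<^sub>M lborel)"
    by (rule lborel.times_in_null_sets1[OF N(1)]) simp
  then have "N \<times> (UNIV::'b set) \<in> null_sets lborel" by (simp add: lborel_prod)
  moreover have "{z. \<not> P (fst z)} \<subseteq> N \<times> (UNIV::'b set)" using N(2) by auto
  ultimately show ?thesis by (auto simp: eventually_ae_filter)
qed

lemma AE_pair_snd:
  assumes "AE x in lborel. P x"
  shows "AE z in (lborel :: ('a::euclidean_space \<times> 'b::euclidean_space) measure). P (snd z)"
proof -
  obtain N where N: "N \<in> null_sets lborel" "{t. \<not> P t} \<subseteq> N"
    using assms by (auto simp: eventually_ae_filter)
  have "(UNIV::'a set) \<times> N \<in> null_sets (lborel \<Otimes>\<^sub>M lborel)"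
    by (rule lborel.times_in_null_sets2[OF _ N(1)]) simp
  then have "(UNIV::'a set) \<times> N \<in> null_sets lborel" by (simp add: lborel_prod)
  moreover have "{z. \<not> P (snd z)} \<subseteq> (UNIV::'a set) \<times> N" using N(2) by auto
  ultimately show ?thesis by (auto simp: eventually_ae_filter)
qed

text \<open>
  The measurability of \<open>f\<close> is a consequence of completeness.
\<close>

lemma integral_lebesgue_eq_lborel:
  fixes f g :: "'a::euclidean_space \<Rightarrow> 'b::euclidean_space"
  assumes g: "g \<in> borel_measurable borel" and ae: "AE x in lborel. f x = g x"
  shows "integral\<^sup>L lebesgue f = integral\<^sup>L lborel g"
proof -
  have gl: "g \<in> borel_measurable lebesgue" using g by (simp add: measurable_completion)
  have ael: "AE x in lebesgue. g x = f x" using AE_completion[OF ae] by eventually_elim simp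
  have fl: "f \<in> borel_measurable lebesgue" by (rule borel_measurable_AE[OF gl ael])
  have "integral\<^sup>L lebesgue f = integral\<^sup>L lebesgue g"
    by (rule integral_cong_AE[OF fl gl]) (rule AE_completion[OF ae])
  also have "\<dots> = integral\<^sup>L lborel g" using g by (intro integral_completion) simp
  finally show ?thesis .
qed

definition nonlin_flux :: "(real^'n \<Rightarrow> real^'n) \<Rightarrow> (real^'n \<Rightarrow> real^'n) \<Rightarrow> (real \<Rightarrow> real) \<Rightarrow> (real \<times> (real^'n) \<Rightarrow> real) \<Rightarrow> real \<times> (real^'n) \<Rightarrow> real^'n" where
  "nonlin_flux K D b U z = U z *\<^sub>R (b (U z) *\<^sub>R D (snd z) + split_kernel.conv K (\<lambda>y. U (fst z, y)) (snd z))"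

text \<open>
  A Borel representative \<open>U\<close> of a bounded integrable solution together with the local bounds for the
  coefficients on the range of \<open>U\<close>.
\<close>

locale borel_solution = split_kernel K \<kappa>1 \<kappa>2
  for K :: "real^'n \<Rightarrow> real^'n" and \<kappa>1 \<kappa>2 :: "real^'n \<Rightarrow> real" +
  fixes \<beta> b :: "real \<Rightarrow> real" and D :: "real^'n \<Rightarrow> real^'n" and U :: "real \<times> (real^'n) \<Rightarrow> real"
    and T M L Bb dD :: real
  assumes measU[measurable]: "U \<in> borel_measurable borel" and Ui: "integrable lborel U"
    and Ub: "\<And>z. \<bar>U z\<bar> \<le> M" and Usupp: "\<And>z. z \<notin> QT T \<Longrightarrow> U z = 0"
    and \<beta>m[measurable]: "\<beta> \<in> borel_measurable borel" and bm[measurable]: "b \<in> borel_measurable borel"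
    and Dm[measurable]: "D \<in> borel_measurable borel" and Db: "\<And>x. norm (D x) \<le> dD"
    and \<beta>0: "\<beta> 0 = 0" and \<beta>b: "\<And>r. \<bar>r\<bar> \<le> M \<Longrightarrow> \<bar>\<beta> r\<bar> \<le> L * \<bar>r\<bar>"
    and bb: "\<And>r. \<bar>r\<bar> \<le> M \<Longrightarrow> \<bar>b r\<bar> \<le> Bb"
begin

lemma M0: "0 \<le> M" using Ub[of "(0, 0)"] by linarith

lemma dD0: "0 \<le> dD" using Db[of 0] norm_ge_zero[of "D 0"] by linarith

lemma AE_section: "AE t in lborel. integrable lborel (\<lambda>x. U (t, x))"
  using lborel_pair.AE_integrable_fst'[of U] Ui by (simp add: lborel_prod)

definition N :: "real \<Rightarrow> real" where "N t = (LBINT x. \<bar>U (t, x)\<bar>)"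

lemma N_integrable: "integrable lborel N"
  using lborel_pair.integrable_fst'[of "\<lambda>z. \<bar>U z\<bar>"] Ui by (simp add: lborel_prod N_def[abs_def])

lemma N_nonneg: "0 \<le> N t" by (simp add: N_def)

lemma conv_measurable_joint[measurable]:
  "(\<lambda>z. conv (\<lambda>y. U (fst z, y)) (snd z)) \<in> borel_measurable (borel :: (real \<times> (real^'n)) measure)"
proof -
  have "(\<lambda>z::real \<times> (real^'n). LBINT y. U (fst z, y) *\<^sub>R K (snd z - y)) \<in> borel_measurable lborel"
    by (rule lborel.borel_measurable_lebesgue_integral) (simp add: lborel_prod split_beta', measurable)
  then show ?thesis by (simp add: conv_def)
qed

lemma nonlin_flux_measurable[measurable]: "nonlin_flux K D b U \<in> borel_measurable borel"
  unfolding nonlin_flux_def[abs_def] by measurable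

lemma conv_sq_le:
  assumes "integrable lborel (\<lambda>x. U (t, x))"
  shows "(norm (conv (\<lambda>y. U (t, y)) x))\<^sup>2 \<le> 2 * c1\<^sup>2 * M\<^sup>2 + 2 * c2 * M * N t"
  using conv_bounded[OF assms Ub] by (simp add: N_def)

text \<open>
  The square of the drift is bounded linearly in the \<open>L\<^sup>1\<close> norm \<open>N t\<close>; weakening this to a linear bound for
  the drift itself keeps the right-hand side integrable in time.
\<close>

lemma nonlin_flux_bound:
  assumes t: "integrable lborel (\<lambda>x. U (t, x))"
  shows "norm (nonlin_flux K D b U (t, x)) \<le> M * (Bb * dD + 1 + 2 * c1\<^sup>2 * M\<^sup>2 + 2 * c2 * M) * (indicat_real {0<..<T} t + N t)"
proof (cases "0 < t \<and> t < T")
  case False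
  then have "U (t, x) = 0" by (intro Usupp) (auto simp: QT_def)
  moreover have "0 \<le> Bb" using bb[of 0] M0 by auto
  ultimately show ?thesis
    using M0 dD0 c_nonneg N_nonneg[of t] by (simp add: nonlin_flux_def add_nonneg_nonneg mult_nonneg_nonneg)
next
  case True
  define c where "c = norm (conv (\<lambda>y. U (t, y)) x)"
  have Bb0: "0 \<le> Bb" using bb[of 0] M0 by auto
  have "c \<le> 1 + c\<^sup>2"
  proof -
    have "2 * c \<le> 1 + c\<^sup>2" using sum_squares_bound[of 1 c] by simp
    moreover have "0 \<le> c" by (simp add: c_def)
    ultimately show ?thesis by linarith
  qed
  then have c: "c \<le> 1 + (2 * c1\<^sup>2 * M\<^sup>2 + 2 * c2 * M * N t)"
    using conv_sq_le[OF t, of x] by (simp add: c_def)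
  let ?m = "Bb * dD + 1 + 2 * c1\<^sup>2 * M\<^sup>2"
  have m0: "0 \<le> ?m" using Bb0 dD0 by (simp add: add_nonneg_nonneg)
  have "norm (b (U (t, x)) *\<^sub>R D x + conv (\<lambda>y. U (t, y)) x) \<le> Bb * dD + c"
  proof -
    have "norm (b (U (t, x)) *\<^sub>R D x) \<le> Bb * dD"
      unfolding norm_scaleR using bb[OF Ub] Db Bb0 by (intro mult_mono) auto
    then show ?thesis unfolding c_def by (intro order_trans[OF norm_triangle_ineq] add_right_mono)
  qed
  also have "\<dots> \<le> ?m + 2 * c2 * M * N t" using c by simp
  also have "\<dots> \<le> (?m + 2 * c2 * M) * (1 + N t)"
  proof -
    have "0 \<le> ?m * N t" "0 \<le> 2 * c2 * M" using m0 N_nonneg[of t] c_nonneg M0 by simp_all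
    then show ?thesis by (simp only: distrib_left distrib_right mult_1_right)
  qed
  finally have "norm (b (U (t, x)) *\<^sub>R D x + conv (\<lambda>y. U (t, y)) x) \<le> (?m + 2 * c2 * M) * (1 + N t)" .
  then have "\<bar>U (t, x)\<bar> * norm (b (U (t, x)) *\<^sub>R D x + conv (\<lambda>y. U (t, y)) x) \<le> M * ((?m + 2 * c2 * M) * (1 + N t))"
    using Ub[of "(t, x)"] M0 by (intro mult_mono) auto
  then show ?thesis using True by (simp add: nonlin_flux_def mult.assoc)
qed

lemma flux_cutoff_integrable:
  assumes [measurable]: "g \<in> borel_measurable borel" and g: "\<And>x. \<bar>g x\<bar> \<le> B" "\<And>x. norm x > R \<Longrightarrow> g x = 0"
  shows "integrable lborel (\<lambda>z. g (snd z) * nonlin_flux K D b U z $ i)"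
proof -
  have B0: "0 \<le> B" using g(1)[of 0] by linarith
  let ?c = "M * (Bb * dD + 1 + 2 * c1\<^sup>2 * M\<^sup>2 + 2 * c2 * M)"
  let ?w = "\<lambda>z::real \<times> (real^'n). (indicat_real {0<..<T} (fst z) + N (fst z)) * (B * ?c * indicat_real (cball 0 R) (snd z))"
  have [measurable]: "(\<lambda>z. nonlin_flux K D b U z $ i) \<in> borel_measurable borel"
    by (rule measurable_compose[OF nonlin_flux_measurable]) (intro borel_measurable_continuous_onI continuous_intros)
  have iw: "integrable lborel ?w"
  proof (rule integrable_lborel_tensor)
    show "integrable lborel (\<lambda>t. indicat_real {0<..<T} t + N t)"
      by (intro Bochner_Integration.integrable_add integrable_indicat_Ioo N_integrable)
    show "integrable lborel (\<lambda>x::real^'n. B * ?c * indicat_real (cball 0 R) x)"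
      using emeasure_lborel_cball_finite[of "0::real^'n" R] by (simp add: integrable_indicator_iff)
  qed
  show ?thesis
  proof (rule Bochner_Integration.integrable_bound[OF iw])
    show "AE z in lborel. norm (g (snd z) * nonlin_flux K D b U z $ i) \<le> norm (?w z)"
      using AE_pair_fst[OF AE_section]
    proof eventually_elim
      case (elim z)
      show ?case
      proof (cases "norm (snd z) \<le> R")
        case True
        have "\<bar>nonlin_flux K D b U z $ i\<bar> \<le> ?c * (indicat_real {0<..<T} (fst z) + N (fst z))"
          using order_trans[OF component_le_norm_cart nonlin_flux_bound[OF elim, of "snd z"]] by simp
        then have "\<bar>g (snd z)\<bar> * \<bar>nonlin_flux K D b U z $ i\<bar> \<le> B * (?c * (indicat_real {0<..<T} (fst z) + N (fst z)))"
          using g(1) B0 by (intro mult_mono) auto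
        also have "\<dots> = ?w z" using True by simp
        finally have "\<bar>g (snd z) * nonlin_flux K D b U z $ i\<bar> \<le> ?w z" by (simp only: abs_mult)
        then show ?thesis unfolding real_norm_def by (rule order_trans[OF _ abs_ge_self])
      qed (use g(2) in simp)
    qed
  qed measurable
qed

definition weak_integrand :: "(real \<Rightarrow> real) \<Rightarrow> (real \<Rightarrow> real) \<Rightarrow> (real^'n \<Rightarrow> real) \<Rightarrow> real \<times> (real^'n) \<Rightarrow> real" where
  "weak_integrand \<theta> \<theta>' \<psi> z = U z * (\<theta>' (fst z) * \<psi> (snd z)) +
     \<theta> (fst z) * (\<beta> (U z) * laplacian \<psi> (snd z) + nonlin_flux K D b U z \<bullet> grad \<psi> (snd z))"

lemma weak_integrand_integrable:
  assumes \<theta>m[measurable]: "\<theta> \<in> borel_measurable borel" "\<theta>' \<in> borel_measurable borel"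
    and \<theta>: "\<And>t. \<bar>\<theta> t\<bar> \<le> B \<and> \<bar>\<theta>' t\<bar> \<le> B"
    and \<psi>: "esmooth \<psi>" "\<And>x. norm x > R \<Longrightarrow> \<psi> x = 0"
  shows "integrable lborel (weak_integrand \<theta> \<theta>' \<psi>)"
proof -
  have B0: "0 \<le> B" using \<theta>[of 0] by linarith
  note [measurable] = borel_measurable_esmooth[OF \<psi>(1)] borel_measurable_esmooth[OF esmooth_laplacian[OF \<psi>(1)]]
    borel_measurable_esmooth[OF esmooth_pd[OF \<psi>(1)]]
  have o1: "norm x > R \<Longrightarrow> pd i \<psi> x = 0" for x i by (rule pd_outside[OF \<psi>(2)])
  have o2: "norm x > R \<Longrightarrow> laplacian \<psi> x = 0" for x
    unfolding laplacian_esmooth[OF \<psi>(1)] by (intro sum.neutral ballI pd_outside[OF o1])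
  obtain C0 where C0: "\<And>x. \<bar>\<psi> x\<bar> \<le> C0" using esmooth_bounded[OF \<psi>] by blast
  obtain C2 where C2: "\<And>x. \<bar>laplacian \<psi> x\<bar> \<le> C2" using esmooth_bounded[OF esmooth_laplacian[OF \<psi>(1)] o2] by blast
  have "integrable lborel (\<lambda>z. (\<theta>' (fst z) * \<psi> (snd z)) *\<^sub>R U z)"
    by (rule integrable_mult_bounded[OF Ui, of _ "B * C0"]) (use \<theta> C0 B0 in \<open>auto simp: abs_mult intro!: mult_mono\<close>)
  moreover have "integrable lborel (\<lambda>z. (\<theta> (fst z) * laplacian \<psi> (snd z)) *\<^sub>R \<beta> (U z))"
  proof (rule integrable_mult_bounded[of _ _ _ "B * C2"])
    show "integrable lborel (\<lambda>z. \<beta> (U z))"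
    proof (rule Bochner_Integration.integrable_bound[of _ "\<lambda>z. L * U z"])
      have "norm (\<beta> (U z)) \<le> norm (L * U z)" for z
        using \<beta>b[OF Ub[of z]] by (auto simp: abs_mult intro: order_trans[OF _ mult_right_mono[OF abs_ge_self]])
      then show "AE z in lborel. norm (\<beta> (U z)) \<le> norm (L * U z)" by simp
    qed (use Ui in auto)
  qed (use \<theta> C2 B0 in \<open>auto simp: abs_mult intro!: mult_mono\<close>)
  moreover have "integrable lborel (\<lambda>z. \<theta> (fst z) * (nonlin_flux K D b U z \<bullet> grad \<psi> (snd z)))"
  proof -
    have "integrable lborel (\<lambda>z. \<theta> (fst z) * (pd i \<psi> (snd z) * nonlin_flux K D b U z $ i))" for i
    proof -
      obtain C1 where C1: "\<And>x. \<bar>pd i \<psi> x\<bar> \<le> C1" using esmooth_bounded[OF esmooth_pd[OF \<psi>(1)] o1] by blast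
      have "integrable lborel (\<lambda>z. pd i \<psi> (snd z) * nonlin_flux K D b U z $ i)"
        by (rule flux_cutoff_integrable[where g="pd i \<psi>" and R=R, OF _ C1 o1]) measurable
      then have "integrable lborel (\<lambda>z. \<theta> (fst z) *\<^sub>R (pd i \<psi> (snd z) * nonlin_flux K D b U z $ i))"
        by (rule integrable_mult_bounded) (use \<theta> in auto)
      then show ?thesis by simp
    qed
    then have "integrable lborel (\<lambda>z. \<Sum>i\<in>UNIV. \<theta> (fst z) * (pd i \<psi> (snd z) * nonlin_flux K D b U z $ i))"
      by (rule Bochner_Integration.integrable_sum)
    moreover have "\<theta> (fst z) * (nonlin_flux K D b U z \<bullet> grad \<psi> (snd z)) = (\<Sum>i\<in>UNIV. \<theta> (fst z) * (pd i \<psi> (snd z) * nonlin_flux K D b U z $ i))" for z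
      by (simp add: inner_vec_def grad_nth sum_distrib_left mult_ac)
    ultimately show ?thesis by simp
  qed
  ultimately have "integrable lborel (\<lambda>z. (\<theta>' (fst z) * \<psi> (snd z)) *\<^sub>R U z + ((\<theta> (fst z) * laplacian \<psi> (snd z)) *\<^sub>R \<beta> (U z)
     + \<theta> (fst z) * (nonlin_flux K D b U z \<bullet> grad \<psi> (snd z))))"
    by (intro Bochner_Integration.integrable_add)
  moreover have "weak_integrand \<theta> \<theta>' \<psi> = (\<lambda>z. (\<theta>' (fst z) * \<psi> (snd z)) *\<^sub>R U z + ((\<theta> (fst z) * laplacian \<psi> (snd z)) *\<^sub>R \<beta> (U z)
     + \<theta> (fst z) * (nonlin_flux K D b U z \<bullet> grad \<psi> (snd z))))"
    by (rule ext) (simp add: weak_integrand_def algebra_simps)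
  ultimately show ?thesis by (simp only:)
qed

text \<open>
  Passing to the representatives changes the integrand on a null set only. For the nonlocal term this
  holds because, for almost every time, \<open>u(t)\<close> and \<open>U(t)\<close> agree almost everywhere, which makes the
  convolutions equal at every point.
\<close>

lemma weak_form:
  fixes u :: "real \<times> (real^'n) \<Rightarrow> real" and u0 :: "real^'n \<Rightarrow> real" and D' K' :: "real^'n \<Rightarrow> real^'n"
  assumes sol: "distributional_solution \<beta> D' b K' T u0 u"
    and ae: "AE z in lborel. z \<in> QT T \<longrightarrow> u z = U z"
    and D': "AE x in lborel. D' x = D x" and K': "AE x in lborel. K' x = K x"
    and \<theta>: "smooth_real \<theta>" "\<And>t. (\<theta> has_real_derivative \<theta>' t) (at t)" "c < T" "\<And>t. t \<ge> c \<Longrightarrow> \<theta> t = 0"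
    and \<theta>m[measurable]: "\<theta> \<in> borel_measurable borel" "\<theta>' \<in> borel_measurable borel"
    and \<psi>: "esmooth \<psi>" "\<And>x. norm x > R \<Longrightarrow> \<psi> x = 0"
  shows "(LBINT z. weak_integrand \<theta> \<theta>' \<psi> z) + (LINT x|lebesgue. u0 x * (\<theta> 0 * \<psi> x)) = 0"
proof -
  let ?\<phi> = "\<lambda>(t, x). \<theta> t * \<psi> x"
  note [measurable] = borel_measurable_esmooth[OF \<psi>(1)] borel_measurable_esmooth[OF esmooth_laplacian[OF \<psi>(1)]]
  have [measurable]: "(\<lambda>x. grad \<psi> x) \<in> borel_measurable borel"
  proof (subst borel_measurable_euclidean_space, intro ballI)
    fix e :: "real^'n" assume "e \<in> Basis"
    then obtain i where "e = axis i 1" by (auto simp: Basis_vec_def)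
    then have "(\<lambda>x. grad \<psi> x \<bullet> e) = pd i \<psi>" by (simp add: grad_nth inner_axis fun_eq_iff)
    then show "(\<lambda>x. grad \<psi> x \<bullet> e) \<in> borel_measurable borel"
      using borel_measurable_esmooth[OF esmooth_pd[OF \<psi>(1)], of i] by simp
  qed
  have wm: "weak_integrand \<theta> \<theta>' \<psi> \<in> borel_measurable borel" unfolding weak_integrand_def[abs_def] by measurable
  have test: "?\<phi> \<in> test_functions ({0..<T} \<times> UNIV)" by (rule test_function_product[OF \<theta>(1,3,4) \<psi>])
  let ?f = "\<lambda>(t, x). u (t, x) * deriv (\<lambda>s. ?\<phi> (s, x)) t + \<beta> (u (t, x)) * laplacian (\<lambda>y. ?\<phi> (t, y)) x
          + u (t, x) * (drift D' b K' u (t, x) \<bullet> grad (\<lambda>y. ?\<phi> (t, y)) x)"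
  have 0: "(LINT z|lebesgue_on (QT T). ?f z) + (LINT x|lebesgue. u0 x * (\<theta> 0 * \<psi> x)) = 0"
    using bspec[OF sol[unfolded distributional_solution_def, THEN conjunct2, THEN conjunct2, THEN conjunct2] test] by simp
  have dt: "deriv (\<lambda>s. \<theta> s * \<psi> x) t = \<theta>' t * \<psi> x" for t x
    by (rule DERIV_imp_deriv) (auto intro!: derivative_eq_intros \<theta>(2))
  have gr: "grad (\<lambda>y. \<theta> t * \<psi> y) x = \<theta> t *\<^sub>R grad \<psi> x" for t x
    by (simp add: vec_eq_iff grad_nth pd_cmult[OF \<psi>(1)])
  have la: "laplacian (\<lambda>y. \<theta> t * \<psi> y) x = \<theta> t * laplacian \<psi> x" for t x
  proof -
    have "pd i (\<lambda>y. \<theta> t * \<psi> y) = (\<lambda>y. \<theta> t * pd i \<psi> y)" for i by (rule ext, rule pd_cmult[OF \<psi>(1)])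
    then show ?thesis
      by (simp add: laplacian_esmooth \<psi>(1) esmooth.mult esmooth.const pd_cmult esmooth_pd sum_distrib_left)
  qed
  have cv: "AE t in lborel. 0 < t \<and> t < T \<longrightarrow> (\<forall>x. convolve K' (\<lambda>y. u (t, y)) x = conv (\<lambda>y. U (t, y)) x)"
  proof -
    have "AE t in lborel. AE x in lborel. (t, x) \<in> QT T \<longrightarrow> u (t, x) = U (t, x)"
      using ae unfolding lborel_prod[symmetric] by (rule lborel_pair.AE_pair)
    then show ?thesis
    proof eventually_elim
      case (elim t)
      show ?case
      proof (intro impI allI)
        fix x assume t: "0 < t \<and> t < T"
        obtain S where S: "S \<in> null_sets lborel" "{x. K' x \<noteq> K x} \<subseteq> S" using K' by (auto simp: eventually_ae_filter)
        have Kx: "AE y in lborel. K' (x - y) = K (x - y)"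
        proof -
          have [measurable]: "S \<in> sets borel" using S(1) by auto
          have "(\<integral>\<^sup>+y. indicator S (x - y) \<partial>lborel) = 0"
            using S(1) nn_integral_lborel_translate_reflect(2)[of "indicator S" x] by (auto simp: null_sets_def)
          then have "AE y in lborel. indicator S (x - y) = (0::ennreal)"
            by (subst (asm) nn_integral_0_iff_AE) auto
          then show ?thesis
            by eventually_elim (use S(2) in \<open>auto simp: indicator_def split: if_splits\<close>)
        qed
        show "convolve K' (\<lambda>y. u (t, y)) x = conv (\<lambda>y. U (t, y)) x"
          unfolding convolve_def conv_def
        proof (rule integral_lebesgue_eq_lborel)
          show "AE y in lborel. u (t, y) *\<^sub>R K' (x - y) = U (t, y) *\<^sub>R K (x - y)"
            using elim Kx by eventually_elim (use t in \<open>auto simp: QT_def\<close>)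
        qed measurable
      qed
    qed
  qed
  have QTl: "(QT T :: (real \<times> (real^'n)) set) \<in> sets lebesgue" by simp
  have "(LINT z|lebesgue_on (QT T). ?f z) = (LINT z|lebesgue. indicat_real (QT T) z *\<^sub>R ?f z)"
    using QTl by (intro integral_restrict_space) simp
  also have "\<dots> = (LBINT z. weak_integrand \<theta> \<theta>' \<psi> z)"
  proof (rule integral_lebesgue_eq_lborel[OF wm])
    show "AE z in lborel. indicat_real (QT T) z *\<^sub>R ?f z = weak_integrand \<theta> \<theta>' \<psi> z"
      using ae AE_pair_fst[OF cv] AE_pair_snd[OF D']
    proof eventually_elim
      case (elim z)
      obtain t x where z: "z = (t, x)" by (cases z)
      show ?case
      proof (cases "z \<in> QT T")
        case False
        then show ?thesis using Usupp[OF False] by (simp add: weak_integrand_def nonlin_flux_def \<beta>0)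
      next
        case True
        then have t: "0 < t" "t < T" using z by (auto simp: QT_def)
        have u: "u (t, x) = U (t, x)" using elim(1) True z by simp
        have dr: "drift D' b K' u (t, x) = b (U (t, x)) *\<^sub>R D x + conv (\<lambda>y. U (t, y)) x"
          using elim(2,3) t u z by (simp add: drift_def)
        show ?thesis
          using True by (simp add: z dt gr la u dr weak_integrand_def nonlin_flux_def) (simp add: algebra_simps)
      qed
    qed
  qed
  finally show ?thesis using 0 by simp
qed

end

section \<open>Uniqueness\<close>

theorem theorem4p1:
  fixes \<beta> b :: "real \<Rightarrow> real"
    and D K :: "real^'n \<Rightarrow> real^'n"
    and T :: real
    and u0 :: "real^'n \<Rightarrow> real"
    and u1 u2 :: "real \<times> (real^'n) \<Rightarrow> real"
  assumes dim: "CARD('n) \<ge> 2"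
    and i: "\<beta> C1_differentiable_on UNIV" "\<beta> 0 = 0" "\<exists>\<alpha>>0. \<forall>r. deriv \<beta> r \<ge> \<alpha>"
    and ii: "D \<in> Linf_on UNIV \<inter> Lp_on 2 UNIV" "distr_divergence_nonneg D"
    and iii: "b C1_differentiable_on UNIV" "\<forall>r. b r \<ge> 0"
    and iv: "Ck_on 1 (UNIV - {0}) K"
            "K \<in> Lp_on 1 (cball 0 1)"
            "\<exists>p. 1 \<le> p \<and> p \<le> 2 \<and> K \<in> Lp_on p (- cball 0 1)"
            "(\<lambda>x. neg_part (divergence K x)) \<in> Linf_on UNIV"
            "(\<lambda>x. neg_part (K x \<bullet> x) / norm x) \<in> Linf_on (cball 0 1)"
    and v: "K \<in> Linf_on (- cball 0 1)"
    and T: "T > 0"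
    and u0: "u0 \<in> L1loc_on UNIV"
    and u1: "u1 \<in> Lp_on 1 (QT T) \<inter> Linf_on (QT T)" "distributional_solution \<beta> D b K T u0 u1"
    and u2: "u2 \<in> Lp_on 1 (QT T) \<inter> Linf_on (QT T)" "distributional_solution \<beta> D b K T u0 u2"
    and initial: "\<forall>\<psi>\<in>test_functions UNIV.
      ((\<lambda>t. esssup (lebesgue_on {0<..<t})
              (\<lambda>s. ereal (LINT x|lebesgue. (u1 (s, x) - u2 (s, x)) * \<psi> x)))
        \<longlongrightarrow> 0) (at_right 0)"
  shows "AE z in lebesgue_on (QT T). u1 z = u2 z"
proof -
  obtain U1 M1 where U1: "U1 \<in> borel_measurable borel" "integrable lborel U1" "\<And>z. \<bar>U1 z\<bar> \<le> M1"
    "\<And>z. z \<notin> QT T \<Longrightarrow> U1 z = 0" "AE z in lborel. z \<in> QT T \<longrightarrow> u1 z = U1 z"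
    using borel_representative_L1_Linf[OF u1(1)] by blast
  obtain U2 M2 where U2: "U2 \<in> borel_measurable borel" "integrable lborel U2" "\<And>z. \<bar>U2 z\<bar> \<le> M2"
    "\<And>z. z \<notin> QT T \<Longrightarrow> U2 z = 0" "AE z in lborel. z \<in> QT T \<longrightarrow> u2 z = U2 z"
    using borel_representative_L1_Linf[OF u2(1)] by blast
  define M where "M = max M1 M2"
  have M: "\<bar>U1 z\<bar> \<le> M" "\<bar>U2 z\<bar> \<le> M" for z using U1(3)[of z] U2(3)[of z] by (auto simp: M_def)
  have M0: "0 \<le> M" using M(1)[of "(0, 0)"] by linarith
  obtain D0 dD where D0: "D0 \<in> borel_measurable borel" "0 \<le> dD" "\<And>x. norm (D0 x) \<le> dD" "AE x in lborel. D x = D0 x"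
    using borel_representative_Linf[of D] ii(1) by blast
  define K0 where "K0 = (\<lambda>x. indicat_real (UNIV - {0}) x *\<^sub>R K x)"
  obtain \<kappa>1 \<kappa>2 where "split_kernel K0 \<kappa>1 \<kappa>2" using kernel_splitting[OF iv(1-3) v] unfolding K0_def by blast
  then interpret K: split_kernel K0 \<kappa>1 \<kappa>2 .
  have K0: "AE x in lborel. K x = K0 x"
    using AE_lborel_singleton[of "0::real^'n"] by eventually_elim (simp add: K0_def)
  obtain \<alpha> where \<alpha>: "\<alpha> > 0" "\<And>r. deriv \<beta> r \<ge> \<alpha>" using i(3) by blast
  obtain L where L: "L \<ge> 0" "\<And>r s. \<bar>r\<bar> \<le> M \<Longrightarrow> \<bar>s\<bar> \<le> M \<Longrightarrow> \<bar>\<beta> r - \<beta> s\<bar> \<le> L * \<bar>r - s\<bar>"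
    using C1_lipschitz[OF i(1), of M] by blast
  have "(\<lambda>r. r * b r) C1_differentiable_on UNIV"
    by (intro C1_differentiable_on_mult iii(1)) simp
  then obtain Lb where Lb: "Lb \<ge> 0" "\<And>r s. \<bar>r\<bar> \<le> M \<Longrightarrow> \<bar>s\<bar> \<le> M \<Longrightarrow> \<bar>r * b r - s * b s\<bar> \<le> Lb * \<bar>r - s\<bar>"
    using C1_lipschitz[of "\<lambda>r. r * b r" M] by blast
  obtain Bb where Bb: "\<And>r. \<bar>r\<bar> \<le> M \<Longrightarrow> \<bar>b r\<bar> \<le> Bb"
  proof -
    obtain C where C: "C \<ge> 0" "\<And>r s. \<bar>r\<bar> \<le> M \<Longrightarrow> \<bar>s\<bar> \<le> M \<Longrightarrow> \<bar>b r - b s\<bar> \<le> C * \<bar>r - s\<bar>"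
      using C1_lipschitz[OF iii(1), of M] by blast
    have "\<bar>b r\<bar> \<le> \<bar>b 0\<bar> + C * M" if "\<bar>r\<bar> \<le> M" for r
      using C(2)[OF that, of 0] M0 mult_left_mono[OF that C(1)] by simp
    then show thesis by (rule that)
  qed
  have \<beta>m: "\<beta> \<in> borel_measurable borel" and bm: "b \<in> borel_measurable borel"
    by (intro borel_measurable_continuous_onI C1_continuous i(1) iii(1))+
  have \<beta>b: "\<bar>\<beta> r\<bar> \<le> L * \<bar>r\<bar>" if "\<bar>r\<bar> \<le> M" for r using L(2)[OF that, of 0] i(2) M0 by simp
  interpret S1: borel_solution K0 \<kappa>1 \<kappa>2 \<beta> b D0 U1 T M L Bb dD
    by standard (use U1 M D0 \<beta>m bm i(2) \<beta>b Bb in auto)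
  interpret S2: borel_solution K0 \<kappa>1 \<kappa>2 \<beta> b D0 U2 T M L Bb dD
    by standard (use U2 M D0 \<beta>m bm i(2) \<beta>b Bb in auto)
  define Z where "Z z = U1 z - U2 z" for z
  define W where "W z = \<beta> (U1 z) - \<beta> (U2 z)" for z
  define F where "F z = nonlin_flux K0 D0 b U1 z - nonlin_flux K0 D0 b U2 z" for z
  define Cg where "Cg = 3 * Lb\<^sup>2 * dD\<^sup>2 + 12 * K.c1\<^sup>2 * M\<^sup>2 + 6 * K.c2 * M"
  define G where "G t = Cg * (1 * indicat_real {0<..<T} t + (S1.N t + S2.N t))" for t
  note [measurable] = U1(1) U2(1) \<beta>m bm
  have Cg0: "0 \<le> Cg" unfolding Cg_def using K.c_nonneg M0 by (intro add_nonneg_nonneg) auto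
  have out: "(t, x) \<notin> (QT T :: (real \<times> (real^'n)) set)" if "t \<le> 0 \<or> T \<le> t" for t x using that by (auto simp: QT_def)
  interpret E: weak_difference Z W F G T "2 * M" \<alpha> L
  proof
    show "T > 0" "\<alpha> > 0" "L \<ge> 0" by (fact T \<alpha>(1) L(1))+
    show "Z \<in> borel_measurable borel" unfolding Z_def[abs_def] by measurable
    show "W \<in> borel_measurable borel" unfolding W_def[abs_def] by measurable
    show "F \<in> borel_measurable borel" unfolding F_def[abs_def] by measurable
    show "\<bar>Z z\<bar> \<le> 2 * M" for z using M(1)[of z] M(2)[of z] unfolding Z_def by linarith
    show "integrable lborel Z" unfolding Z_def[abs_def] using U1(2) U2(2) by simp
    show "\<bar>W z\<bar> \<le> L * \<bar>Z z\<bar>" for z unfolding W_def Z_def by (rule L(2)[OF M])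
    show "\<alpha> * (Z z)\<^sup>2 \<le> Z z * W z" for z unfolding W_def Z_def by (rule strongly_increasing[OF i(1) \<alpha>(2)])
    show "Z (t, x) = 0" if "t \<le> 0 \<or> T \<le> t" for t x
      using U1(4)[OF out[OF that]] U2(4)[OF out[OF that]] by (simp add: Z_def)
    show "F (t, x) = 0" if "t \<le> 0 \<or> T \<le> t" for t x
      using U1(4)[OF out[OF that]] U2(4)[OF out[OF that]] by (simp add: F_def nonlin_flux_def)
    show "integrable lborel G" unfolding G_def[abs_def]
      by (intro integrable_mult_right Bochner_Integration.integrable_add integrable_indicat_Ioo S1.N_integrable S2.N_integrable)
    show "0 \<le> G t" for t unfolding G_def using Cg0 S1.N_nonneg[of t] S2.N_nonneg[of t] by simp
    show "AE t in lborel. integrable lborel (\<lambda>x. (norm (F (t, x)))\<^sup>2) \<and>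
               (LBINT x. (norm (F (t, x)))\<^sup>2) \<le> G t * (LBINT x. (Z (t, x))\<^sup>2)"
      using S1.AE_section S2.AE_section
    proof eventually_elim
      case (elim t)
      show ?case
      proof (cases "0 < t \<and> t < T")
        case False
        then have "F (t, x) = 0" "Z (t, x) = 0" for x
          using U1(4)[OF out[of t x]] U2(4)[OF out[of t x]] by (auto simp: F_def nonlin_flux_def Z_def)
        then show ?thesis by simp
      next
        case True
        let ?z = "\<lambda>x. Z (t, x)" and ?c1 = "K.conv (\<lambda>y. U1 (t, y))" and ?cz = "K.conv (\<lambda>y. Z (t, y))"
        have zi: "integrable lborel ?z" unfolding Z_def using elim by simp
        have zb: "\<bar>?z x\<bar> \<le> 2 * M" for x using M(1)[of "(t, x)"] M(2)[of "(t, x)"] unfolding Z_def by linarith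
        note z2 = K.bounded_L1_L2(1)[OF zi zb]
        define P where "P = 2 * K.c1\<^sup>2 * M\<^sup>2 + 2 * K.c2 * M * S1.N t"
        have P0: "0 \<le> P" unfolding P_def using K.c_nonneg M0 S1.N_nonneg[of t] by (intro add_nonneg_nonneg) auto
        have cz: "?cz x = ?c1 x - K.conv (\<lambda>y. U2 (t, y)) x" for x
          unfolding Z_def by (rule K.conv_diff) (use elim M in auto)
        \<comment> \<open>Each of the three terms carries exactly one factor \<open>Z\<close>.\<close>
        have Fx: "F (t, x) = (U1 (t, x) * b (U1 (t, x)) - U2 (t, x) * b (U2 (t, x))) *\<^sub>R D0 x + Z (t, x) *\<^sub>R ?c1 x + U2 (t, x) *\<^sub>R ?cz x" for x
          unfolding F_def nonlin_flux_def cz by (simp add: Z_def algebra_simps)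
        have pt: "(norm (F (t, x)))\<^sup>2 \<le> (3 * Lb\<^sup>2 * dD\<^sup>2 + 3 * P) * (Z (t, x))\<^sup>2 + 3 * ((U2 (t, x))\<^sup>2 * (norm (?cz x))\<^sup>2)" for x
        proof -
          let ?a = "Lb * dD * \<bar>Z (t, x)\<bar>" and ?b = "\<bar>Z (t, x)\<bar> * norm (?c1 x)" and ?c = "\<bar>U2 (t, x)\<bar> * norm (?cz x)"
          have "norm ((U1 (t, x) * b (U1 (t, x)) - U2 (t, x) * b (U2 (t, x))) *\<^sub>R D0 x) \<le> (Lb * \<bar>Z (t, x)\<bar>) * dD"
            unfolding norm_scaleR Z_def real_norm_def by (intro mult_mono Lb(2) M D0(3)) (use Lb(1) in auto)
          then have "norm (F (t, x)) \<le> ?a + ?b + ?c"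
            unfolding Fx by (intro order_trans[OF norm_triangle_ineq] add_mono) (auto simp: mult_ac)
          then have "(norm (F (t, x)))\<^sup>2 \<le> (?a + ?b + ?c)\<^sup>2" by (rule power_mono) simp
          also have "\<dots> \<le> 3 * ?a\<^sup>2 + 3 * ?b\<^sup>2 + 3 * ?c\<^sup>2"
          proof -
            have "(a + b + c)\<^sup>2 \<le> 3 * a\<^sup>2 + 3 * b\<^sup>2 + 3 * c\<^sup>2" for a b c :: real
              using sum_squares_bound[of a b] sum_squares_bound[of a c] sum_squares_bound[of b c]
              by (simp add: power2_eq_square algebra_simps)
            then show ?thesis .
          qed
          also have "?b\<^sup>2 \<le> P * (Z (t, x))\<^sup>2"
          proof -
            have "(norm (?c1 x))\<^sup>2 \<le> P" unfolding P_def by (rule S1.conv_sq_le[OF elim(1)])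
            from mult_left_mono[OF this, of "(Z (t, x))\<^sup>2"] show ?thesis by (simp add: power_mult_distrib mult.commute)
          qed
          finally show ?thesis by (simp add: power_mult_distrib algebra_simps)
        qed
        note cw = K.conv_weighted[OF zi zb elim(2) M(2)]
        have ir: "integrable lborel (\<lambda>x. (3 * Lb\<^sup>2 * dD\<^sup>2 + 3 * P) * (Z (t, x))\<^sup>2 + 3 * ((U2 (t, x))\<^sup>2 * (norm (?cz x))\<^sup>2))"
          by (intro Bochner_Integration.integrable_add integrable_mult_right z2 cw(1))
        have Fm: "F \<in> borel_measurable borel" unfolding F_def[abs_def] by measurable
        have "(\<lambda>x. F (t, x)) \<in> borel_measurable borel" by (rule borel_measurable_section[OF Fm])
        then have fm: "(\<lambda>x. (norm (F (t, x)))\<^sup>2) \<in> borel_measurable lborel" by simp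
        have iF: "integrable lborel (\<lambda>x. (norm (F (t, x)))\<^sup>2)"
        proof (rule Bochner_Integration.integrable_bound[OF ir fm], intro AE_I2)
          fix x
          show "norm ((norm (F (t, x)))\<^sup>2) \<le> norm ((3 * Lb\<^sup>2 * dD\<^sup>2 + 3 * P) * (Z (t, x))\<^sup>2 + 3 * ((U2 (t, x))\<^sup>2 * (norm (?cz x))\<^sup>2))"
            using order_trans[OF pt[of x] abs_ge_self] by simp
        qed
        have "(LBINT x. (norm (F (t, x)))\<^sup>2) \<le>
            (LBINT x. (3 * Lb\<^sup>2 * dD\<^sup>2 + 3 * P) * (Z (t, x))\<^sup>2 + 3 * ((U2 (t, x))\<^sup>2 * (norm (?cz x))\<^sup>2))"
          by (rule integral_mono[OF iF ir pt])
        also have "\<dots> = (3 * Lb\<^sup>2 * dD\<^sup>2 + 3 * P) * (LBINT x. (Z (t, x))\<^sup>2) + 3 * (LBINT x. (U2 (t, x))\<^sup>2 * (norm (?cz x))\<^sup>2)"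
          using z2 cw(1) by simp
        also have "\<dots> \<le> (3 * Lb\<^sup>2 * dD\<^sup>2 + 3 * P) * (LBINT x. (Z (t, x))\<^sup>2) +
            3 * ((2 * K.c1\<^sup>2 * M\<^sup>2 + 2 * K.c2 * M * S2.N t) * (LBINT x. (Z (t, x))\<^sup>2))"
          using cw(2) by (intro add_left_mono mult_left_mono) (auto simp: S2.N_def)
        also have "\<dots> = (3 * Lb\<^sup>2 * dD\<^sup>2 + 12 * K.c1\<^sup>2 * M\<^sup>2 + 6 * K.c2 * M * (S1.N t + S2.N t)) * (LBINT x. (Z (t, x))\<^sup>2)"
          unfolding P_def by (simp add: algebra_simps)
        also have "\<dots> \<le> G t * (LBINT x. (Z (t, x))\<^sup>2)"
        proof (rule mult_right_mono)
          define n where "n = S1.N t + S2.N t"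
          define s where "s = 3 * Lb\<^sup>2 * dD\<^sup>2 + 12 * K.c1\<^sup>2 * M\<^sup>2"
          define r where "r = 6 * K.c2 * M"
          have n: "0 \<le> s * n" "0 \<le> r"
            unfolding n_def s_def r_def using S1.N_nonneg[of t] S2.N_nonneg[of t] K.c_nonneg M0 by (auto intro!: mult_nonneg_nonneg add_nonneg_nonneg)
          have "G t = (s + r) * (1 + n)" using True by (simp add: G_def Cg_def n_def s_def r_def)
          also have "\<dots> = s + s * n + r + r * n" by (simp add: algebra_simps)
          finally show "3 * Lb\<^sup>2 * dD\<^sup>2 + 12 * K.c1\<^sup>2 * M\<^sup>2 + 6 * K.c2 * M * (S1.N t + S2.N t) \<le> G t"
            using n unfolding n_def[symmetric] s_def[symmetric] r_def[symmetric] by linarith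
        qed simp
        finally show ?thesis using iF by blast
      qed
    qed
    show "integrable lborel (\<lambda>z. g (snd z) * F z $ i)"
      if "g \<in> borel_measurable borel" "\<And>x. \<bar>g x\<bar> \<le> B" "\<And>x. norm x > R \<Longrightarrow> g x = 0" for g B R i
      using S1.flux_cutoff_integrable[OF that, where i=i] S2.flux_cutoff_integrable[OF that, where i=i]
      by (simp add: F_def right_diff_distrib)
    fix \<theta> \<theta>' :: "real \<Rightarrow> real" and c B R :: real and \<psi> :: "real^'n \<Rightarrow> real"
    assume \<theta>: "smooth_real \<theta>" "\<And>t. (\<theta> has_real_derivative \<theta>' t) (at t)" "c < T" "\<And>t. c \<le> t \<Longrightarrow> \<theta> t = 0"
      "\<And>t. \<bar>\<theta> t\<bar> \<le> B \<and> \<bar>\<theta>' t\<bar> \<le> B"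
      and \<psi>: "esmooth \<psi>" "\<And>x. R < norm x \<Longrightarrow> \<psi> x = 0"
    note \<theta>m = smooth_real_measurable[OF \<theta>(1,2)]
    have w1: "(LBINT z. S1.weak_integrand \<theta> \<theta>' \<psi> z) + (LINT x|lebesgue. u0 x * (\<theta> 0 * \<psi> x)) = 0"
      by (rule S1.weak_form[OF u1(2) U1(5) D0(4) K0 \<theta>(1-4) \<theta>m \<psi>])
    have w2: "(LBINT z. S2.weak_integrand \<theta> \<theta>' \<psi> z) + (LINT x|lebesgue. u0 x * (\<theta> 0 * \<psi> x)) = 0"
      by (rule S2.weak_form[OF u2(2) U2(5) D0(4) K0 \<theta>(1-4) \<theta>m \<psi>])
    have "(LBINT z. S1.weak_integrand \<theta> \<theta>' \<psi> z - S2.weak_integrand \<theta> \<theta>' \<psi> z) = 0"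
      using w1 w2 S1.weak_integrand_integrable[OF \<theta>m \<theta>(5) \<psi>] S2.weak_integrand_integrable[OF \<theta>m \<theta>(5) \<psi>] by simp
    moreover have "S1.weak_integrand \<theta> \<theta>' \<psi> z - S2.weak_integrand \<theta> \<theta>' \<psi> z = Z z * (\<theta>' (fst z) * \<psi> (snd z)) +
           \<theta> (fst z) * (W z * laplacian \<psi> (snd z) + F z \<bullet> grad \<psi> (snd z))" for z
      by (simp add: S1.weak_integrand_def S2.weak_integrand_def Z_def W_def F_def algebra_simps)
    ultimately show "(LBINT z. Z z * (\<theta>' (fst z) * \<psi> (snd z)) +
           \<theta> (fst z) * (W z * laplacian \<psi> (snd z) + F z \<bullet> grad \<psi> (snd z))) = 0" by simp
  qed
  have "AE z in lborel. z \<in> QT T \<longrightarrow> u1 z = u2 z"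
    using E.difference_vanishes U1(5) U2(5) by eventually_elim (simp add: Z_def)
  then show ?thesis
    by (simp add: AE_restrict_space_iff AE_completion_iff)
qed

end
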